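(* Let $\beta>0$ and let $k\ge 1$ be an integer. For $n\ge k$ let $\lambda_k^{(n)}$ be the $k$-th eigenvalue of the random matrix $A_n$, and let $\lambda_k$ be the $k$-th eigenvalue of the random operator $L$ (eigenvalues in both cases listed in decreasing order with multiplicity). Then $\lambda_k^{(n)}$ converges in distribution to $\lambda_k$ as $n\to\infty$.
   Context: The matrix $A_n$: let $\xi_1,\dots,\xi_n$ be i.i.d. $N(0,1)$ random variables. $A_n$ is the $n\times n$ symmetric tridiagonal random matrix with diagonal entries $(A_n)_{ii}=\sqrt{n+1}\,\xi_i-2\beta(n+1)^2$ for $1\le i\le n$, entries $(A_n)_{i,i+1}=(A_n)_{i+1,i}=\beta(n+1)^2$ for $1\le i\le n-1$, and all other entries $0$. The operator $L$: let $H_1=\{h\in L^2[0,1]: h \text{ absolutely continuous},\ h'\in L^2[0,1],\ h(0)=h(1)=0\}$, and let $B$ be a standard Brownian motion on $[0,1]$. The random Schrödinger operator $L u=\beta\,\frac{d^2u}{dx^2}+u\times b'$ (with $b'$ the white noise on $[0,1]$) is defined weakly, i.e. through its form: for all $u,v\in H_1$, $$\langle Lu,v\rangle:=-\beta\int_0^1u'(x)v'(x)\,dx+\int_0^1u(x)v(x)\,dB(x),$$ where $\langle\cdot,\cdot\rangle$ is the $L^2[0,1]$ inner product and the stochastic integral can be written pathwise as $$\int_0^1u(x)v(x)\,dB(x)=-\int_0^1\big(u'(x)v(x)+u(x)v'(x)\big)B(x)\,dx .$$ $L$ has a discrete spectrum $\{\lambda_1,\lambda_2,\dots\}$, and in distribution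 its $k$-th eigenvalue is given by $$\lambda_k\overset{(d)}{=}-\inf_{M_1\subset H_1,\ \dim(M_1)=k}\ \sup_{v\in M_1,\ \|v\|=1}\left\{\beta\int_0^1(v'(x))^2dx+\int_0^1v^2(x)\,dB(x)\right\},$$ where $M_1$ ranges over linear subspaces of $H_1$ of dimension $k$ and $\|\cdot\|$ is the $L^2[0,1]$ norm. *)

theory Defs
  imports
    "HOL-Probability.Probability"
    "HOL-Library.Function_Algebras"
    "Jordan_Normal_Form.Char_Poly"
begin

definition tridiagonal_matrix :: "real \<Rightarrow> nat \<Rightarrow> (nat \<Rightarrow> real) \<Rightarrow> real mat" where
  "tridiagonal_matrix \<beta> n x = mat n n (\<lambda>(i, j).
     \<comment> \<open>rows and columns are counted from 0, the sample \<open>x\<close> from 1\<close>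
     if i = j then sqrt (real n + 1) * x (i + 1) - 2 * \<beta> * (real n + 1)\<^sup>2
     else if j = i + 1 \<or> i = j + 1 then \<beta> * (real n + 1)\<^sup>2
     else 0)"

text \<open>Only the real roots of the characteristic polynomial are listed; for a symmetric matrix
  these are all of its eigenvalues. The \<open>k\<close>-th eigenvalue (\<open>k \<ge> 1\<close>) is entry \<open>k - 1\<close> of the list.\<close>

definition eigenvalues_decreasing :: "real mat \<Rightarrow> real list" where
  "eigenvalues_decreasing A = rev (sorted_list_of_multiset (proots (char_poly A)))"

definition standard_brownian_motion :: "'a measure \<Rightarrow> (real \<Rightarrow> 'a \<Rightarrow> real) \<Rightarrow> bool" where
  "standard_brownian_motion M B \<longleftrightarrow>
     prob_space M \<and>
     (\<forall>t\<in>{0..1}. B t \<in> borel_measurable M) \<and>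
     (AE \<omega> in M. B 0 \<omega> = 0) \<and>
     (\<forall>\<omega>\<in>space M. continuous_on {0..1} (\<lambda>t. B t \<omega>)) \<and>
     (\<forall>s t. 0 \<le> s \<and> s < t \<and> t \<le> 1 \<longrightarrow>
        distributed M lborel (\<lambda>\<omega>. B t \<omega> - B s \<omega>) (normal_density 0 (sqrt (t - s)))) \<and>
     (\<forall>m t. strict_mono_on {0..m} t \<and> t ` {0..m} \<subseteq> {0..1} \<longrightarrow>
        prob_space.indep_vars M (\<lambda>_. borel) (\<lambda>i \<omega>. B (t (Suc i)) \<omega> - B (t i) \<omega>) {..<m::nat})"

definition absolutely_continuous_fun_on :: "real \<Rightarrow> real \<Rightarrow> (real \<Rightarrow> real) \<Rightarrow> bool" where
  "absolutely_continuous_fun_on a b f \<longleftrightarrow>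
     (\<forall>\<epsilon>>0. \<exists>\<delta>>0. \<forall>(m::nat) s t.
        (\<forall>i<m. a \<le> s i \<and> s i \<le> t i \<and> t i \<le> b) \<longrightarrow>
        (\<forall>i<m. \<forall>j<m. i \<noteq> j \<longrightarrow> {s i<..<t i} \<inter> {s j<..<t j} = {}) \<longrightarrow>
        (\<Sum>i<m. t i - s i) < \<delta> \<longrightarrow>
        (\<Sum>i<m. \<bar>f (t i) - f (s i)\<bar>) < \<epsilon>)"

definition square_integrable_01 :: "(real \<Rightarrow> real) \<Rightarrow> bool" where
  "square_integrable_01 f \<longleftrightarrow>
     set_borel_measurable lebesgue {0..1} f \<and> set_integrable lebesgue {0..1} (\<lambda>x. (f x)\<^sup>2)"

text \<open>Elements of \<open>H1\<close> are functions on \<open>[0, 1]\<close>; each is represented by its extension by zero to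
  the real line, so that equality on \<open>[0, 1]\<close> is equality of the representatives. The almost
  everywhere existence of \<open>h'\<close> follows from absolute continuity; it is written out because
  \<^const>\<open>deriv\<close> is a total function.\<close>

definition H1 :: "(real \<Rightarrow> real) set" where
  "H1 = {h. square_integrable_01 h \<and>
            absolutely_continuous_fun_on 0 1 h \<and>
            (AE x in lebesgue. x \<in> {0..1} \<longrightarrow> h field_differentiable at x) \<and>
            square_integrable_01 (deriv h) \<and>
            h 0 = 0 \<and> h 1 = 0 \<and>
            (\<forall>x. x \<notin> {0..1} \<longrightarrow> h x = 0)}"

definition inner_01 :: "(real \<Rightarrow> real) \<Rightarrow> (real \<Rightarrow> real) \<Rightarrow> real" where
  "inner_01 u v = (LINT x:{0..1}|lebesgue. u x * v x)"

text \<open>The pathwise value of the stochastic integral of \<open>u v\<close> against the path \<open>b\<close>.\<close>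

definition noise_form :: "(real \<Rightarrow> real) \<Rightarrow> (real \<Rightarrow> real) \<Rightarrow> (real \<Rightarrow> real) \<Rightarrow> real" where
  "noise_form b u v = - (LINT x:{0..1}|lebesgue. (deriv u x * v x + u x * deriv v x) * b x)"

definition schroedinger_form ::
  "real \<Rightarrow> (real \<Rightarrow> real) \<Rightarrow> (real \<Rightarrow> real) \<Rightarrow> (real \<Rightarrow> real) \<Rightarrow> real" where
  "schroedinger_form \<beta> b u v = - \<beta> * inner_01 (deriv u) (deriv v) + noise_form b u v"

text \<open>The weak solutions of \<open>L u = t u\<close>, including \<open>0\<close>, for the path \<open>b\<close>.\<close>

definition schroedinger_eigenspace ::
  "real \<Rightarrow> (real \<Rightarrow> real) \<Rightarrow> real \<Rightarrow> (real \<Rightarrow> real) set" where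
  "schroedinger_eigenspace \<beta> b t =
     {u \<in> H1. \<forall>v\<in>H1. schroedinger_form \<beta> b u v = t * inner_01 u v}"

interpretation fun_vs: vector_space "\<lambda>(c::real) (f::real \<Rightarrow> real) x. c * f x"
  by unfold_locales (auto simp: fun_eq_iff algebra_simps)

text \<open>The sequence \<open>l\<close> lists the spectrum in decreasing order with multiplicity: each real \<open>t\<close>
  occurs in \<open>l\<close> as often as the dimension of its eigenspace says (so not at all if \<open>t\<close> is not an
  eigenvalue). At most one sequence has this property.\<close>

definition lists_schroedinger_eigenvalues ::
  "real \<Rightarrow> (real \<Rightarrow> real) \<Rightarrow> (nat \<Rightarrow> real) \<Rightarrow> bool" where
  "lists_schroedinger_eigenvalues \<beta> b l \<longleftrightarrow>
     antimono l \<and>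
     (\<forall>t. finite {i. l i = t} \<and>
          (\<exists>S. finite S \<and> fun_vs.independent S \<and>
               fun_vs.span S = schroedinger_eigenspace \<beta> b t \<and>
               card S = card {i. l i = t}))"

definition schroedinger_eigenvalue :: "real \<Rightarrow> (real \<Rightarrow> real) \<Rightarrow> nat \<Rightarrow> real" where
  "schroedinger_eigenvalue \<beta> b k = (THE l. lists_schroedinger_eigenvalues \<beta> b l) (k - 1)"

end

theory Submission
  imports Defs
begin

text \<open>
  For a continuous path \<open>b\<close> replace the scaled Gaussians by the scaled increments of \<open>b\<close> over the
  grid of mesh \<open>1 / (n + 1)\<close>. The characteristic polynomials of the leading minors of the matrix
  are then, up to constants, the iterates of an Euler scheme for the first-order system
  \<open>\<beta> \<phi>' = \<psi> - b \<phi>\<close>, \<open>\<psi>' = t \<phi> + b \<phi>'\<close>, \<open>\<phi>(0) = 0\<close>, \<open>\<psi>(0) = 1\<close>, which is the eigenvalue equation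
  without any derivative of \<open>b\<close>. Hence the characteristic polynomial converges locally uniformly
  in \<open>t\<close> to a multiple of \<open>\<phi>\<^sub>t(1)\<close>, whose real zeros are the eigenvalues of the operator, each with
  eigenspace spanned by \<open>\<phi>\<^sub>t\<close>. The zeros are simple by the Christoffel--Darboux identity; a bound
  from above, and Sturm's sign-change count with the oscillation of \<open>\<phi>\<^sub>t\<close> as \<open>t \<rightarrow> -\<infinity>\<close>, keep the
  \<open>k\<close>-th zero in a compact set, so the \<open>k\<close>-th eigenvalues converge for every path. For a Brownian
  path the scaled increments are again independent standard normal variables, and convergence at
  every point of the probability space gives convergence in distribution.
\<close>

section \<open>Roots of three-term recurrences\<close>

text \<open>Formally the eigenvalue equation is \<open>\<beta> * u'' + u * b' = t * u\<close>. With
  the quasi-derivative \<open>\<psi> = \<beta> * u' + b * u\<close> in place of \<open>u'\<close>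
  the product \<open>u * b'\<close> is absorbed into \<open>\<psi>'\<close>, so the system makes
  sense for every continuous path. The statement involves only the laws of the matrices, which
  allows coupling all of them to one path although the \<open>\<xi> n\<close> live on unrelated
  spaces. For functions of a real variable, locally uniform convergence does not by itself control
  zeros: two of them may merge, and a zero of the limit without change of sign may be missed. Both
  are excluded by one discrete identity whose right-hand side stays positive uniformly in
  \<open>n\<close>; the scheme is chosen to make that identity exact, not for its accuracy. The
  operator side is a \<open>THE\<close> over complete lists of the spectrum, so convergence of each
  eigenvalue to some zero is not enough: the limits must exhaust the zeros, and every weak
  eigenspace must be computed.\<close>

fun jacobi_poly :: "(nat \<Rightarrow> real) \<Rightarrow> real \<Rightarrow> nat \<Rightarrow> real poly" where
  "jacobi_poly a c 0 = 1"
| "jacobi_poly a c (Suc 0) = [:- a 0, 1:]"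
| "jacobi_poly a c (Suc (Suc j)) =
     [:- a (Suc j), 1:] * jacobi_poly a c (Suc j) - Polynomial.smult (c\<^sup>2) (jacobi_poly a c j)"

text \<open>Keeps the roots as an indexed list, the form in which interlacing and the sorted
  eigenvalues are compared.\<close>

definition root_poly :: "(nat \<Rightarrow> real) \<Rightarrow> nat \<Rightarrow> real poly" where
  "root_poly y n = (\<Prod>i<n. [:- y i, 1:])"

lemma poly_root_poly: "poly (root_poly y n) t = (\<Prod>i<n. t - y i)"
  by (simp add: root_poly_def poly_prod)

lemma root_poly_Suc: "root_poly y (Suc n) = root_poly y n * [:- y n, 1:]"
  by (simp add: root_poly_def)

lemma poly_root_poly_eq_0_iff: "poly (root_poly y n) t = 0 \<longleftrightarrow> (\<exists>i<n. t = y i)"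
  by (auto simp: poly_root_poly)

lemma degree_root_poly: "degree (root_poly y n) = n \<and> lead_coeff (root_poly y n) = 1"
proof (induction n)
  case 0 show ?case by (simp add: root_poly_def)
next
  case (Suc n)
  then have "root_poly y n \<noteq> 0" by auto
  then show ?case
    using Suc degree_mult_eq[of "root_poly y n" "[:- y n, 1:]"] lead_coeff_mult[of "root_poly y n" "[:- y n, 1:]"]
    by (auto simp: root_poly_Suc simp del: mult_pCons_right)
qed

lemma root_poly_sign:
  assumes "m \<le> n" "\<And>i. i < m \<Longrightarrow> t < y i" "\<And>i. m \<le> i \<Longrightarrow> i < n \<Longrightarrow> y i < t"
  shows "(-1) ^ m * poly (root_poly y n) t > 0"
proof -
  have "(\<Prod>i<n. t - y i) = (\<Prod>i<m. t - y i) * (\<Prod>i=m..<n. t - y i)"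
    using assms(1) by (metis atLeast0LessThan prod.atLeastLessThan_concat zero_le)
  moreover have "(\<Prod>i<m. t - y i) = (-1) ^ m * (\<Prod>i<m. y i - t)"
  proof -
    have "(\<Prod>i<m. t - y i) = (\<Prod>i<m. (-1) * (y i - t))" by simp
    then show ?thesis by (simp only: prod.distrib prod_constant card_lessThan)
  qed
  ultimately have "(-1) ^ m * poly (root_poly y n) t
      = ((-1) ^ m * (-1) ^ m) * (\<Prod>i<m. y i - t) * (\<Prod>i=m..<n. t - y i)"
    by (simp add: poly_root_poly)
  also have "\<dots> = (\<Prod>i<m. y i - t) * (\<Prod>i=m..<n. t - y i)"
    by (simp flip: power_add mult_2)
  also have "\<dots> > 0" using assms by (intro mult_pos_pos prod_pos) auto
  finally show ?thesis .
qed

lemma root_poly_dvd: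
  assumes "inj_on x {..<m}" "\<And>i. i < m \<Longrightarrow> poly r (x i) = 0"
  shows "root_poly x m dvd r"
  using assms
proof (induction m)
  case 0 show ?case by (simp add: root_poly_def)
next
  case (Suc m)
  then have "root_poly x m dvd r" by (auto simp: inj_on_def)
  then obtain q where q: "r = root_poly x m * q" by blast
  have "poly (root_poly x m) (x m) \<noteq> 0"
  proof
    assume "poly (root_poly x m) (x m) = 0"
    then obtain i where "i < m" "x m = x i" by (auto simp: poly_root_poly_eq_0_iff)
    then show False using inj_onD[OF Suc.prems(1), of m i] by auto
  qed
  then have "poly q (x m) = 0" using Suc.prems(2)[of m] q by simp
  then have "[:- x m, 1:] dvd q" by (simp add: poly_eq_0_iff_dvd)
  then show ?case unfolding root_poly_Suc q by (rule mult_dvd_mono[OF dvd_refl])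
qed

lemma degree_jacobi_poly: "degree (jacobi_poly a c n) = n \<and> lead_coeff (jacobi_poly a c n) = 1"
proof (induction n rule: induct_nat_012)
  case (ge2 n)
  let ?A = "[:- a (Suc n), 1:] * jacobi_poly a c (Suc n)"
  let ?B = "- Polynomial.smult (c\<^sup>2) (jacobi_poly a c n)"
  have nz: "jacobi_poly a c (Suc n) \<noteq> 0" using ge2 by auto
  have A: "degree ?A = Suc (Suc n)" "lead_coeff ?A = 1"
    using ge2 nz degree_mult_eq[of "[:- a (Suc n), 1:]" "jacobi_poly a c (Suc n)"]
      lead_coeff_mult[of "[:- a (Suc n), 1:]" "jacobi_poly a c (Suc n)"]
    by (auto simp del: mult_pCons_left)
  have B: "degree ?B < degree ?A"
    using ge2 A by (metis degree_minus degree_smult_le le_imp_less_Suc less_Suc_eq)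
  have "degree (?A + ?B) = degree ?A" using B by (rule degree_add_eq_left)
  moreover have "coeff ?B (degree ?A) = 0" using B by (rule coeff_eq_0)
  moreover have "jacobi_poly a c (Suc (Suc n)) = ?A + ?B" by simp
  ultimately show ?case using A by (metis add.right_neutral coeff_add)
qed auto

lemma decreasing_from_steps:
  fixes z :: "nat \<Rightarrow> real"
  assumes "\<And>i. i < j \<Longrightarrow> z (Suc i) < z i" "i < k" "k \<le> j"
  shows "z k < z i"
  using assms(2,3)
proof (induction k)
  case (Suc k)
  then show ?case using assms(1)[of k] by (cases "i = k") auto
qed simp

lemma interlacing_decreasing:
  fixes y z :: "nat \<Rightarrow> real"
  assumes il: "\<And>i. i < j \<Longrightarrow> z (Suc i) < y i \<and> y i < z i" and "i < k"
  shows "k \<le> j \<Longrightarrow> z k < z i" and "k < j \<Longrightarrow> y k < y i"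
proof -
  have z: "z (Suc i) < z i" if "i < j" for i using il[OF that] by linarith
  have y: "y (Suc i) < y i" if "i < j - 1" for i using il[of i] il[of "Suc i"] that by linarith
  show "z k < z i" if "k \<le> j" using decreasing_from_steps[of j z, OF z \<open>i < k\<close> that] .
  show "y k < y i" if "k < j"
    using decreasing_from_steps[of "j - 1" y, OF y \<open>i < k\<close>] that by linarith
qed

text \<open>At a root of one polynomial the recurrence reduces its successor to
  \<open>- c\<^sup>2\<close> times its predecessor. The predecessor alternates in sign along these
  roots by interlacing, hence so does the successor: it has a root in every gap and, by its leading
  coefficient, one above the largest.\<close>

lemma jacobi_poly_interlacing:
  assumes "c \<noteq> 0"
  shows "\<exists>y z. jacobi_poly a c j = root_poly y j \<and> jacobi_poly a c (Suc j) = root_poly z (Suc j) \<and>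
           (\<forall>i<j. z (Suc i) < y i \<and> y i < z i)"
proof (induction j)
  case 0
  have "jacobi_poly a c (Suc 0) = root_poly (\<lambda>_. a 0) (Suc 0)" by (simp add: root_poly_def)
  then show ?case by (auto simp: root_poly_def)
next
  case (Suc j)
  then obtain y z where p: "jacobi_poly a c j = root_poly y j"
    and q: "jacobi_poly a c (Suc j) = root_poly z (Suc j)"
    and il: "\<And>i. i < j \<Longrightarrow> z (Suc i) < y i \<and> y i < z i" by blast
  define r where "r = jacobi_poly a c (Suc (Suc j))"
  have z_dec: "z k < z i" if "i < k" "k \<le> j" for i k
    using interlacing_decreasing(1)[of j z y i k, OF il] that by auto
  have z_le: "z k \<le> z i" if "i \<le> k" "k \<le> j" for i k
    using z_dec[of i k] that by (cases "i = k") auto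
  have rz: "(-1) ^ i * poly r (z i) < 0" if "i \<le> j" for i
  proof -
    have "(-1) ^ i * poly (root_poly y j) (z i) > 0"
    proof (rule root_poly_sign)
      fix k assume "k < i"
      then show "z i < y k" using il[of k] z_le[of "Suc k" i] that by auto
    next
      fix k assume "i \<le> k" "k < j"
      then show "y k < z i" using il[of k] z_le[of i k] that by auto
    qed (use that in auto)
    moreover have "poly r (z i) = - (c\<^sup>2 * poly (root_poly y j) (z i))"
    proof -
      have "poly (jacobi_poly a c (Suc j)) (z i) = 0"
        unfolding q poly_root_poly_eq_0_iff using that by (intro exI[of _ i]) auto
      then show ?thesis using p unfolding r_def by simp
    qed
    ultimately show ?thesis using assms
      by (simp add: mult.left_commute[of _ "c\<^sup>2"] zero_less_mult_iff)
  qed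
  have ex: "\<exists>e. poly r e = 0 \<and> z i < e \<and> (i > 0 \<longrightarrow> e < z (i - 1))" if "i \<le> j" for i
  proof (cases "i = 0")
    case True
    have "lead_coeff r = 1" unfolding r_def using degree_jacobi_poly by blast
    then obtain x1 where x1: "\<And>x. x \<ge> x1 \<Longrightarrow> poly r x \<ge> 1"
      using poly_pinfty_gt_lc[of r] by auto
    have "poly r (z 0) < 0" using rz[of 0] by simp
    moreover have "poly r (max x1 (z 0 + 1)) > 0" using x1[of "max x1 (z 0 + 1)"] by auto
    moreover have "z 0 < max x1 (z 0 + 1)" by simp
    ultimately obtain e where "z 0 < e" "poly r e = 0" using poly_IVT_pos by blast
    then show ?thesis using True by blast
  next
    case False
    then obtain i' where i': "i = Suc i'" by (cases i) auto
    have lt: "z i < z i'" using z_dec[of i' i] i' that by auto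
    have "(-1) ^ i * poly r (z i) < 0" "(-1) ^ i' * poly r (z i') < 0"
      using rz[of i] rz[of i'] i' that by auto
    then have "poly r (z i) * poly r (z i') < 0"
      unfolding i' by (cases "even i'") (auto simp: mult_less_0_iff)
    then obtain e where "z i < e" "e < z i'" "poly r e = 0" using poly_IVT[OF lt] by blast
    then show ?thesis using i' by auto
  qed
  then obtain x where x: "\<And>i. i \<le> j \<Longrightarrow> poly r (x i) = 0 \<and> z i < x i \<and> (i > 0 \<longrightarrow> x i < z (i - 1))"
    by metis
  have x_dec: "x k < x i" if "i < k" "k \<le> j" for i k
  proof (rule decreasing_from_steps[of j x, OF _ that])
    fix i assume "i < j"
    then show "x (Suc i) < x i" using x[of i] x[of "Suc i"] by auto
  qed
  have "inj_on x {..<Suc j}"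
    by (intro linorder_inj_onI) (use x_dec in \<open>force simp: less_Suc_eq_le\<close>)+
  \<comment> \<open>The \<open>j + 1\<close> roots found so far leave a monic linear cofactor, which
    supplies the remaining root.\<close>
  then have "root_poly x (Suc j) dvd r" by (rule root_poly_dvd) (use x in auto)
  then obtain s where s: "r = root_poly x (Suc j) * s" by blast
  have r: "degree r = Suc (Suc j)" "lead_coeff r = 1"
    unfolding r_def using degree_jacobi_poly by blast+
  then have "s \<noteq> 0" "root_poly x (Suc j) \<noteq> 0" using s by auto
  then have s1: "degree s = 1" "lead_coeff s = 1"
    using r degree_root_poly[of x "Suc j"] degree_mult_eq[of "root_poly x (Suc j)" s]
      lead_coeff_mult[of "root_poly x (Suc j)" s] unfolding s by auto
  obtain e0 s' where e0: "s = pCons e0 s'" by (cases s)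
  with s1 have "s' \<noteq> 0" "degree s' = 0" by (auto split: if_splits)
  then have "s' = [:1:]" using s1 e0 by (auto elim: degree_eq_zeroE)
  then obtain e where e: "s = [:- e, 1:]" using e0 by (metis minus_minus)
  define x' where "x' = x (Suc j := e)"
  have "root_poly x' (Suc j) = root_poly x (Suc j)"
    unfolding root_poly_def x'_def by (rule prod.cong) auto
  then have r': "r = root_poly x' (Suc (Suc j))"
    using s e root_poly_Suc[of x' "Suc j"] by (simp add: x'_def)
  \<comment> \<open>All other roots lie above \<open>z j\<close>, so the known sign of
    \<open>r\<close> at \<open>z j\<close> decides on which side the last root is. This replaces an
    argument at minus infinity.\<close>
  have "e < z j"
  proof -
    have "(-1) ^ Suc j * poly (root_poly x (Suc j)) (z j) > 0"
    proof (rule root_poly_sign)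
      fix i assume "i < Suc j"
      then show "z j < x i" using x[of i] z_le[of i j] by auto
    qed auto
    moreover have "(-1) ^ j * (poly (root_poly x (Suc j)) (z j) * (z j - e)) < 0"
      using rz[of j] unfolding s e poly_mult by simp
    ultimately show ?thesis by (cases "even j") (auto simp: zero_less_mult_iff mult_less_0_iff)
  qed
  then have "x' (Suc i) < z i \<and> z i < x' i" if "i < Suc j" for i
    using that x[of i] x[of "Suc i"] by (cases "i = j") (auto simp: x'_def)
  then show ?case using q r' unfolding r_def by blast
qed

section \<open>Sturm counts: the number of roots above a level\<close>

lemma decreasing_threshold:
  fixes y :: "nat \<Rightarrow> real"
  assumes "\<And>i k. i < k \<Longrightarrow> k < n \<Longrightarrow> y k < y i"
  obtains m where "m \<le> n" "\<And>i. i < m \<Longrightarrow> t < y i" "\<And>i. m \<le> i \<Longrightarrow> i < n \<Longrightarrow> y i \<le> t"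
    "card {s. poly (root_poly y n) s = 0 \<and> t < s} = m"
proof -
  define m where "m = (LEAST m. m \<ge> n \<or> y m \<le> t)"
  have m: "m \<ge> n \<or> y m \<le> t" unfolding m_def by (rule LeastI[of _ n]) simp
  have mn: "m \<le> n" unfolding m_def by (rule Least_le) simp
  have lt: "t < y i" if "i < m" for i using not_less_Least[OF that[unfolded m_def]] by simp
  have ge: "y i \<le> t" if "m \<le> i" "i < n" for i
    using m that assms[of m i] by (cases "i = m") auto
  have "{s. poly (root_poly y n) s = 0 \<and> t < s} = y ` {..<m}"
  proof (intro equalityI subsetI)
    fix s assume "s \<in> {s. poly (root_poly y n) s = 0 \<and> t < s}"
    then obtain i where "i < n" "s = y i" "t < y i" by (auto simp: poly_root_poly_eq_0_iff)
    then show "s \<in> y ` {..<m}" using ge[of i] by (cases "i < m") auto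
  next
    fix s assume "s \<in> y ` {..<m}"
    then obtain i where "i < m" "s = y i" by auto
    then show "s \<in> {s. poly (root_poly y n) s = 0 \<and> t < s}"
      using lt mn by (auto simp: poly_root_poly_eq_0_iff intro!: exI[of _ i])
  qed
  moreover have "inj_on y {..<m}"
    by (intro linorder_inj_onI) (use assms mn in \<open>force\<close>)+
  ultimately have "card {s. poly (root_poly y n) s = 0 \<and> t < s} = m" by (simp add: card_image)
  with mn lt ge that show ?thesis by blast
qed

text \<open>A set of roots suffices for counting eigenvalues: for \<open>c \<noteq> 0\<close> all
  roots are simple by \<open>jacobi_poly_roots\<close>.\<close>

definition nroots_above :: "(nat \<Rightarrow> real) \<Rightarrow> real \<Rightarrow> nat \<Rightarrow> real \<Rightarrow> nat" where
  "nroots_above a c n t = card {s. poly (jacobi_poly a c n) s = 0 \<and> t < s}"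

lemma jacobi_poly_roots:
  assumes "c \<noteq> 0"
  obtains y where "jacobi_poly a c n = root_poly y n" "\<And>i k. i < k \<Longrightarrow> k < n \<Longrightarrow> y k < y i"
proof -
  obtain y z where y: "jacobi_poly a c n = root_poly y n"
    and il: "\<And>i. i < n \<Longrightarrow> z (Suc i) < y i \<and> y i < z i"
    using jacobi_poly_interlacing[OF assms, of a n] by blast
  have "y k < y i" if "i < k" "k < n" for i k
    using interlacing_decreasing(2)[of n z y i k, OF il] that by auto
  with y that show ?thesis by blast
qed

text \<open>The sign-change count of Sturm, with the convention that a zero counts as a sign change
  with its successor.\<close>

lemma nroots_above_Suc:
  assumes "c \<noteq> 0"
  shows "nroots_above a c (Suc j) t = nroots_above a c j t +
    (if poly (jacobi_poly a c j) t = 0 \<or>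
        poly (jacobi_poly a c j) t * poly (jacobi_poly a c (Suc j)) t < 0 then 1 else 0)"
proof -
  obtain y z where p: "jacobi_poly a c j = root_poly y j"
    and q: "jacobi_poly a c (Suc j) = root_poly z (Suc j)"
    and il: "\<And>i. i < j \<Longrightarrow> z (Suc i) < y i \<and> y i < z i"
    using jacobi_poly_interlacing[OF assms, of a j] by blast
  have z_dec: "z k < z i" if "i < k" "k < Suc j" for i k
    using interlacing_decreasing(1)[of j z y i k, OF il] that by auto
  have y_dec: "y k < y i" if "i < k" "k < j" for i k
    using interlacing_decreasing(2)[of j z y i k, OF il] that by auto
  obtain m where m: "m \<le> j" "\<And>i. i < m \<Longrightarrow> t < y i" "\<And>i. m \<le> i \<Longrightarrow> i < j \<Longrightarrow> y i \<le> t"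
    "nroots_above a c j t = m"
    using decreasing_threshold[of j y t] y_dec p unfolding nroots_above_def by auto
  obtain m' where m': "m' \<le> Suc j" "\<And>i. i < m' \<Longrightarrow> t < z i"
    "\<And>i. m' \<le> i \<Longrightarrow> i < Suc j \<Longrightarrow> z i \<le> t" "nroots_above a c (Suc j) t = m'"
    using decreasing_threshold[of "Suc j" z t] z_dec q unfolding nroots_above_def by auto
  have zl: "t < z i" if "i < m" for i using m(2)[OF that] il[of i] m(1) that by auto
  have zr: "z i < t" if "m < i" "i < Suc j" for i
    using il[of "i - 1"] m(3)[of "i - 1"] that by (cases i) auto
  \<comment> \<open>Interlacing already places every root of the next polynomial except
    \<open>z m\<close> relative to \<open>t\<close>; the position of \<open>z m\<close> alone
    decides whether the count grows by one.\<close>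
  have zm: "t < z m \<longleftrightarrow> m' = Suc m" "z m \<le> t \<longleftrightarrow> m' = m"
  proof -
    have "m \<le> m'" using zl m'(3)[of m'] m'(1) m(1) by (force simp: not_le[symmetric])
    moreover have "m' \<le> Suc m"
    proof (rule ccontr)
      assume "\<not> m' \<le> Suc m"
      then show False using zr[of "Suc m"] m'(1) m'(2)[of "Suc m"] by auto
    qed
    ultimately have "m' = m \<or> m' = Suc m" by auto
    then show "t < z m \<longleftrightarrow> m' = Suc m" "z m \<le> t \<longleftrightarrow> m' = m"
      using m'(2)[of m] m'(3)[of m] m(1) by fastforce+
  qed
  show ?thesis
  proof (cases "poly (jacobi_poly a c j) t = 0")
    case True
    then obtain i where i: "i < j" "t = y i" using p by (auto simp: poly_root_poly_eq_0_iff)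
    then have "i = m"
      using m(2)[of i] m(3)[of m] y_dec[of m i] by (cases i m rule: linorder_cases) fastforce+
    then have "t < z m" using i il by auto
    then show ?thesis using True zm m(4) m'(4) by auto
  next
    case False
    have "y i < t" if "m \<le> i" "i < j" for i
      using m(3)[OF that] False p that by (force simp: poly_root_poly_eq_0_iff)
    then have sp: "(-1) ^ m * poly (jacobi_poly a c j) t > 0"
      unfolding p using m by (intro root_poly_sign) auto
    consider "t < z m" | "t = z m" | "z m < t" by linarith
    then show ?thesis
    proof cases
      case 1
      have "(-1) ^ (Suc m) * poly (jacobi_poly a c (Suc j)) t > 0"
        unfolding q using m zl zr 1 by (intro root_poly_sign) (auto simp: less_Suc_eq)
      then show ?thesis using sp zm 1 m(4) m'(4)
        by (cases "even m") (auto simp: mult_less_0_iff)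
    next
      case 2
      then have "poly (jacobi_poly a c (Suc j)) t = 0"
        unfolding q poly_root_poly_eq_0_iff using m(1) by (intro exI[of _ m]) auto
      then show ?thesis using zm 2 m(4) m'(4) False by auto
    next
      case 3
      have "(-1) ^ m * poly (jacobi_poly a c (Suc j)) t > 0"
        unfolding q using m zl zr 3 by (intro root_poly_sign) (auto simp: le_less)
      then show ?thesis using sp zm 3 m(4) m'(4) False
        by (cases "even m") (auto simp: mult_less_0_iff)
    qed
  qed
qed

lemma nroots_above_mono:
  assumes "c \<noteq> 0" "i \<le> j"
  shows "nroots_above a c i t \<le> nroots_above a c j t"
  by (rule lift_Suc_mono_le[OF _ assms(2)]) (simp add: nroots_above_Suc[OF assms(1)])

lemma nroots_above_parity:
  assumes "c \<noteq> 0" "poly (jacobi_poly a c n) t \<noteq> 0"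
  shows "(-1) ^ nroots_above a c n t * poly (jacobi_poly a c n) t > 0"
proof -
  obtain y where y: "jacobi_poly a c n = root_poly y n" "\<And>i k. i < k \<Longrightarrow> k < n \<Longrightarrow> y k < y i"
    using jacobi_poly_roots[OF assms(1)] by blast
  obtain m where m: "m \<le> n" "\<And>i. i < m \<Longrightarrow> t < y i" "\<And>i. m \<le> i \<Longrightarrow> i < n \<Longrightarrow> y i \<le> t"
    "nroots_above a c n t = m"
    using decreasing_threshold[of n y t] y unfolding nroots_above_def by auto
  have "y i \<noteq> t" if "i < n" for i
    using assms(2) that by (auto simp: y(1) poly_root_poly_eq_0_iff)
  then show ?thesis unfolding m(4) y(1) using m
    by (intro root_poly_sign) (auto simp: less_le)
qed

text \<open>The parity of the count is the sign of the polynomial, so the count must grow wherever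
  the sign changes between two sampled indices. Sampling matters because the limit function gives
  signs at a few points only, not at all grid points.\<close>

lemma nroots_above_alternation:
  assumes "c \<noteq> 0" "\<And>m. m < k \<Longrightarrow> i m \<le> i (Suc m)"
    "\<And>m. m \<le> k \<Longrightarrow> (-1) ^ m * poly (jacobi_poly a c (i m)) t > 0"
  shows "k \<le> nroots_above a c (i k) t"
  using assms(2,3)
proof (induction k)
  case (Suc k)
  have "k \<le> nroots_above a c (i k) t" using Suc by auto
  also have "\<dots> \<le> nroots_above a c (i (Suc k)) t"
    using Suc.prems(1)[of k] by (intro nroots_above_mono[OF assms(1)]) auto
  finally have le: "k \<le> nroots_above a c (i (Suc k)) t" .
  have s: "(-1) ^ Suc k * poly (jacobi_poly a c (i (Suc k))) t > 0" using Suc.prems(2) by blast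
  then have "(-1) ^ nroots_above a c (i (Suc k)) t * poly (jacobi_poly a c (i (Suc k))) t > 0"
    by (intro nroots_above_parity[OF assms(1)]) auto
  with s have "nroots_above a c (i (Suc k)) t \<noteq> k"
    by (cases "even k") (auto simp: zero_less_mult_iff)
  with le show ?case by auto
qed simp

section \<open>Eigenvalues of tridiagonal matrices\<close>

text \<open>Expansion along the last row and then along the last column. The ring is general because
  the entries will be polynomials.\<close>

lemma det_tridiagonal:
  fixes \<alpha> :: "nat \<Rightarrow> 'a::comm_ring_1" and \<gamma> :: 'a
  defines "T \<equiv> \<lambda>n. mat n n (\<lambda>(i, j). if i = j then \<alpha> i else if j = i + 1 \<or> i = j + 1 then \<gamma> else 0)"
  shows "det (T (Suc (Suc n))) = \<alpha> (Suc n) * det (T (Suc n)) - \<gamma> * \<gamma> * det (T n)"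
proof -
  let ?A = "T (Suc (Suc n))"
  have A: "?A \<in> carrier_mat (Suc (Suc n)) (Suc (Suc n))" by (simp add: T_def)
  define D where "D = mat_delete ?A (Suc n) n"
  have D: "D \<in> carrier_mat (Suc n) (Suc n)" by (simp add: D_def T_def mat_delete_def)
  have "det ?A = (\<Sum>j<Suc (Suc n). ?A $$ (Suc n, j) * cofactor ?A (Suc n) j)"
    by (rule laplace_expansion_row[OF A]) simp
  also have "\<dots> = (\<Sum>j<n. ?A $$ (Suc n, j) * cofactor ?A (Suc n) j)
      + \<gamma> * cofactor ?A (Suc n) n + \<alpha> (Suc n) * cofactor ?A (Suc n) (Suc n)"
    by (simp add: T_def)
  also have "(\<Sum>j<n. ?A $$ (Suc n, j) * cofactor ?A (Suc n) j) = 0"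
    by (rule sum.neutral) (auto simp: T_def)
  also have "cofactor ?A (Suc n) (Suc n) = det (T (Suc n))"
  proof -
    have "mat_delete ?A (Suc n) (Suc n) = T (Suc n)"
      by (rule eq_matI) (auto simp: T_def mat_delete_def)
    then show ?thesis by (simp add: cofactor_def)
  qed
  also have "cofactor ?A (Suc n) n = - det D" by (simp add: cofactor_def D_def)
  also have "det D = \<gamma> * det (T n)"
  proof -
    have "det D = (\<Sum>i<Suc n. D $$ (i, n) * cofactor D i n)"
      by (rule laplace_expansion_column[OF D]) simp
    also have "\<dots> = (\<Sum>i<n. D $$ (i, n) * cofactor D i n) + \<gamma> * cofactor D n n"
      by (simp add: D_def mat_delete_def T_def)
    also have "(\<Sum>i<n. D $$ (i, n) * cofactor D i n) = 0"
      by (rule sum.neutral) (auto simp: D_def mat_delete_def T_def)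
    also have "cofactor D n n = det (T n)"
    proof -
      have "mat_delete D n n = T n"
        by (rule eq_matI) (auto simp: D_def T_def mat_delete_def)
      then show ?thesis by (simp add: cofactor_def)
    qed
    finally show ?thesis by simp
  qed
  finally show ?thesis by (simp add: algebra_simps)
qed

definition tridiagonal_diag :: "real \<Rightarrow> nat \<Rightarrow> (nat \<Rightarrow> real) \<Rightarrow> nat \<Rightarrow> real" where
  "tridiagonal_diag \<beta> n x j = sqrt (real n + 1) * x (Suc j) - 2 * \<beta> * (real n + 1)\<^sup>2"

lemma char_poly_tridiagonal_matrix:
  "char_poly (tridiagonal_matrix \<beta> n x) = jacobi_poly (tridiagonal_diag \<beta> n x) (\<beta> * (real n + 1)\<^sup>2) n"
proof -
  define c where "c = \<beta> * (real n + 1)\<^sup>2"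
  define a where "a = tridiagonal_diag \<beta> n x"
  \<comment> \<open>The leading blocks of one matrix of size \<open>n\<close>: the coefficients keep
    their dependence on \<open>n\<close> while the size \<open>m\<close> varies, so
    \<open>T m\<close> does not belong to \<open>tridiagonal_matrix \<beta> m x\<close>.\<close>
  define T where "T m = mat m m (\<lambda>(i, j). if i = j then [:- a i, 1:]
    else if j = i + 1 \<or> i = j + 1 then [:- c:] else 0)" for m
  have "char_poly_matrix (tridiagonal_matrix \<beta> n x) = T n"
    by (rule eq_matI)
      (auto simp: T_def char_poly_matrix_def tridiagonal_matrix_def c_def a_def tridiagonal_diag_def)
  then have "char_poly (tridiagonal_matrix \<beta> n x) = det (T n)" by (simp add: char_poly_def)
  moreover have "det (T m) = jacobi_poly a c m" for m
  proof (induction m rule: induct_nat_012)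
    case 0 show ?case by (simp add: T_def det_dim_zero)
  next
    case 1 show ?case by (simp add: T_def det_single)
  next
    case (ge2 m)
    have "det (T (Suc (Suc m))) = [:- a (Suc m), 1:] * det (T (Suc m)) - [:- c:] * [:- c:] * det (T m)"
      unfolding T_def by (rule det_tridiagonal)
    then show ?case using ge2 by (simp add: power2_eq_square)
  qed
  ultimately show ?thesis by (simp add: a_def c_def)
qed

lemma proots_root_poly: "proots (root_poly y n) = mset (map y [0..<n])"
proof (induction n)
  case (Suc n)
  have "root_poly y n \<noteq> 0" using degree_root_poly[of y n] by auto
  then have "proots (root_poly y (Suc n)) = proots (root_poly y n) + proots [:- y n, 1:]"
    unfolding root_poly_Suc by (intro proots_mult) auto
  then show ?case using Suc by simp
qed (simp add: root_poly_def)

lemma eigenvalues_decreasing_root_poly: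
  assumes "char_poly A = root_poly y n" "\<And>i k. i < k \<Longrightarrow> k < n \<Longrightarrow> y k < y i"
  shows "eigenvalues_decreasing A = map y [0..<n]"
proof -
  have "sorted (rev (map y [0..<n]))"
    unfolding sorted_wrt_rev unfolding sorted_wrt_iff_nth_less using assms(2) by (auto intro: less_imp_le)
  then have "sort (map y [0..<n]) = rev (map y [0..<n])"
    by (intro properties_for_sort) auto
  then show ?thesis
    unfolding eigenvalues_decreasing_def assms(1) proots_root_poly
    by (simp del: mset_map)
qed

lemma eigenvalues_decreasing_tridiagonal_matrix:
  assumes "\<beta> \<noteq> 0"
  obtains y where "eigenvalues_decreasing (tridiagonal_matrix \<beta> n x) = map y [0..<n]"
    "jacobi_poly (tridiagonal_diag \<beta> n x) (\<beta> * (real n + 1)\<^sup>2) n = root_poly y n"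
    "\<And>i k. i < k \<Longrightarrow> k < n \<Longrightarrow> y k < y i"
proof -
  have "\<beta> * (real n + 1)\<^sup>2 \<noteq> 0" using assms by simp
  then obtain y where y: "jacobi_poly (tridiagonal_diag \<beta> n x) (\<beta> * (real n + 1)\<^sup>2) n = root_poly y n"
    "\<And>i k. i < k \<Longrightarrow> k < n \<Longrightarrow> y k < y i"
    using jacobi_poly_roots by blast
  have "eigenvalues_decreasing (tridiagonal_matrix \<beta> n x) = map y [0..<n]"
    by (rule eigenvalues_decreasing_root_poly) (use y char_poly_tridiagonal_matrix in auto)
  with y that show ?thesis by blast
qed

text \<open>The bridge from the sorted list to the Sturm count, used for measurability and for the
  lower bound on the eigenvalues. With indices from 0, entry \<open>k\<close> exceeds
  \<open>t\<close> when more than \<open>k\<close> roots do.\<close>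

lemma less_eigenvalue_iff:
  assumes "\<beta> \<noteq> 0" "k < n"
  shows "t < eigenvalues_decreasing (tridiagonal_matrix \<beta> n x) ! k \<longleftrightarrow>
    k < nroots_above (tridiagonal_diag \<beta> n x) (\<beta> * (real n + 1)\<^sup>2) n t"
proof -
  obtain y where y: "eigenvalues_decreasing (tridiagonal_matrix \<beta> n x) = map y [0..<n]"
    "jacobi_poly (tridiagonal_diag \<beta> n x) (\<beta> * (real n + 1)\<^sup>2) n = root_poly y n"
    "\<And>i k. i < k \<Longrightarrow> k < n \<Longrightarrow> y k < y i"
    using eigenvalues_decreasing_tridiagonal_matrix[OF assms(1)] by blast
  obtain m where m: "m \<le> n" "\<And>i. i < m \<Longrightarrow> t < y i" "\<And>i. m \<le> i \<Longrightarrow> i < n \<Longrightarrow> y i \<le> t"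
    "nroots_above (tridiagonal_diag \<beta> n x) (\<beta> * (real n + 1)\<^sup>2) n t = m"
    using decreasing_threshold[of n y t] y unfolding nroots_above_def by auto
  show ?thesis using m(2)[of k] m(3)[of k] assms(2) y(1) m(4) by (cases "k < m") auto
qed

section \<open>Measurability of the matrix eigenvalues\<close>

lemma borel_measurable_poly_jacobi_poly:
  assumes "\<And>i. i < n \<Longrightarrow> (\<lambda>\<omega>. a \<omega> i) \<in> borel_measurable M"
  shows "j \<le> n \<Longrightarrow> (\<lambda>\<omega>. poly (jacobi_poly (a \<omega>) c j) t) \<in> borel_measurable M"
proof (induction j rule: induct_nat_012)
  case 1
  then show ?case using assms[of 0] by simp
next
  case (ge2 j)
  then show ?case using assms[of "Suc j"] by simp
qed simp

text \<open>The recursion \<open>nroots_above_Suc\<close> expresses the count by finitely many sign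
  tests on polynomials in the entries, so roots never have to be selected measurably.\<close>

lemma measurable_nroots_above:
  assumes "c \<noteq> 0" "\<And>i. i < n \<Longrightarrow> (\<lambda>\<omega>. a \<omega> i) \<in> borel_measurable M"
  shows "j \<le> n \<Longrightarrow> (\<lambda>\<omega>. nroots_above (a \<omega>) c j t) \<in> measurable M (count_space UNIV)"
proof (induction j)
  case 0
  show ?case by (simp add: nroots_above_def)
next
  case (Suc j)
  have [measurable]: "(\<lambda>\<omega>. poly (jacobi_poly (a \<omega>) c j) t) \<in> borel_measurable M"
    "(\<lambda>\<omega>. poly (jacobi_poly (a \<omega>) c (Suc j)) t) \<in> borel_measurable M"
    using Suc.prems by (auto intro!: borel_measurable_poly_jacobi_poly[OF assms(2)] simp del: jacobi_poly.simps)
  have [measurable]: "(\<lambda>\<omega>. nroots_above (a \<omega>) c j t) \<in> measurable M (count_space UNIV)"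
    using Suc by simp
  show ?case unfolding nroots_above_Suc[OF assms(1)] by measurable
qed

lemma borel_measurable_eigenvalue:
  assumes "\<beta> \<noteq> 0" "k < n" "\<And>i. i \<in> {1..n} \<Longrightarrow> (\<lambda>\<omega>. X \<omega> i) \<in> borel_measurable M"
  shows "(\<lambda>\<omega>. eigenvalues_decreasing (tridiagonal_matrix \<beta> n (X \<omega>)) ! k) \<in> borel_measurable M"
  unfolding borel_measurable_iff_greater
proof
  fix t
  define c where "c = \<beta> * (real n + 1)\<^sup>2"
  have "c \<noteq> 0" using assms(1) by (simp add: c_def)
  then have [measurable]: "(\<lambda>\<omega>. nroots_above (tridiagonal_diag \<beta> n (X \<omega>)) c n t)
      \<in> measurable M (count_space UNIV)"
  proof (rule measurable_nroots_above)
    fix i assume "i < n"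
    then have "(\<lambda>\<omega>. X \<omega> (Suc i)) \<in> borel_measurable M" by (intro assms(3)) auto
    then show "(\<lambda>\<omega>. tridiagonal_diag \<beta> n (X \<omega>) i) \<in> borel_measurable M"
      by (simp add: tridiagonal_diag_def)
  qed simp
  have "{\<omega> \<in> space M. k < nroots_above (tridiagonal_diag \<beta> n (X \<omega>)) c n t} \<in> sets M"
    by measurable
  then show "{\<omega> \<in> space M. t < eigenvalues_decreasing (tridiagonal_matrix \<beta> n (X \<omega>)) ! k} \<in> sets M"
    unfolding less_eigenvalue_iff[OF assms(1,2)] c_def .
qed

section \<open>Limits of simple zeros\<close>

text \<open>A substitute for Hurwitz's theorem on the real line. \<open>conv\<close> keeps zeros
  away from points where \<open>f\<close> does not vanish; \<open>sign\<close> makes every zero of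
  \<open>f\<close> a limit of zeros; \<open>sep\<close> forbids two zeros to merge there;
  \<open>upper\<close> and \<open>lower\<close> stop the \<open>k\<close>-th zero from
  escaping.\<close>

locale simple_zeros =
  fixes F :: "nat \<Rightarrow> real \<Rightarrow> real" and f :: "real \<Rightarrow> real" and y :: "nat \<Rightarrow> nat \<Rightarrow> real" and C :: real
  assumes zeros: "\<And>n t. F n t = 0 \<longleftrightarrow> (\<exists>i<n. t = y n i)"
    and dec: "\<And>n i k. i < k \<Longrightarrow> k < n \<Longrightarrow> y n k < y n i"
    and cont: "\<And>n. continuous_on UNIV (F n)"
    and conv: "\<And>t \<eta>. \<eta> > 0 \<Longrightarrow> \<exists>\<epsilon>>0. \<forall>\<^sub>F n in sequentially. \<forall>s. \<bar>s - t\<bar> < \<epsilon> \<longrightarrow> \<bar>F n s - f t\<bar> < \<eta>"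
    and upper: "\<forall>\<^sub>F n in sequentially. \<forall>i<n. y n i \<le> C"
    and lower: "\<And>k. \<exists>T. \<forall>\<^sub>F n in sequentially. T \<le> y n k"
    and sep: "\<And>t0. f t0 = 0 \<Longrightarrow> \<exists>\<epsilon>>0. \<forall>\<^sub>F n in sequentially. \<forall>s t.
      \<bar>s - t0\<bar> < \<epsilon> \<longrightarrow> \<bar>t - t0\<bar> < \<epsilon> \<longrightarrow> F n s = 0 \<longrightarrow> F n t = 0 \<longrightarrow> s = t"
    and sign: "\<And>t0 \<epsilon>. f t0 = 0 \<Longrightarrow> \<epsilon> > 0 \<Longrightarrow>
      \<exists>a b. t0 - \<epsilon> < a \<and> a < t0 \<and> t0 < b \<and> b < t0 + \<epsilon> \<and> f a * f b < 0"
begin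

lemma tendsto_F: "(\<lambda>n. F n t) \<longlonglongrightarrow> f t"
proof (rule tendstoI)
  fix \<eta> :: real assume "\<eta> > 0"
  then obtain \<epsilon> where "\<epsilon> > 0" "\<forall>\<^sub>F n in sequentially. \<forall>s. \<bar>s - t\<bar> < \<epsilon> \<longrightarrow> \<bar>F n s - f t\<bar> < \<eta>"
    using conv by blast
  then show "\<forall>\<^sub>F n in sequentially. dist (F n t) (f t) < \<eta>"
    by (auto elim!: eventually_mono simp: dist_real_def)
qed

lemma continuous_f: "continuous_on UNIV f"
  unfolding continuous_on_iff
proof (intro ballI allI impI)
  fix t \<eta> :: real assume "\<eta> > 0"
  then obtain \<epsilon> where e: "\<epsilon> > 0" "\<forall>\<^sub>F n in sequentially. \<forall>s. \<bar>s - t\<bar> < \<epsilon> \<longrightarrow> \<bar>F n s - f t\<bar> < \<eta> / 2"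
    using conv[of "\<eta> / 2" t] by auto
  have "dist (f s) (f t) < \<eta>" if "dist s t < \<epsilon>" for s
  proof -
    have "(\<lambda>n. \<bar>F n s - f t\<bar>) \<longlonglongrightarrow> \<bar>f s - f t\<bar>" by (intro tendsto_intros tendsto_F)
    moreover have "\<forall>\<^sub>F n in sequentially. \<bar>F n s - f t\<bar> \<le> \<eta> / 2"
      using e(2) by eventually_elim (use that in \<open>auto simp: dist_real_def intro: less_imp_le\<close>)
    ultimately have "\<bar>f s - f t\<bar> \<le> \<eta> / 2" by (rule tendsto_upperbound) simp
    then show ?thesis using \<open>\<eta> > 0\<close> by (simp add: dist_real_def)
  qed
  then show "\<exists>d>0. \<forall>x'\<in>UNIV. dist x' t < d \<longrightarrow> dist (f x') (f t) < \<eta>" using e(1) by blast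
qed

lemma zero_approximated:
  assumes "f t0 = 0" "\<epsilon> > 0"
  shows "\<forall>\<^sub>F n in sequentially. \<exists>i<n. \<bar>y n i - t0\<bar> < \<epsilon>"
proof -
  obtain a b where ab: "t0 - \<epsilon> < a" "a < t0" "t0 < b" "b < t0 + \<epsilon>" "f a * f b < 0"
    using sign[OF assms] by blast
  have "(\<lambda>n. F n a * F n b) \<longlonglongrightarrow> f a * f b" by (intro tendsto_intros tendsto_F)
  then have "\<forall>\<^sub>F n in sequentially. F n a * F n b < 0" using ab(5) by (rule order_tendstoD)
  then show ?thesis
  proof eventually_elim
    case (elim n)
    have c: "continuous_on {a..b} (F n)" using cont continuous_on_subset by blast
    have "\<exists>x\<ge>a. x \<le> b \<and> F n x = 0"
    proof (cases "F n a < 0")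
      case True
      then have "F n b > 0" using elim by (simp add: mult_less_0_iff)
      then show ?thesis using IVT'[of "F n" a 0 b] c True ab by auto
    next
      case False
      then have "F n a > 0" "F n b < 0" using elim by (auto simp: mult_less_0_iff)
      then show ?thesis using IVT2'[of "F n" b 0 a] c ab by auto
    qed
    then obtain x where "a \<le> x" "x \<le> b" "F n x = 0" by blast
    then obtain i where "i < n" "a \<le> y n i" "y n i \<le> b" using zeros[of n x] by auto
    then show ?case using ab by (intro exI[of _ i]) auto
  qed
qed

lemma eventually_nonzero:
  assumes "\<And>t. a \<le> t \<Longrightarrow> t \<le> b \<Longrightarrow> f t \<noteq> 0"
  shows "\<forall>\<^sub>F n in sequentially. \<forall>i<n. \<not> (a \<le> y n i \<and> y n i \<le> b)"
proof -
  have "\<exists>\<epsilon>. \<epsilon> > 0 \<and> (\<forall>\<^sub>F n in sequentially. \<forall>s. \<bar>s - t\<bar> < \<epsilon> \<longrightarrow> F n s \<noteq> 0)" if "t \<in> {a..b}" for t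
  proof -
    have "\<bar>f t\<bar> > 0" using assms that by simp
    then obtain \<epsilon> where "\<epsilon> > 0" "\<forall>\<^sub>F n in sequentially. \<forall>s. \<bar>s - t\<bar> < \<epsilon> \<longrightarrow> \<bar>F n s - f t\<bar> < \<bar>f t\<bar>"
      using conv by blast
    then show ?thesis by (intro exI[of _ \<epsilon>]) (force elim!: eventually_mono)
  qed
  then have "\<forall>t\<in>{a..b}. \<exists>\<epsilon>. \<epsilon> > 0 \<and> (\<forall>\<^sub>F n in sequentially. \<forall>s. \<bar>s - t\<bar> < \<epsilon> \<longrightarrow> F n s \<noteq> 0)"
    by blast
  from bchoice[OF this] obtain e where e0: "\<forall>t\<in>{a..b}. e t > 0 \<and>
      (\<forall>\<^sub>F n in sequentially. \<forall>s. \<bar>s - t\<bar> < e t \<longrightarrow> F n s \<noteq> 0)" by blast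
  have e: "e t > 0" "\<forall>\<^sub>F n in sequentially. \<forall>s. \<bar>s - t\<bar> < e t \<longrightarrow> F n s \<noteq> 0" if "t \<in> {a..b}" for t
    using e0 that by blast+
  obtain D where D: "D \<subseteq> {a..b}" "finite D" "{a..b} \<subseteq> (\<Union>t\<in>D. ball t (e t))"
    using compactE_image[of "{a..b}" "{a..b}" "\<lambda>t. ball t (e t)"] e(1) by force
  have "\<forall>\<^sub>F n in sequentially. \<forall>t\<in>D. \<forall>s. \<bar>s - t\<bar> < e t \<longrightarrow> F n s \<noteq> 0"
    using D e(2) by (intro eventually_ball_finite) auto
  then show ?thesis
  proof eventually_elim
    case (elim n)
    show ?case
    proof (intro allI impI notI)
      fix i assume i: "i < n" "a \<le> y n i \<and> y n i \<le> b"
      then have "y n i \<in> (\<Union>t\<in>D. ball t (e t))" by (intro subsetD[OF D(3)]) simp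
      then obtain t where "t \<in> D" "\<bar>y n i - t\<bar> < e t" by (auto simp: dist_real_def abs_minus_commute)
      then have "F n (y n i) \<noteq> 0" using elim by blast
      then show False using i zeros by blast
    qed
  qed
qed

text \<open>In the state \<open>(V, U)\<close> of the induction the zeros with index below \<open>k\<close> are above \<open>U\<close> and
  the others are at most \<open>V\<close>.\<close>

definition separated_at :: "nat \<Rightarrow> real \<times> real \<Rightarrow> bool" where
  "separated_at k = (\<lambda>(V, U). V < U \<and>
     (\<forall>\<^sub>F n in sequentially. \<forall>i<n. (i < k \<longrightarrow> U < y n i) \<and> (k \<le> i \<longrightarrow> y n i \<le> V)))"

text \<open>The uniqueness clause is what later shows that no zero of \<open>f\<close> is skipped
  between two consecutive states.\<close>

definition zero_between :: "nat \<Rightarrow> real \<times> real \<Rightarrow> real \<times> real \<Rightarrow> bool" where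
  "zero_between k = (\<lambda>(V, U) (V', U'). \<exists>l. V' < l \<and> l \<le> V \<and> f l = 0 \<and>
     (\<forall>t. f t = 0 \<longrightarrow> V' < t \<longrightarrow> t \<le> V \<longrightarrow> t = l) \<and> (\<lambda>n. y n k) \<longlonglongrightarrow> l)"

text \<open>The limit of the \<open>k\<close>-th zeros is the largest zero \<open>l\<close> of
  \<open>f\<close> that is at most \<open>V\<close>: zeros of \<open>F n\<close> must approach
  \<open>l\<close>, none survive between \<open>l\<close> and \<open>V\<close>, and the
  \<open>k\<close>-th one is the highest of those still below \<open>U\<close>. \<open>sep\<close>
  then isolates \<open>l\<close> and provides the next state.\<close>

lemma separated_step:
  assumes "separated_at k x"
  shows "\<exists>x'. separated_at (Suc k) x' \<and> zero_between k x x'"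
proof -
  obtain V U where x: "x = (V, U)" by (cases x)
  have VU: "V < U" and ev: "\<forall>\<^sub>F n in sequentially. \<forall>i<n. (i < k \<longrightarrow> U < y n i) \<and> (k \<le> i \<longrightarrow> y n i \<le> V)"
    using assms by (auto simp: separated_at_def x)
  obtain T where T: "\<forall>\<^sub>F n in sequentially. T \<le> y n k" using lower by blast
  define S where "S = {t \<in> {T..V}. f t = 0}"
  \<comment> \<open>The \<open>k\<close>-th zero lies in \<open>[T, V]\<close> for large
    \<open>n\<close>, which is impossible if \<open>f\<close> has no zero there.\<close>
  have "S \<noteq> {}"
  proof
    assume "S = {}"
    then have "\<forall>\<^sub>F n in sequentially. \<forall>i<n. \<not> (T \<le> y n i \<and> y n i \<le> V)"
      by (intro eventually_nonzero) (auto simp: S_def)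
    with T ev eventually_gt_at_top[of k] have "\<forall>\<^sub>F n in sequentially. False" by eventually_elim auto
    then show False by simp
  qed
  moreover have "compact S"
  proof -
    have "closed (f -` {0})" using continuous_f by (simp add: continuous_closed_vimage continuous_on_eq_continuous_at)
    moreover have "S = {T..V} \<inter> f -` {0}" by (auto simp: S_def)
    ultimately show ?thesis by (simp add: compact_Int_closed)
  qed
  ultimately obtain l where l: "l \<in> S" "\<And>t. t \<in> S \<Longrightarrow> t \<le> l" using compact_attains_sup[of S] by metis
  have fl: "f l = 0" and lV: "l \<le> V" using l(1) by (auto simp: S_def)
  have lmax: "t \<le> l" if "f t = 0" "t \<le> V" for t
    using that l(2)[of t] l(1) by (cases "T \<le> t") (auto simp: S_def)
  have yl: "(\<lambda>n. y n k) \<longlonglongrightarrow> l"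
  proof (rule tendstoI)
    fix \<epsilon>0 :: real assume "\<epsilon>0 > 0"
    define \<epsilon> where "\<epsilon> = min (\<epsilon>0 / 2) (U - V)"
    have e: "\<epsilon> > 0" "\<epsilon> < \<epsilon>0" "\<epsilon> \<le> U - V" using VU \<open>\<epsilon>0 > 0\<close> by (auto simp: \<epsilon>_def)
    have "\<forall>\<^sub>F n in sequentially. \<forall>i<n. \<not> (l + \<epsilon> \<le> y n i \<and> y n i \<le> V)"
      using lmax e by (intro eventually_nonzero) force
    with ev zero_approximated[OF fl e(1)] eventually_gt_at_top[of k]
    show "\<forall>\<^sub>F n in sequentially. dist (y n k) l < \<epsilon>0"
    proof eventually_elim
      case (elim n)
      then obtain i where i: "i < n" "\<bar>y n i - l\<bar> < \<epsilon>" by blast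
      \<comment> \<open>The gap between \<open>V\<close> and \<open>U\<close> enters here:
        \<open>\<epsilon>\<close> is at most \<open>U - V\<close>, so a zero this close to
        \<open>l\<close> cannot be one of the first \<open>k\<close>.\<close>
      have "\<not> i < k"
      proof
        assume "i < k"
        then have "U < y n i" using elim(1) i by blast
        then show False using i(2) e lV by linarith
      qed
      then have "y n i \<le> y n k" using dec[of k i n] i by (cases "i = k") auto
      moreover have "y n k < l + \<epsilon>" using elim by force
      ultimately show ?case using i e by (auto simp: dist_real_def)
    qed
  qed
  obtain \<epsilon> where e: "\<epsilon> > 0" and se: "\<forall>\<^sub>F n in sequentially. \<forall>s t.
      \<bar>s - l\<bar> < \<epsilon> \<longrightarrow> \<bar>t - l\<bar> < \<epsilon> \<longrightarrow> F n s = 0 \<longrightarrow> F n t = 0 \<longrightarrow> s = t"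
    using sep[OF fl] by blast
  \<comment> \<open>A second zero of \<open>f\<close> in the window would bring zeros of
    \<open>F n\<close> near both points, and \<open>sep\<close> would identify them.\<close>
  have alone: "t = l" if "f t = 0" "\<bar>t - l\<bar> < \<epsilon>" for t
  proof (rule ccontr)
    assume "t \<noteq> l"
    define d where "d = min (\<bar>t - l\<bar> / 2) (\<epsilon> - \<bar>t - l\<bar>)"
    have d: "d > 0" using that \<open>t \<noteq> l\<close> by (simp add: d_def)
    have d': "d \<le> \<bar>t - l\<bar> / 2" "d \<le> \<epsilon> - \<bar>t - l\<bar>"
      unfolding d_def by (rule min.cobounded1, rule min.cobounded2)
    from zero_approximated[OF that(1) d] zero_approximated[OF fl d] se
    have "\<forall>\<^sub>F n in sequentially. False"
    proof eventually_elim
      case (elim n)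
      then obtain i j where ij: "i < n" "\<bar>y n i - t\<bar> < d" "j < n" "\<bar>y n j - l\<bar> < d" by blast
      have "F n (y n i) = 0" "F n (y n j) = 0" using ij zeros by blast+
      moreover have "\<bar>y n i - l\<bar> < \<epsilon>" "\<bar>y n j - l\<bar> < \<epsilon>" using ij d d' by linarith+
      ultimately have "y n i = y n j" using elim(3) by blast
      then have "\<bar>t - l\<bar> \<le> \<bar>y n i - t\<bar> + \<bar>y n j - l\<bar>" by linarith
      also have "\<dots> < d + d" using ij by (intro add_strict_mono) auto
      finally show ?case using d'(1) by simp
    qed
    then show False by simp
  qed
  \<comment> \<open>Eventually the \<open>k\<close>-th zero is within \<open>\<epsilon> / 2\<close>
    of \<open>l\<close>, while by \<open>sep\<close> the later ones are at least
    \<open>\<epsilon>\<close> below \<open>l\<close>. The two levels are placed in this gap.\<close>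
  define U' V' where "U' = l - \<epsilon> / 2" and "V' = l - 2 * \<epsilon> / 3"
  have "\<forall>\<^sub>F n in sequentially. \<bar>y n k - l\<bar> < \<epsilon> / 2"
    using tendstoD[OF yl, of "\<epsilon> / 2"] e by (simp add: dist_real_def)
  with se ev eventually_gt_at_top[of k]
  have ev': "\<forall>\<^sub>F n in sequentially. \<forall>i<n. (i < Suc k \<longrightarrow> U' < y n i) \<and> (Suc k \<le> i \<longrightarrow> y n i \<le> V')"
  proof eventually_elim
    case (elim n)
    show ?case
    proof (intro allI impI conjI)
      fix i assume "i < n" "i < Suc k"
      then have "y n k \<le> y n i" using dec[of i k n] elim by (cases "i = k") auto
      then show "U' < y n i" using elim unfolding U'_def by linarith
    next
      fix i assume i: "i < n" "Suc k \<le> i"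
      then have lt: "y n i < y n k" using dec[of k i n] by auto
      have "F n (y n i) = 0" "F n (y n k) = 0" using i elim zeros by blast+
      moreover have "\<bar>y n k - l\<bar> < \<epsilon>" using elim e by linarith
      ultimately have "\<not> \<bar>y n i - l\<bar> < \<epsilon>" using elim(1) lt less_irrefl by metis
      then show "y n i \<le> V'" using lt elim e unfolding V'_def by linarith
    qed
  qed
  have "separated_at (Suc k) (V', U')"
    using ev' e by (auto simp: separated_at_def U'_def V'_def)
  moreover have "zero_between k x (V', U')"
  proof -
    have "t = l" if "f t = 0" "V' < t" "t \<le> V" for t
      using lmax[OF that(1,3)] alone[OF that(1)] that(2) e unfolding V'_def by linarith
    moreover have "V' < l" using e by (simp add: V'_def)
    ultimately show ?thesis using lV fl yl unfolding zero_between_def x prod.case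
      by (intro exI[of _ l]) blast
  qed
  ultimately show ?thesis by blast
qed

text \<open>The steps are chained by dependent choice. That the limits reach every zero of
  \<open>f\<close> rests on \<open>sep\<close>: a missed zero would make the limits
  accumulate.\<close>

lemma zeros_limit:
  obtains l where "\<And>i k. i < k \<Longrightarrow> l k < l i" "range l = {t. f t = 0}" "\<And>k. (\<lambda>n. y n k) \<longlonglongrightarrow> l k"
proof -
  have "separated_at 0 (C, C + 1)" using upper by (auto simp: separated_at_def)
  \<comment> \<open>The clause for index 0 ties the start of the chain to the upper bound
    \<open>C\<close>.\<close>
  then have "\<exists>x. separated_at 0 x \<and> (0 = (0::nat) \<longrightarrow> x = (C, C + 1))" by blast
  then have "\<exists>g. \<forall>k. (separated_at k (g k) \<and> (k = 0 \<longrightarrow> g k = (C, C + 1))) \<and> zero_between k (g k) (g (Suc k))"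
    by (intro dependent_nat_choice) (use separated_step in auto)
  then obtain g where g0: "g 0 = (C, C + 1)" and g: "\<And>k. zero_between k (g k) (g (Suc k))" by blast
  define V where "V k = fst (g k)" for k
  have "\<exists>l. V (Suc k) < l \<and> l \<le> V k \<and> f l = 0 \<and>
     (\<forall>t. f t = 0 \<longrightarrow> V (Suc k) < t \<longrightarrow> t \<le> V k \<longrightarrow> t = l) \<and> (\<lambda>n. y n k) \<longlonglongrightarrow> l" for k
    using g[of k] by (auto simp: zero_between_def V_def split: prod.splits)
  then obtain l where l: "\<And>k. V (Suc k) < l k" "\<And>k. l k \<le> V k" "\<And>k. f (l k) = 0"
     "\<And>k t. f t = 0 \<Longrightarrow> V (Suc k) < t \<Longrightarrow> t \<le> V k \<Longrightarrow> t = l k" "\<And>k. (\<lambda>n. y n k) \<longlonglongrightarrow> l k"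
    by metis
  have "l (Suc k) < l k" for k using l(2)[of "Suc k"] l(1)[of k] by linarith
  then have l_dec: "l k < l i" if "i < k" for i k
    using lift_Suc_mono_less[of "\<lambda>k. - l k" i k] that by simp
  have "t \<in> range l" if t: "f t = 0" for t
  proof (rule ccontr)
    assume "t \<notin> range l"
    \<comment> \<open>A missed zero slips below every level, since
      \<open>V (Suc k) < t \<le> V k\<close> would force \<open>t = l k\<close>.\<close>
    have tV: "t \<le> V k" for k
    proof (induction k)
      case 0
      show ?case
      proof (rule ccontr)
        assume "\<not> t \<le> V 0"
        then have "t - C > 0" using g0 by (simp add: V_def)
        from zero_approximated[OF t this] upper have "\<forall>\<^sub>F n in sequentially. False"
        proof eventually_elim
          case (elim n)
          then obtain i where "i < n" "\<bar>y n i - t\<bar> < t - C" "y n i \<le> C" by blast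
          then show ?case by linarith
        qed
        then show False by simp
      qed
    next
      case (Suc k)
      then show ?case using l(4)[OF t, of k] \<open>t \<notin> range l\<close> by force
    qed
    \<comment> \<open>The decreasing limits are bounded below by \<open>t\<close>, so they converge
      to some \<open>L\<close>, a zero by continuity. Two consecutive ones lie in the window of
      \<open>sep\<close> around \<open>L\<close>, and so do the distinct zeros of \<open>F n\<close>
      near them.\<close>
    have "decseq l" using l_dec by (intro decseq_SucI) (auto intro: less_imp_le)
    moreover have "t \<le> l k" for k using tV[of "Suc k"] l(1)[of k] by linarith
    ultimately obtain L where L: "l \<longlonglongrightarrow> L" using decseq_convergent[of l t] by blast
    have "(\<lambda>k. f (l k)) \<longlonglongrightarrow> f L"
      using continuous_f L by (simp add: continuous_on_eq_continuous_at isCont_tendsto_compose)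
    then have "f L = 0" using l(3) by (simp add: LIMSEQ_const_iff)
    then obtain \<epsilon> where e: "\<epsilon> > 0" and se: "\<forall>\<^sub>F n in sequentially. \<forall>s t.
        \<bar>s - L\<bar> < \<epsilon> \<longrightarrow> \<bar>t - L\<bar> < \<epsilon> \<longrightarrow> F n s = 0 \<longrightarrow> F n t = 0 \<longrightarrow> s = t"
      using sep by blast
    have "\<forall>\<^sub>F k in sequentially. dist (l k) L < \<epsilon>" using L e by (rule tendstoD)
    then obtain k where k: "\<And>j. j \<ge> k \<Longrightarrow> dist (l j) L < \<epsilon>" unfolding eventually_sequentially by blast
    have ev: "\<forall>\<^sub>F n in sequentially. dist (y n j) L < \<epsilon>" if "j \<ge> k" for j
      using order_tendstoD(2)[OF tendsto_dist[OF l(5)[of j] tendsto_const[of L]]] k[OF that] by blast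
    from ev[of k, OF order_refl] ev[of "Suc k", OF le_SucI[OF order_refl]] se eventually_gt_at_top[of "Suc k"]
    have "\<forall>\<^sub>F n in sequentially. False"
    proof eventually_elim
      case (elim n)
      have "F n (y n k) = 0" "F n (y n (Suc k)) = 0" using elim zeros Suc_lessD by blast+
      then have "y n k = y n (Suc k)" using elim by (simp add: dist_real_def)
      then show ?case using dec[of k "Suc k" n] elim by simp
    qed
    then show False by simp
  qed
  then have "range l = {t. f t = 0}" using l(3) by auto
  with l_dec l(5) that show ?thesis by blast
qed

end

section \<open>Linear differential systems\<close>

text \<open>Measured against the weight \<open>exp (2 * L * x)\<close> each iteration halves the
  difference, because the integral of \<open>L * exp (2 * L * s)\<close> over \<open>[0, x]\<close>
  is below \<open>exp (2 * L * x) / 2\<close>. This gives a solution on the whole interval without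
  gluing local ones.\<close>

lemma picard_solution:
  fixes F :: "real \<Rightarrow> 'a::euclidean_space \<Rightarrow> 'a"
  assumes cF: "\<And>g. continuous_on {0..1} g \<Longrightarrow> continuous_on {0..1} (\<lambda>s. F s (g s))"
    and L: "L > 0" "\<And>s y z. s \<in> {0..1} \<Longrightarrow> norm (F s y - F s z) \<le> L * norm (y - z)"
  shows "\<exists>g. g 0 = y0 \<and> (\<forall>x\<in>{0..1}. (g has_vector_derivative F x (g x)) (at x within {0..1}))"
proof -
  define T where "T g x = y0 + integral {0..x} (\<lambda>s. F s (g s))" for g x
  define Y where "Y k = (T ^^ k) (\<lambda>_. y0)" for k
  have YS: "Y (Suc k) x = y0 + integral {0..x} (\<lambda>s. F s (Y k s))" for k x
    by (simp add: Y_def T_def)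
  have cY: "continuous_on {0..1} (Y k)" for k
  proof (induction k)
    case (Suc k)
    have "continuous_on {0..1} (\<lambda>x. y0 + integral {0..x} (\<lambda>s. F s (Y k s)))"
      by (intro continuous_intros indefinite_integral_continuous_1 integrable_continuous_real cF Suc)
    then show ?case by (simp add: YS)
  qed (simp add: Y_def)
  have int: "(\<lambda>s. F s (g s)) integrable_on {0..x}" if "continuous_on {0..1} g" "x \<in> {0..1}" for g x
    by (intro integrable_continuous_real continuous_on_subset[OF cF[OF that(1)]]) (use that in auto)
  obtain C where C: "\<And>x. x \<in> {0..1} \<Longrightarrow> norm (Y 1 x - Y 0 x) \<le> C"
  proof -
    have "compact ((\<lambda>x. Y 1 x - Y 0 x) ` {0..1})"
      by (intro compact_continuous_image continuous_intros cY) auto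
    then obtain C where "\<forall>v\<in>(\<lambda>x. Y 1 x - Y 0 x) ` {0..1}. norm v \<le> C"
      using compact_imp_bounded bounded_iff by blast
    then show ?thesis using that by blast
  qed
  have "norm (Y 1 0 - Y 0 0) \<le> C" using C by simp
  then have C0: "C \<ge> 0" using norm_ge_zero order_trans by blast
  have diff: "norm (Y (Suc k) x - Y k x) \<le> C * exp (2 * L * x) / 2 ^ k" if "x \<in> {0..1}" for k x
    using that
  proof (induction k arbitrary: x)
    case 0
    have "C * 1 \<le> C * exp (2 * L * x)" using 0 L(1) C0 by (intro mult_left_mono) auto
    then show ?case using C[OF 0] by simp
  next
    case (Suc k)
    define G where "G s = C / 2 ^ Suc k * exp (2 * L * s)" for s
    have G: "((\<lambda>s. L * (C * exp (2 * L * s) / 2 ^ k)) has_integral (G x - G 0)) {0..x}"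
    proof (rule fundamental_theorem_of_calculus)
      fix s assume "s \<in> {0..x}"
      show "(G has_vector_derivative L * (C * exp (2 * L * s) / 2 ^ k)) (at s within {0..x})"
        unfolding G_def has_real_derivative_iff_has_vector_derivative[symmetric]
        by (auto intro!: derivative_eq_intros simp: field_simps)
    qed (use Suc in auto)
    have "Y (Suc (Suc k)) x - Y (Suc k) x
        = integral {0..x} (\<lambda>s. F s (Y (Suc k) s) - F s (Y k s))"
      using Henstock_Kurzweil_Integration.integral_diff[OF int[OF cY[of "Suc k"] Suc.prems] int[OF cY[of k] Suc.prems]]
      by (simp only: YS[of "Suc k" x] YS[of k x] add_diff_cancel_left)
    also have "norm \<dots> \<le> integral {0..x} (\<lambda>s. L * (C * exp (2 * L * s) / 2 ^ k))"
    proof (rule integral_norm_bound_integral)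
      show "(\<lambda>s. F s (Y (Suc k) s) - F s (Y k s)) integrable_on {0..x}"
        using Suc.prems by (intro Henstock_Kurzweil_Integration.integrable_diff int cY)
      show "(\<lambda>s. L * (C * exp (2 * L * s) / 2 ^ k)) integrable_on {0..x}" using G by blast
      fix s assume "s \<in> {0..x}"
      then have s: "s \<in> {0..1}" using Suc.prems by auto
      have "norm (F s (Y (Suc k) s) - F s (Y k s)) \<le> L * norm (Y (Suc k) s - Y k s)" using L(2)[OF s] .
      also have "\<dots> \<le> L * (C * exp (2 * L * s) / 2 ^ k)" using Suc.IH[OF s] L(1) by (intro mult_left_mono) auto
      finally show "norm (F s (Y (Suc k) s) - F s (Y k s)) \<le> L * (C * exp (2 * L * s) / 2 ^ k)" .
    qed
    also have "\<dots> = G x - G 0" using G by (rule integral_unique)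
    also have "\<dots> \<le> G x" using C0 by (simp add: G_def)
    finally show ?case by (simp add: G_def)
  qed
  define G where "G x = Y 0 x + (\<Sum>k. Y (Suc k) x - Y k x)" for x
  have "uniform_limit {0..1} (\<lambda>n x. \<Sum>k<n. Y (Suc k) x - Y k x) (\<lambda>x. \<Sum>k. Y (Suc k) x - Y k x) sequentially"
  proof (rule Weierstrass_m_test)
    fix k x assume x: "x \<in> {0..1::real}"
    have "C * exp (2 * L * x) / 2 ^ k \<le> C * exp (2 * L) / 2 ^ k"
      using x L(1) C0 by (intro divide_right_mono mult_left_mono) auto
    then show "norm (Y (Suc k) x - Y k x) \<le> C * exp (2 * L) * (1 / 2) ^ k"
      using diff[OF x, of k] by (simp add: power_one_over field_simps)
  qed (intro summable_mult summable_geometric, simp)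
  moreover have "(\<Sum>k<n. Y (Suc k) x - Y k x) = Y n x - Y 0 x" for n x
    using sum_lessThan_telescope[of "\<lambda>k. Y k x"] by simp
  ultimately have lim: "uniform_limit {0..1} Y G sequentially"
    unfolding G_def uniform_limit_iff dist_norm by (simp add: diff_diff_eq)
  have cG: "continuous_on {0..1} G"
    by (rule uniform_limit_theorem[OF _ lim]) (auto simp: cY)
  have eq: "G x = y0 + integral {0..x} (\<lambda>s. F s (G s))" if x: "x \<in> {0..1}" for x
  proof -
    have "(\<lambda>n. Y n x) \<longlonglongrightarrow> G x" using lim x by (rule tendsto_uniform_limitI)
    then have "(\<lambda>n. Y (Suc n) x) \<longlonglongrightarrow> G x" by (rule LIMSEQ_Suc)
    moreover have "(\<lambda>n. Y (Suc n) x) \<longlonglongrightarrow> y0 + integral {0..x} (\<lambda>s. F s (G s))"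
    proof (rule tendstoI)
      fix e :: real assume e: "e > 0"
      then have "e / (2 * L) > 0" using L by simp
      then have "\<forall>\<^sub>F n in sequentially. \<forall>s\<in>{0..1}. dist (Y n s) (G s) < e / (2 * L)"
        using lim unfolding uniform_limit_iff by blast
      then show "\<forall>\<^sub>F n in sequentially. dist (Y (Suc n) x) (y0 + integral {0..x} (\<lambda>s. F s (G s))) < e"
      proof eventually_elim
        case (elim n)
        have "dist (Y (Suc n) x) (y0 + integral {0..x} (\<lambda>s. F s (G s)))
            = norm (integral {0..x} (\<lambda>s. F s (Y n s) - F s (G s)))"
          unfolding YS dist_norm using x
          by (subst Henstock_Kurzweil_Integration.integral_diff) (auto intro!: int cY cG)
        also have "\<dots> \<le> e / 2 * (x - 0)"
        proof (rule integral_bound)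
          show "continuous_on {0..x} (\<lambda>s. F s (Y n s) - F s (G s))"
            using x by (intro continuous_on_subset[OF continuous_on_diff[OF cF[OF cY[of n]] cF[OF cG]]]) auto
          fix s assume "s \<in> {0..x}"
          then have s: "s \<in> {0..1}" using x by auto
          have "norm (F s (Y n s) - F s (G s)) \<le> L * norm (Y n s - G s)" using L(2)[OF s] .
          also have "\<dots> \<le> L * (e / (2 * L))"
            using elim s L(1) by (intro mult_left_mono) (auto simp: dist_norm intro: less_imp_le)
          finally show "norm (F s (Y n s) - F s (G s)) \<le> e / 2" using L(1) by simp
        qed (use x in auto)
        also have "\<dots> < e" using x e mult_left_mono[of x 1 "e / 2"] by auto
        finally show ?case .
      qed
    qed
    ultimately show ?thesis by (rule LIMSEQ_unique)
  qed
  have "(G has_vector_derivative F x (G x)) (at x within {0..1})" if x: "x \<in> {0..1}" for x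
  proof -
    have "((\<lambda>u. y0 + integral {0..u} (\<lambda>s. F s (G s))) has_vector_derivative 0 + F x (G x)) (at x within {0..1})"
      by (intro has_vector_derivative_add has_vector_derivative_const integral_has_vector_derivative cF cG x)
    then show ?thesis
      by (intro has_vector_derivative_transform[OF x eq]) auto
  qed
  then show ?thesis using eq[of 0] by (intro exI[of _ G]) auto
qed

lemma continuous_on_unit_bounded:
  fixes g :: "real \<Rightarrow> real"
  assumes "continuous_on {0..1} g"
  obtains K where "K > 0" "\<And>x. x \<in> {0..1} \<Longrightarrow> \<bar>g x\<bar> \<le> K"
proof -
  have "compact (g ` {0..1})" using assms by (intro compact_continuous_image) auto
  then obtain K where "K > 0" "\<forall>v\<in>g ` {0..1}. norm v \<le> K"
    using compact_imp_bounded bounded_pos by blast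
  then show ?thesis using that by auto
qed

lemma linear_system_solution:
  fixes a b c d p q :: "real \<Rightarrow> real"
  assumes cont: "continuous_on {0..1} a" "continuous_on {0..1} b" "continuous_on {0..1} c"
    "continuous_on {0..1} d" "continuous_on {0..1} p" "continuous_on {0..1} q"
  obtains y z where "y 0 = y0" "z 0 = z0"
    "\<And>x. x \<in> {0..1} \<Longrightarrow> (y has_real_derivative a x * y x + b x * z x + p x) (at x within {0..1})"
    "\<And>x. x \<in> {0..1} \<Longrightarrow> (z has_real_derivative c x * y x + d x * z x + q x) (at x within {0..1})"
proof -
  obtain K1 where K1: "K1 > 0" "\<And>x. x \<in> {0..1} \<Longrightarrow> \<bar>a x\<bar> \<le> K1"
    using continuous_on_unit_bounded cont(1) by blast
  obtain K2 where K2: "K2 > 0" "\<And>x. x \<in> {0..1} \<Longrightarrow> \<bar>b x\<bar> \<le> K2"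
    using continuous_on_unit_bounded cont(2) by blast
  obtain K3 where K3: "K3 > 0" "\<And>x. x \<in> {0..1} \<Longrightarrow> \<bar>c x\<bar> \<le> K3"
    using continuous_on_unit_bounded cont(3) by blast
  obtain K4 where K4: "K4 > 0" "\<And>x. x \<in> {0..1} \<Longrightarrow> \<bar>d x\<bar> \<le> K4"
    using continuous_on_unit_bounded cont(4) by blast
  define F where "F s = (\<lambda>(y, z). (a s * y + b s * z + p s, c s * y + d s * z + q s))" for s
  have "\<exists>g. g 0 = (y0, z0) \<and> (\<forall>x\<in>{0..1}. (g has_vector_derivative F x (g x)) (at x within {0..1}))"
  proof (rule picard_solution)
    fix g :: "real \<Rightarrow> real \<times> real" assume "continuous_on {0..1} g"
    then show "continuous_on {0..1} (\<lambda>s. F s (g s))"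
      unfolding F_def case_prod_beta by (intro continuous_intros cont)
  next
    show "K1 + K2 + K3 + K4 > 0" using K1 K2 K3 K4 by linarith
  next
    fix s :: real and v w :: "real \<times> real" assume s: "s \<in> {0..1}"
    define u1 u2 where "u1 = fst (v - w)" and "u2 = snd (v - w)"
    have u: "\<bar>u1\<bar> \<le> norm (v - w)" "\<bar>u2\<bar> \<le> norm (v - w)"
      unfolding u1_def u2_def using norm_fst_le[of "fst (v - w)" "snd (v - w)"]
        norm_snd_le[of "snd (v - w)" "fst (v - w)"] unfolding prod.collapse real_norm_def by auto
    have "F s v - F s w = (a s * u1 + b s * u2, c s * u1 + d s * u2)"
      by (auto simp: F_def case_prod_beta u1_def u2_def algebra_simps)
    then have "norm (F s v - F s w) \<le> \<bar>a s * u1 + b s * u2\<bar> + \<bar>c s * u1 + d s * u2\<bar>"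
      using norm_Pair_le[of "a s * u1 + b s * u2" "c s * u1 + d s * u2"] by simp
    also have "\<dots> \<le> \<bar>a s\<bar> * \<bar>u1\<bar> + \<bar>b s\<bar> * \<bar>u2\<bar> + \<bar>c s\<bar> * \<bar>u1\<bar> + \<bar>d s\<bar> * \<bar>u2\<bar>"
      unfolding abs_mult[symmetric] by linarith
    also have "\<dots> \<le> K1 * norm (v - w) + K2 * norm (v - w) + K3 * norm (v - w) + K4 * norm (v - w)"
      using K1 K2 K3 K4 s u by (intro add_mono mult_mono) auto
    finally show "norm (F s v - F s w) \<le> (K1 + K2 + K3 + K4) * norm (v - w)" by (simp add: algebra_simps)
  qed
  then obtain g where g: "g 0 = (y0, z0)"
    "\<And>x. x \<in> {0..1} \<Longrightarrow> (g has_vector_derivative F x (g x)) (at x within {0..1})" by blast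
  show ?thesis
  proof (rule that[of "\<lambda>x. fst (g x)" "\<lambda>x. snd (g x)"])
    fix x :: real assume "x \<in> {0..1}"
    then have g': "(g has_derivative (\<lambda>h. h *\<^sub>R F x (g x))) (at x within {0..1})"
      using g(2) by (simp add: has_vector_derivative_def)
    show "((\<lambda>x. fst (g x)) has_real_derivative a x * fst (g x) + b x * snd (g x) + p x) (at x within {0..1})"
      using has_derivative_fst[OF g'] unfolding has_field_derivative_def
      by (rule has_derivative_eq_rhs) (auto simp: F_def case_prod_beta)
    show "((\<lambda>x. snd (g x)) has_real_derivative c x * fst (g x) + d x * snd (g x) + q x) (at x within {0..1})"
      using has_derivative_snd[OF g'] unfolding has_field_derivative_def
      by (rule has_derivative_eq_rhs) (auto simp: F_def case_prod_beta)
  qed (use g in auto)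
qed

section \<open>The shooting function and its discretization\<close>

text \<open>\<open>B\<close> is the local error per unit length and \<open>i * h\<close> the length
  covered, so on the unit interval the bound depends on \<open>A\<close> and \<open>B\<close> but
  not on the number of steps.\<close>

lemma discrete_gronwall:
  fixes S :: "nat \<Rightarrow> real"
  assumes "S 0 = 0" "\<And>i. i < m \<Longrightarrow> S (Suc i) \<le> S i * (1 + h * A) + h * B"
    "h \<ge> 0" "A \<ge> 0" "B \<ge> 0"
  shows "i \<le> m \<Longrightarrow> S i \<le> real i * h * B * exp (A * (real i * h))"
proof (induction i)
  case (Suc i)
  have e: "1 + h * A \<le> exp (A * h)" using exp_ge_add_one_self[of "A * h"] by (simp add: mult.commute)
  have e1: "1 \<le> exp (A * (real (Suc i) * h))" using assms by simp
  have "S (Suc i) \<le> S i * (1 + h * A) + h * B" using Suc assms(2) by simp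
  also have "\<dots> \<le> (real i * h * B * exp (A * (real i * h))) * (1 + h * A) + h * B"
    using Suc assms by (intro add_mono mult_right_mono) auto
  also have "\<dots> \<le> (real i * h * B * exp (A * (real i * h))) * exp (A * h) + (h * B) * exp (A * (real (Suc i) * h))"
    using assms e mult_left_mono[OF e1, of "h * B"] by (intro add_mono mult_left_mono) auto
  also have "\<dots> = real (Suc i) * h * B * exp (A * (real (Suc i) * h))"
    by (simp add: exp_add algebra_simps)
  finally show ?case .
qed (use assms in simp)

locale continuous_path =
  fixes \<beta> :: real and b :: "real \<Rightarrow> real"
  assumes beta_pos: "\<beta> > 0" and cont_b: "continuous_on {0..1} b"
begin

text \<open>There are \<open>n + 1\<close> steps: the \<open>n\<close> rows of the matrix belong to
  the interior grid points, and step \<open>n + 1\<close> reaches the right boundary.\<close>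

definition mesh :: "nat \<Rightarrow> real" where "mesh n = 1 / (real n + 1)"

text \<open>The symplectic Euler scheme for \<open>u' = (w - b u) / \<beta>\<close>, \<open>w' = t u + b u'\<close>; eliminating \<open>w\<close>
  gives the three-term recurrence of the matrix, and the Christoffel--Darboux identity of the
  differential equation has an exact discrete counterpart.\<close>

primrec scheme :: "nat \<Rightarrow> real \<Rightarrow> nat \<Rightarrow> real \<times> real" where
  "scheme n t 0 = (0, 1)"
| "scheme n t (Suc i) = (let (u, w) = scheme n t i; d = b (real i * mesh n);
     v = (w - d * u) / \<beta>; u' = u + mesh n * v in (u', w + mesh n * (t * u' + d * v)))"

definition scheme_u where "scheme_u n t i = fst (scheme n t i)"
definition scheme_w where "scheme_w n t i = snd (scheme n t i)"
definition scheme_v where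
  "scheme_v n t i = (scheme_w n t i - b (real i * mesh n) * scheme_u n t i) / \<beta>"

lemma scheme_simps [simp]: "scheme_u n t 0 = 0" "scheme_w n t 0 = 1" "scheme_v n t 0 = 1 / \<beta>"
  by (simp_all add: scheme_u_def scheme_w_def scheme_v_def)

lemma scheme_u_Suc: "scheme_u n t (Suc i) = scheme_u n t i + mesh n * scheme_v n t i"
  by (simp add: scheme_u_def scheme_w_def scheme_v_def Let_def case_prod_beta)

lemma scheme_w_Suc: "scheme_w n t (Suc i) = scheme_w n t i +
    mesh n * (t * scheme_u n t (Suc i) + b (real i * mesh n) * scheme_v n t i)"
  by (simp add: scheme_u_def scheme_w_def scheme_v_def Let_def case_prod_beta)

lemma scheme_w_eq: "scheme_w n t i = \<beta> * scheme_v n t i + b (real i * mesh n) * scheme_u n t i"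
  using beta_pos by (simp add: scheme_v_def)

lemma mesh_pos [simp]: "mesh n > 0" "mesh n \<ge> 0" by (simp_all add: mesh_def)

lemma mesh_le_1: "mesh n \<le> 1" by (simp add: mesh_def)

lemma grid_in_unit: "i \<le> Suc n \<Longrightarrow> real i * mesh n \<in> {0..1}"
  by (simp add: mesh_def)

lemma grid_end: "real (Suc n) * mesh n = 1" by (simp add: mesh_def)

lemma mesh_tendsto: "mesh \<longlonglongrightarrow> 0"
  unfolding mesh_def by real_asymp

text \<open>The update of \<open>scheme_w\<close> takes the new \<open>u\<close> but the old value
  \<open>d\<close> of \<open>b\<close>, so \<open>w + mesh n * d * v\<close> equals
  \<open>\<beta> * v + d * u'\<close> exactly. The terms with \<open>b\<close> then cancel in the
  discrete Wronskian, and no discretization error is left.\<close>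

lemma scheme_christoffel_darboux:
  "scheme_u n s i * scheme_w n t i - scheme_u n t i * scheme_w n s i
     = (t - s) * (\<Sum>j=1..i. mesh n * (scheme_u n s j * scheme_u n t j))"
proof (induction i)
  case (Suc i)
  define d where "d = b (real i * mesh n)"
  have "scheme_u n s (Suc i) * scheme_w n t (Suc i) - scheme_u n t (Suc i) * scheme_w n s (Suc i)
    = (scheme_u n s i * scheme_w n t i - scheme_u n t i * scheme_w n s i)
      + (t - s) * (mesh n * (scheme_u n s (Suc i) * scheme_u n t (Suc i)))"
    unfolding scheme_w_Suc scheme_w_eq[of _ _ i] d_def[symmetric] scheme_u_Suc
    by (simp add: algebra_simps)
  then show ?case unfolding Suc by (simp add: algebra_simps)
qed simp

text \<open>Without \<open>scheme_w\<close> the scheme reads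
  \<open>c * u (i + 2) = (t - a i) * u (i + 1) - c * u i\<close>, the recurrence for the components
  of an eigenvector; the powers of \<open>c\<close> make it the monic recurrence. At
  \<open>i = n\<close> the right boundary value of the scheme becomes a multiple of the
  characteristic polynomial.\<close>

lemma scheme_u_jacobi_poly:
  fixes n :: nat
  defines "c \<equiv> \<beta> * (real n + 1)\<^sup>2"
    and "a \<equiv> tridiagonal_diag \<beta> n (\<lambda>i. sqrt (real n + 1) * (b (real i * mesh n) - b (real (i - 1) * mesh n)))"
  shows "c ^ i * scheme_u n t (Suc i) = mesh n / \<beta> * poly (jacobi_poly a c i) t"
proof (induction i rule: induct_nat_012)
  case 0
  show ?case by (simp add: scheme_u_Suc)
next
  have h: "mesh n * (real n + 1) = 1" by (simp add: mesh_def)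
  \<comment> \<open>The root in the sample and the root in the diagonal entry multiply to
    \<open>n + 1\<close>, so the noise part is a difference quotient of \<open>b\<close>.\<close>
  have a: "a i = (b (real (Suc i) * mesh n) - b (real i * mesh n)) * (real n + 1) - 2 * c" for i
    using real_sqrt_mult_self[of "real n + 1"]
    by (simp add: a_def tridiagonal_diag_def c_def mult.assoc[symmetric] del: real_sqrt_mult_self)
  have "mesh n * mesh n * c = \<beta> * (mesh n * (real n + 1))\<^sup>2" by (simp add: c_def power2_eq_square)
  then have hc: "mesh n * mesh n * c = \<beta>" unfolding h by simp
  have rec: "c * scheme_u n t (Suc (Suc i)) = (t - a i) * scheme_u n t (Suc i) - c * scheme_u n t i" for i
  proof -
    define d d' where "d = b (real i * mesh n)" and "d' = b (real (Suc i) * mesh n)"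
    define u v u' where "u = scheme_u n t i" and "v = scheme_v n t i" and "u' = scheme_u n t (Suc i)"
    have u': "u' = u + mesh n * v" by (simp add: u'_def u_def v_def scheme_u_Suc)
    have "\<beta> * scheme_v n t (Suc i) = scheme_w n t (Suc i) - d' * u'"
      using scheme_w_eq[of n t "Suc i"] by (simp add: d'_def u'_def)
    also have "\<dots> = \<beta> * v + d * u + mesh n * (t * u' + d * v) - d' * u'"
      unfolding scheme_w_Suc scheme_w_eq[of n t i] by (simp add: d_def u_def v_def u'_def)
    also have "\<dots> = \<beta> * v + (d + mesh n * t - d') * u'" unfolding u' by (simp add: algebra_simps)
    finally have v': "\<beta> * scheme_v n t (Suc i) = \<beta> * v + (d + mesh n * t - d') * u'" .
    have "c * mesh n * \<beta> * (mesh n * scheme_v n t (Suc i) - mesh n * v)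
        = \<beta> * (\<beta> * scheme_v n t (Suc i) - \<beta> * v)"
      using hc by (simp add: algebra_simps)
    then have "c * mesh n * (mesh n * scheme_v n t (Suc i) - mesh n * v)
        = (d + mesh n * t - d') * u'"
      using v' beta_pos by (simp add: mult.assoc)
    then have "(real n + 1) * (c * mesh n * (mesh n * scheme_v n t (Suc i) - mesh n * v))
        = (real n + 1) * ((d + mesh n * t - d') * u')" by simp
    then have "(mesh n * (real n + 1)) * (c * (mesh n * scheme_v n t (Suc i) - mesh n * v))
        = ((d - d') * (real n + 1) + (mesh n * (real n + 1)) * t) * u'" by (simp add: algebra_simps)
    then have "c * (mesh n * scheme_v n t (Suc i) - mesh n * v) = ((d - d') * (real n + 1) + t) * u'"
      unfolding h by simp
    moreover have ai: "a i = (d' - d) * (real n + 1) - 2 * c" by (simp add: a d_def d'_def)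
    moreover have "c * u' - c * u = c * (mesh n * v)" unfolding u' by (simp add: algebra_simps)
    ultimately have "c * (u' + mesh n * scheme_v n t (Suc i)) = (t - a i) * u' - c * u"
      unfolding ai by (simp add: algebra_simps)
    then show ?thesis by (simp add: scheme_u_Suc[of n t "Suc i"] u'_def u_def)
  qed
  {
    case 1
    show ?case using rec[of 0] by (simp add: scheme_u_Suc)
  next
    case (ge2 i)
    have "c ^ Suc (Suc i) * scheme_u n t (Suc (Suc (Suc i)))
        = c ^ Suc i * ((t - a (Suc i)) * scheme_u n t (Suc (Suc i)) - c * scheme_u n t (Suc i))"
      using rec[of "Suc i"] by simp
    also have "\<dots> = (t - a (Suc i)) * (c ^ Suc i * scheme_u n t (Suc (Suc i)))
        - c\<^sup>2 * (c ^ i * scheme_u n t (Suc i))"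
      by (simp add: algebra_simps power2_eq_square)
    also have "\<dots> = mesh n / \<beta> * poly (jacobi_poly a c (Suc (Suc i))) t"
      unfolding ge2 by (simp add: algebra_simps)
    finally show ?case .
  }
qed

text \<open>For large \<open>t\<close> the cone \<open>0 \<le> u\<close>,
  \<open>K * u \<le> w\<close> is invariant, and inside it \<open>scheme_v\<close> is nonnegative
  because \<open>b\<close> is at most \<open>K\<close>. The factor 4 comes from
  \<open>(K - d)\<^sup>2 \<le> (2 * K)\<^sup>2\<close>, a loss that \<open>\<beta> * t * u'\<close>
  covers; the rest of the loss is covered by \<open>w - K * u\<close> once the mesh is
  small.\<close>

lemma scheme_u_increasing:
  assumes K: "K > 0" "\<And>x. x \<in> {0..1} \<Longrightarrow> \<bar>b x\<bar> \<le> K"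
    and n: "2 * K * mesh n \<le> \<beta>" and t: "4 * K\<^sup>2 / \<beta> \<le> t" and "i \<le> n"
  shows "0 \<le> scheme_u n t i \<and> K * scheme_u n t i \<le> scheme_w n t i \<and>
    scheme_u n t i \<le> scheme_u n t (Suc i)"
proof -
  have step: "scheme_u n t j \<le> scheme_u n t (Suc j)"
    if "0 \<le> scheme_u n t j" "K * scheme_u n t j \<le> scheme_w n t j" "j \<le> n" for j
  proof -
    have "b (real j * mesh n) * scheme_u n t j \<le> K * scheme_u n t j"
      using K(2)[OF grid_in_unit[of j n]] that by (intro mult_right_mono) auto
    then have "scheme_v n t j \<ge> 0" using that beta_pos by (simp add: scheme_v_def)
    then show ?thesis by (simp add: scheme_u_Suc)
  qed
  have "0 \<le> scheme_u n t i \<and> K * scheme_u n t i \<le> scheme_w n t i" using \<open>i \<le> n\<close>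
  proof (induction i)
    case (Suc i)
    define d where "d = b (real i * mesh n)"
    define u w v u' where "u = scheme_u n t i" and "w = scheme_w n t i" and "v = scheme_v n t i"
      and "u' = scheme_u n t (Suc i)"
    have IH: "0 \<le> u" "K * u \<le> w" "u \<le> u'" using Suc step[of i] by (auto simp: u_def w_def u'_def)
    have d: "\<bar>d\<bar> \<le> K" unfolding d_def using K(2)[OF grid_in_unit[of i n]] Suc.prems by simp
    have v: "\<beta> * v = w - d * u" using beta_pos by (simp add: v_def scheme_v_def u_def w_def d_def)
    have "(K - d) * (\<beta> * v) = (K - d) * (w - K * u) + (K - d)\<^sup>2 * u"
      unfolding v by (simp add: algebra_simps power2_eq_square)
    also have "\<dots> \<le> 2 * K * (w - K * u) + (2 * K)\<^sup>2 * u'"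
      using d IH by (intro add_mono mult_right_mono mult_mono power_mono) auto
    also have "(2 * K)\<^sup>2 * u' \<le> (\<beta> * t) * u'"
      using t beta_pos IH by (intro mult_right_mono) (auto simp: field_simps)
    finally have "mesh n * ((K - d) * (\<beta> * v)) \<le> mesh n * (2 * K * (w - K * u) + (\<beta> * t) * u')"
      by (intro mult_left_mono) auto
    also have "\<dots> = (2 * K * mesh n) * (w - K * u) + \<beta> * (mesh n * t * u')" by (simp add: algebra_simps)
    also have "\<dots> \<le> \<beta> * (w - K * u) + \<beta> * (mesh n * t * u')"
      using n IH by (intro add_right_mono mult_right_mono) auto
    finally have "\<beta> * (mesh n * (K - d) * v) \<le> \<beta> * (w - K * u + mesh n * t * u')"
      by (simp add: algebra_simps)
    then have "mesh n * (K - d) * v \<le> w - K * u + mesh n * t * u'" using beta_pos by simp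
    moreover have "u' = u + mesh n * v" by (simp add: u'_def u_def v_def scheme_u_Suc)
    moreover have "scheme_w n t (Suc i) = w + mesh n * (t * u' + d * v)"
      by (simp add: scheme_w_Suc w_def u'_def d_def v_def)
    ultimately have "K * u' \<le> scheme_w n t (Suc i)" by (simp add: algebra_simps)
    then show ?case using IH by (simp add: u'_def)
  qed simp
  with step[of i] \<open>i \<le> n\<close> show ?thesis by blast
qed

text \<open>The first step already gives \<open>mesh n / \<beta> > 0\<close>, and the scheme does
  not decrease afterwards. This yields one upper bound for the eigenvalues of all large
  matrices.\<close>

lemma scheme_u_end_pos:
  assumes K: "K > 0" "\<And>x. x \<in> {0..1} \<Longrightarrow> \<bar>b x\<bar> \<le> K"
    and n: "2 * K * mesh n \<le> \<beta>" and t: "4 * K\<^sup>2 / \<beta> \<le> t"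
  shows "scheme_u n t (Suc n) > 0"
proof -
  have "scheme_u n t (Suc 0) \<le> scheme_u n t (Suc i)" if "i \<le> n" for i
    using that
  proof (induction i)
    case (Suc i)
    then show ?case using scheme_u_increasing[OF K n t, of "Suc i"] by simp
  qed simp
  from this[of n] have "mesh n / \<beta> \<le> scheme_u n t (Suc n)" by (simp add: scheme_u_Suc[of _ _ 0])
  then show ?thesis using beta_pos mesh_pos(1)[of n] less_le_trans divide_pos_pos by blast
qed

end

section \<open>The continuous shooting problem and uniform convergence of the scheme to it\<close>

context continuous_path
begin

definition shooting :: "real \<Rightarrow> (real \<Rightarrow> real) \<times> (real \<Rightarrow> real)" where
  "shooting t = (SOME (y, z). y 0 = 0 \<and> z 0 = 1 \<and> (\<forall>x\<in>{0..1}.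
     (y has_real_derivative (z x - b x * y x) / \<beta>) (at x within {0..1}) \<and>
     (z has_real_derivative t * y x + b x * ((z x - b x * y x) / \<beta>)) (at x within {0..1})))"

definition phi where "phi t = fst (shooting t)"
definition psi where "psi t = snd (shooting t)"
text \<open>The derivative of \<open>phi\<close>, read off from the quasi-derivative
  \<open>psi\<close>. In this form it is continuous up to both end points.\<close>

definition dphi where "dphi t x = (psi t x - b x * phi t x) / \<beta>"

lemma inhomogeneous_solution:
  assumes "continuous_on {0..1} f"
  obtains y z where "y 0 = y0" "z 0 = z0"
    "\<And>x. x \<in> {0..1} \<Longrightarrow> (y has_real_derivative (z x - b x * y x) / \<beta>) (at x within {0..1})"
    "\<And>x. x \<in> {0..1} \<Longrightarrow>
       (z has_real_derivative t * y x + b x * ((z x - b x * y x) / \<beta>) + f x) (at x within {0..1})"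
proof -
  have nz: "\<beta> \<noteq> 0" using beta_pos by simp
  obtain y z where yz: "y 0 = y0" "z 0 = z0"
    "\<And>x. x \<in> {0..1} \<Longrightarrow> (y has_real_derivative (- b x / \<beta>) * y x + (1 / \<beta>) * z x + 0) (at x within {0..1})"
    "\<And>x. x \<in> {0..1} \<Longrightarrow>
       (z has_real_derivative (t - b x * b x / \<beta>) * y x + (b x / \<beta>) * z x + f x) (at x within {0..1})"
    by (rule linear_system_solution[of "\<lambda>x. - b x / \<beta>" "\<lambda>x. 1 / \<beta>" "\<lambda>x. t - b x * b x / \<beta>"
          "\<lambda>x. b x / \<beta>" "\<lambda>_. 0" f y0 z0])
      (auto intro!: continuous_intros cont_b assms simp: nz)
  show ?thesis
  proof (rule that[of y z, OF yz(1,2)])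
    fix x :: real assume x: "x \<in> {0..1}"
    show "(y has_real_derivative (z x - b x * y x) / \<beta>) (at x within {0..1})"
      by (rule DERIV_cong[OF yz(3)[OF x]]) (simp add: diff_divide_distrib)
    show "(z has_real_derivative t * y x + b x * ((z x - b x * y x) / \<beta>) + f x) (at x within {0..1})"
      by (rule DERIV_cong[OF yz(4)[OF x]]) (simp add: diff_divide_distrib algebra_simps)
  qed
qed

lemma shooting:
  shows phi_0 [simp]: "phi t 0 = 0" and psi_0 [simp]: "psi t 0 = 1"
    and DERIV_phi: "x \<in> {0..1} \<Longrightarrow> (phi t has_real_derivative dphi t x) (at x within {0..1})"
    and DERIV_psi: "x \<in> {0..1} \<Longrightarrow>
      (psi t has_real_derivative t * phi t x + b x * dphi t x) (at x within {0..1})"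
proof -
  have "\<exists>p. case p of (y, z) \<Rightarrow> y 0 = 0 \<and> z 0 = 1 \<and> (\<forall>x\<in>{0..1}.
     (y has_real_derivative (z x - b x * y x) / \<beta>) (at x within {0..1}) \<and>
     (z has_real_derivative t * y x + b x * ((z x - b x * y x) / \<beta>)) (at x within {0..1}))"
  proof -
    obtain y z where "y 0 = 0" "z 0 = 1"
      "\<And>x. x \<in> {0..1} \<Longrightarrow> (y has_real_derivative (z x - b x * y x) / \<beta>) (at x within {0..1})"
      "\<And>x. x \<in> {0..1} \<Longrightarrow>
         (z has_real_derivative t * y x + b x * ((z x - b x * y x) / \<beta>) + 0) (at x within {0..1})"
      by (rule inhomogeneous_solution[of "\<lambda>_. 0" 0 1 t]) auto
    then show ?thesis by (intro exI[of _ "(y, z)"]) auto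
  qed
  then have *: "case shooting t of (y, z) \<Rightarrow> y 0 = 0 \<and> z 0 = 1 \<and> (\<forall>x\<in>{0..1}.
     (y has_real_derivative (z x - b x * y x) / \<beta>) (at x within {0..1}) \<and>
     (z has_real_derivative t * y x + b x * ((z x - b x * y x) / \<beta>)) (at x within {0..1}))"
    unfolding shooting_def by (rule someI_ex)
  then show "phi t 0 = 0" "psi t 0 = 1"
    "x \<in> {0..1} \<Longrightarrow> (phi t has_real_derivative dphi t x) (at x within {0..1})"
    "x \<in> {0..1} \<Longrightarrow> (psi t has_real_derivative t * phi t x + b x * dphi t x) (at x within {0..1})"
    by (auto simp: phi_def psi_def dphi_def case_prod_beta)
qed

lemma cont_phi: "continuous_on {0..1} (phi t)"
  by (rule DERIV_continuous_on[OF DERIV_phi])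

lemma cont_psi: "continuous_on {0..1} (psi t)"
  by (rule DERIV_continuous_on[OF DERIV_psi])

lemma cont_dphi: "continuous_on {0..1} (dphi t)"
  unfolding dphi_def using beta_pos by (intro continuous_intros cont_phi cont_psi cont_b) auto

text \<open>The derivatives in question contain \<open>b\<close>, which is merely continuous, so the
  local error is small compared with the mesh but has no rate; uniform continuity of
  \<open>g'\<close> makes it uniform over the grid. Applied to an antiderivative this also gives
  convergence of Riemann sums.\<close>

lemma euler_step_error:
  fixes g g' :: "real \<Rightarrow> real"
  assumes "\<And>x. x \<in> {0..1} \<Longrightarrow> (g has_real_derivative g' x) (at x within {0..1})"
    and "continuous_on {0..1} g'" "\<omega> > 0"
  shows "\<forall>\<^sub>F n in sequentially. \<forall>i\<le>n.
    \<bar>g (real (Suc i) * mesh n) - g (real i * mesh n) - mesh n * g' (real i * mesh n)\<bar> \<le> mesh n * \<omega>"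
proof -
  have "uniformly_continuous_on {0..1} g'"
    using assms(2) by (rule compact_uniformly_continuous) simp
  then obtain \<delta> where d: "\<delta> > 0" "\<And>x y. x \<in> {0..1} \<Longrightarrow> y \<in> {0..1} \<Longrightarrow> dist x y < \<delta> \<Longrightarrow> dist (g' x) (g' y) < \<omega>"
    unfolding uniformly_continuous_on_def using assms(3) by metis
  have "\<forall>\<^sub>F n in sequentially. mesh n < \<delta>" using mesh_tendsto d(1) by (rule order_tendstoD)
  then show ?thesis
  proof eventually_elim
    case (elim n)
    show ?case
    proof (intro allI impI)
      fix i assume i: "i \<le> n"
      define x where "x = real i * mesh n"
      define x' where "x' = real (Suc i) * mesh n"
      have x': "x' = x + mesh n" by (simp add: x_def x'_def algebra_simps)
      have sub: "{x..x'} \<subseteq> {0..1}"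
        using grid_in_unit[of i n] grid_in_unit[of "Suc i" n] i by (auto simp: x_def x'_def)
      have lt: "x < x'" by (simp add: x')
      have "\<exists>z\<in>{x<..<x'}. g x' - g x = g' z * (x' - x)"
      proof (rule mvt_simple[OF lt])
        fix z assume "x \<le> z" "z \<le> x'"
        then have "z \<in> {0..1}" using sub by auto
        from has_field_derivative_subset[OF assms(1)[OF this] sub]
        show "(g has_derivative (\<lambda>h. g' z * h)) (at z within {x..x'})"
          by (simp add: has_field_derivative_def)
      qed
      then obtain z where z: "x < z" "z < x'" "g x' - g x = mesh n * g' z" using x' by auto
      have "dist (g' z) (g' x) < \<omega>"
        using z sub elim by (intro d(2)) (auto simp: dist_real_def x' subset_iff)
      then have "mesh n * \<bar>g' z - g' x\<bar> \<le> mesh n * \<omega>"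
        by (intro mult_left_mono) (auto simp: dist_real_def)
      moreover have "\<bar>g x' - g x - mesh n * g' x\<bar> = mesh n * \<bar>g' z - g' x\<bar>"
        unfolding z(3) by (simp add: abs_mult right_diff_distrib[symmetric])
      ultimately show "\<bar>g (real (Suc i) * mesh n) - g (real i * mesh n) - mesh n * g' (real i * mesh n)\<bar>
          \<le> mesh n * \<omega>"
        by (simp only: x_def x'_def)
    qed
  qed
qed

text \<open>The scheme at parameter \<open>s\<close> is compared directly with the solution at
  \<open>t\<close>; the mismatch of parameters counts as one more local error. Uniformity near
  \<open>t\<close> thus comes from the same Gronwall estimate.\<close>

lemma scheme_tendsto:
  assumes "\<eta> > 0"
  shows "\<exists>\<epsilon>>0. \<forall>\<^sub>F n in sequentially. \<forall>s. \<bar>s - t\<bar> < \<epsilon> \<longrightarrow> (\<forall>i\<le>Suc n.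
    \<bar>scheme_u n s i - phi t (real i * mesh n)\<bar> + \<bar>scheme_w n s i - psi t (real i * mesh n)\<bar> < \<eta>)"
proof -
  obtain K where K: "K > 0" "\<And>x. x \<in> {0..1} \<Longrightarrow> \<bar>b x\<bar> \<le> K"
    using continuous_on_unit_bounded cont_b by blast
  obtain G where G: "G > 0" "\<And>x. x \<in> {0..1} \<Longrightarrow> \<bar>phi t x\<bar> \<le> G"
    using continuous_on_unit_bounded[OF cont_phi] by blast
  obtain D where D: "D > 0" "\<And>x. x \<in> {0..1} \<Longrightarrow> \<bar>dphi t x\<bar> \<le> D"
    using continuous_on_unit_bounded[OF cont_dphi] by blast
  define M T where "M = (1 + K) / \<beta>" and "T = \<bar>t\<bar> + 1"
  have MT: "M > 0" "T > 0" using K beta_pos by (auto simp: M_def T_def)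
  define A where "A = M + T + T * M + K * M"
  define c where "c = 2 + T + T * D + T + G"
  have A: "A > 0" and c: "c > 0" using MT K G D by (auto simp: A_def c_def intro!: add_pos_pos)
  \<comment> \<open>\<open>\<kappa>\<close> bounds the Euler errors, the mesh and
    \<open>\<bar>s - t\<bar>\<close> at the same time. \<open>A\<close> is the growth rate and
    \<open>c\<close> collects the coefficients of \<open>\<kappa>\<close>, so that Gronwall ends
    with \<open>c * \<kappa> * exp A = \<eta> / 2\<close>.\<close>
  define \<kappa> where "\<kappa> = \<eta> / (2 * c * exp A)"
  have k: "\<kappa> > 0" using assms c by (simp add: \<kappa>_def)
  define \<epsilon> where "\<epsilon> = min \<kappa> 1"
  have E1: "\<forall>\<^sub>F n in sequentially. \<forall>i\<le>n. \<bar>phi t (real (Suc i) * mesh n) - phi t (real i * mesh n)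
      - mesh n * dphi t (real i * mesh n)\<bar> \<le> mesh n * \<kappa>"
    by (rule euler_step_error[OF _ cont_dphi k]) (rule DERIV_phi)
  have E2: "\<forall>\<^sub>F n in sequentially. \<forall>i\<le>n. \<bar>psi t (real (Suc i) * mesh n) - psi t (real i * mesh n)
      - mesh n * (t * phi t (real i * mesh n) + b (real i * mesh n) * dphi t (real i * mesh n))\<bar> \<le> mesh n * \<kappa>"
    by (rule euler_step_error[OF _ _ k, where g' = "\<lambda>x. t * phi t x + b x * dphi t x"])
      (auto intro!: DERIV_psi continuous_intros cont_phi cont_dphi cont_b)
  have "\<forall>\<^sub>F n in sequentially. \<forall>s. \<bar>s - t\<bar> < \<epsilon> \<longrightarrow> (\<forall>i\<le>Suc n.
    \<bar>scheme_u n s i - phi t (real i * mesh n)\<bar> + \<bar>scheme_w n s i - psi t (real i * mesh n)\<bar> < \<eta>)"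
    using E1 E2 order_tendstoD(2)[OF mesh_tendsto k]
  proof eventually_elim
    case (elim n)
    show ?case
    proof (intro allI impI)
      fix s i assume s: "\<bar>s - t\<bar> < \<epsilon>" and "i \<le> Suc n"
      define h where "h = mesh n"
      have h: "h > 0" "h \<le> 1" "h < \<kappa>" using mesh_le_1 elim(3) by (auto simp: h_def)
      define a where "a j = scheme_u n s j - phi t (real j * h)" for j
      define e where "e j = scheme_w n s j - psi t (real j * h)" for j
      define S where "S j = \<bar>a j\<bar> + \<bar>e j\<bar>" for j
      have sT: "\<bar>s\<bar> \<le> T" "\<bar>s - t\<bar> \<le> \<kappa>" using s by (auto simp: T_def \<epsilon>_def)
      have "S (Suc j) \<le> S j * (1 + h * A) + h * (c * \<kappa>)" if j: "j < Suc n" for j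
      proof -
        define x x' where "x = real j * h" and "x' = real (Suc j) * h"
        have x: "x \<in> {0..1}" "x' \<in> {0..1}"
          using grid_in_unit[of j n] grid_in_unit[of "Suc j" n] j by (auto simp: x_def x'_def h_def)
        define r1 where "r1 = phi t x' - phi t x - h * dphi t x"
        define r2 where "r2 = psi t x' - psi t x - h * (t * phi t x + b x * dphi t x)"
        have r: "\<bar>r1\<bar> \<le> h * \<kappa>" "\<bar>r2\<bar> \<le> h * \<kappa>"
          using elim j by (auto simp: r1_def r2_def x_def x'_def h_def)
        define q where "q = scheme_v n s j - dphi t x"
        have q: "\<bar>q\<bar> \<le> M * S j"
        proof -
          have "\<beta> * q = e j - b x * a j"
          proof -
            have "\<beta> * scheme_v n s j = scheme_w n s j - b x * scheme_u n s j"
              "\<beta> * dphi t x = psi t x - b x * phi t x"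
              using beta_pos by (simp_all add: scheme_v_def dphi_def x_def h_def)
            then show ?thesis by (simp add: q_def e_def a_def x_def right_diff_distrib)
          qed
          then have "\<beta> * \<bar>q\<bar> = \<bar>e j - b x * a j\<bar>" using beta_pos by (metis abs_mult abs_of_pos)
          also have "\<dots> \<le> \<bar>e j\<bar> + \<bar>b x\<bar> * \<bar>a j\<bar>" unfolding abs_mult[symmetric] by linarith
          also have "\<dots> \<le> \<bar>e j\<bar> + K * \<bar>a j\<bar>" using K(2)[OF x(1)] by (intro add_left_mono mult_right_mono) auto
          also have "\<dots> \<le> (1 + K) * S j" using K(1) by (simp add: S_def algebra_simps)
          finally show ?thesis using beta_pos by (simp add: M_def field_simps)
        qed
        have S0: "S j \<ge> 0" by (simp add: S_def)
        have "a (Suc j) = a j + h * q - r1"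
          by (simp add: a_def scheme_u_Suc q_def r1_def x_def x'_def h_def algebra_simps)
        then have *: "\<bar>a (Suc j)\<bar> \<le> \<bar>a j\<bar> + \<bar>h * q\<bar> + \<bar>r1\<bar>" by linarith
        have a1: "\<bar>a (Suc j)\<bar> \<le> \<bar>a j\<bar> + h * (M * S j) + h * \<kappa>"
        proof -
          have "\<bar>h * q\<bar> \<le> h * (M * S j)" unfolding abs_mult using q h by (simp add: mult_left_mono)
          with * r(1) show ?thesis by linarith
        qed
        \<comment> \<open>The scheme uses the new \<open>u\<close> while \<open>phi\<close> is taken
          at the old node. The difference of the two nodes contributes
          \<open>h * dphi t x + r1\<close>, which is of order \<open>\<kappa>\<close> because
          \<open>h < \<kappa>\<close>.\<close>
        define z where "z = s * scheme_u n s (Suc j) - t * phi t x"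
        have z_eq: "z = s * (a (Suc j) + h * dphi t x + r1) + (s - t) * phi t x"
          by (simp add: z_def a_def r1_def x'_def algebra_simps)
        have "\<bar>z\<bar> \<le> \<bar>s\<bar> * \<bar>a (Suc j) + h * dphi t x + r1\<bar> + \<bar>s - t\<bar> * \<bar>phi t x\<bar>"
          unfolding z_eq abs_mult[symmetric] by linarith
        also have "\<dots> \<le> T * ((S j + M * S j + \<kappa>) + D * \<kappa> + \<kappa>) + \<kappa> * G"
        proof (intro add_mono mult_mono)
          have "\<bar>h * dphi t x\<bar> \<le> \<kappa> * D"
            unfolding abs_mult using h D(2)[OF x(1)] by (intro mult_mono) auto
          moreover have "h * (M * S j) \<le> 1 * (M * S j)" using h MT S0 by (intro mult_right_mono) auto
          moreover have "h * \<kappa> \<le> 1 * \<kappa>" using h k by (intro mult_right_mono) auto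
          moreover have "\<bar>a j\<bar> \<le> S j" by (simp add: S_def)
          ultimately show "\<bar>a (Suc j) + h * dphi t x + r1\<bar> \<le> (S j + M * S j + \<kappa>) + D * \<kappa> + \<kappa>"
            using a1 r(1) by (simp add: mult.commute[of D])
        qed (use sT G(2)[OF x(1)] MT k in auto)
        finally have zb: "\<bar>z\<bar> \<le> T * ((S j + M * S j + \<kappa>) + D * \<kappa> + \<kappa>) + \<kappa> * G" .
        have "e (Suc j) = e j + h * (z + b x * q) - r2"
          by (simp add: e_def scheme_w_Suc q_def r2_def z_def x_def x'_def h_def algebra_simps)
        then have "\<bar>e (Suc j)\<bar> \<le> \<bar>e j\<bar> + \<bar>h * (z + b x * q)\<bar> + \<bar>r2\<bar>" by linarith
        also have "\<bar>h * (z + b x * q)\<bar> \<le> h * ((T * ((S j + M * S j + \<kappa>) + D * \<kappa> + \<kappa>) + \<kappa> * G) + K * (M * S j))"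
        proof -
          have "\<bar>b x * q\<bar> \<le> K * (M * S j)"
            unfolding abs_mult using K(1) K(2)[OF x(1)] q by (intro mult_mono) auto
          then have "\<bar>z + b x * q\<bar> \<le> (T * ((S j + M * S j + \<kappa>) + D * \<kappa> + \<kappa>) + \<kappa> * G) + K * (M * S j)"
            using zb by linarith
          then show ?thesis unfolding abs_mult using h by (simp add: mult_left_mono)
        qed
        finally have "S (Suc j) \<le> S j + h * (M * S j) + h * \<kappa>
            + h * ((T * ((S j + M * S j + \<kappa>) + D * \<kappa> + \<kappa>) + \<kappa> * G) + K * (M * S j)) + h * \<kappa>"
          using a1 r(2) S_def[of j] S_def[of "Suc j"] by linarith
        also have "\<dots> = S j * (1 + h * A) + h * (c * \<kappa>)" by (simp add: A_def c_def algebra_simps)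
        finally show ?thesis .
      qed
      moreover have "S 0 = 0" by (simp add: S_def a_def e_def)
      ultimately have "S i \<le> real i * h * (c * \<kappa>) * exp (A * (real i * h))"
        using A c k h \<open>i \<le> Suc n\<close> by (intro discrete_gronwall[of S "Suc n"]) auto
      also have "\<dots> \<le> 1 * (c * \<kappa>) * exp (A * 1)"
        using grid_in_unit[OF \<open>i \<le> Suc n\<close>] A c k unfolding h_def
        by (intro mult_mono iffD2[OF exp_le_cancel_iff]) auto
      also have "\<dots> = \<eta> / 2" using c by (simp add: \<kappa>_def)
      also have "\<dots> < \<eta>" using assms by simp
      finally show "\<bar>scheme_u n s i - phi t (real i * mesh n)\<bar> + \<bar>scheme_w n s i - psi t (real i * mesh n)\<bar> < \<eta>"
        by (simp add: S_def a_def e_def h_def)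
    qed
  qed
  then show ?thesis using k by (intro exI[of _ \<epsilon>]) (simp add: \<epsilon>_def)
qed

end

section \<open>Zeros of the shooting function\<close>

context continuous_path
begin

text \<open>Lagrange's identity with quasi-derivatives: in the derivative of
  \<open>y1 * z2 - y2 * z1\<close> all terms with \<open>t\<close> and \<open>b\<close>
  cancel.\<close>

lemma wronskian_integral:
  assumes y1: "\<And>x. x \<in> {0..1} \<Longrightarrow> (y1 has_real_derivative (z1 x - b x * y1 x) / \<beta>) (at x within {0..1})"
    and z1: "\<And>x. x \<in> {0..1} \<Longrightarrow>
      (z1 has_real_derivative t * y1 x + b x * ((z1 x - b x * y1 x) / \<beta>)) (at x within {0..1})"
    and y2: "\<And>x. x \<in> {0..1} \<Longrightarrow> (y2 has_real_derivative (z2 x - b x * y2 x) / \<beta>) (at x within {0..1})"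
    and z2: "\<And>x. x \<in> {0..1} \<Longrightarrow>
      (z2 has_real_derivative t * y2 x + b x * ((z2 x - b x * y2 x) / \<beta>) + f x) (at x within {0..1})"
    and x: "x \<in> {0..1}"
  shows "((\<lambda>s. y1 s * f s) has_integral
    (y1 x * z2 x - y2 x * z1 x) - (y1 0 * z2 0 - y2 0 * z1 0)) {0..x}"
proof (rule fundamental_theorem_of_calculus[where f = "\<lambda>x. y1 x * z2 x - y2 x * z1 x"])
  fix s assume s: "s \<in> {0..x}"
  then have s1: "s \<in> {0..1}" using x by auto
  have sub: "{0..x} \<subseteq> {0..1}" using x by auto
  have "((\<lambda>x. y1 x * z2 x - y2 x * z1 x) has_real_derivative
      ((z1 s - b s * y1 s) / \<beta> * z2 s + (t * y2 s + b s * ((z2 s - b s * y2 s) / \<beta>) + f s) * y1 s)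
      - ((z2 s - b s * y2 s) / \<beta> * z1 s + (t * y1 s + b s * ((z1 s - b s * y1 s) / \<beta>)) * y2 s))
      (at s within {0..1})"
    by (intro DERIV_diff DERIV_mult y1[OF s1] z1[OF s1] y2[OF s1] z2[OF s1])
  moreover have "((z1 s - b s * y1 s) / \<beta> * z2 s + (t * y2 s + b s * ((z2 s - b s * y2 s) / \<beta>) + f s) * y1 s)
      - ((z2 s - b s * y2 s) / \<beta> * z1 s + (t * y1 s + b s * ((z1 s - b s * y1 s) / \<beta>)) * y2 s) = y1 s * f s"
    by (simp add: diff_divide_distrib algebra_simps)
  ultimately show "((\<lambda>x. y1 x * z2 x - y2 x * z1 x) has_vector_derivative y1 s * f s) (at s within {0..x})"
    using has_field_derivative_subset[OF _ sub] by (simp add: has_real_derivative_iff_has_vector_derivative)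
qed (use x in auto)

text \<open>The Wronskian with the solution that starts from \<open>(1, 0)\<close> is constant and
  nonzero.\<close>

lemma phi_psi_not_both_0:
  assumes "x \<in> {0..1}" "phi t x = 0"
  shows "psi t x \<noteq> 0"
proof
  assume "psi t x = 0"
  obtain y z where yz: "y 0 = 1" "z 0 = 0"
    "\<And>x. x \<in> {0..1} \<Longrightarrow> (y has_real_derivative (z x - b x * y x) / \<beta>) (at x within {0..1})"
    "\<And>x. x \<in> {0..1} \<Longrightarrow>
       (z has_real_derivative t * y x + b x * ((z x - b x * y x) / \<beta>) + 0) (at x within {0..1})"
    by (rule inhomogeneous_solution[of "\<lambda>_. 0" 1 0 t]) auto
  have "((\<lambda>s. phi t s * 0) has_integral
    (phi t x * z x - y x * psi t x) - (phi t 0 * z 0 - y 0 * psi t 0)) {0..x}"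
  proof (rule wronskian_integral[of "phi t" "psi t" t y z "\<lambda>_. 0" x])
    fix s :: real assume s: "s \<in> {0..1}"
    show "(phi t has_real_derivative (psi t s - b s * phi t s) / \<beta>) (at s within {0..1})"
      using DERIV_phi[OF s, of t] unfolding dphi_def .
    show "(psi t has_real_derivative t * phi t s + b s * ((psi t s - b s * phi t s) / \<beta>)) (at s within {0..1})"
      using DERIV_psi[OF s, of t] unfolding dphi_def .
  qed (fact yz(3) yz(4) assms(1))+
  then have "((\<lambda>s. 0 :: real) has_integral 1) {0..x}" using assms(2) \<open>psi t x = 0\<close> yz(1,2) by simp
  from has_integral_unique[OF this has_integral_0] show False by simp
qed

text \<open>\<open>phi t\<close> leaves \<open>0\<close> with slope \<open>1 / \<beta>\<close>, so
  it cannot vanish identically.\<close>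

lemma integral_phi_sq_pos: "integral {0..1} (\<lambda>x. (phi t x)\<^sup>2) > 0"
proof -
  have c: "continuous_on {0..1} (\<lambda>x. (phi t x)\<^sup>2)" by (intro continuous_intros cont_phi)
  have "integral {0..1} (\<lambda>x. (phi t x)\<^sup>2) \<noteq> 0"
  proof
    assume "integral {0..1} (\<lambda>x. (phi t x)\<^sup>2) = 0"
    then have z: "\<And>x. x \<in> {0..1} \<Longrightarrow> phi t x = 0"
      using integral_eq_0_iff[OF c] by auto
    have "((\<lambda>x. 0) has_vector_derivative dphi t 0) (at 0 within {0..1})"
      using DERIV_phi[of 0 t] z unfolding has_real_derivative_iff_has_vector_derivative
      by (auto intro: has_vector_derivative_transform[rotated 2])
    moreover have "((\<lambda>x. 0) has_vector_derivative 0) (at 0 within {0..1})" by simp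
    ultimately have "dphi t 0 = 0"
      using vector_derivative_unique_within_closed_interval[of 0 1 0 "\<lambda>x. 0::real" "dphi t 0" 0] by auto
    then show False using beta_pos by (simp add: dphi_def)
  qed
  moreover have "integral {0..1} (\<lambda>x. (phi t x)\<^sup>2) \<ge> 0"
    by (rule Henstock_Kurzweil_Integration.integral_nonneg[OF integrable_continuous_real[OF c]]) simp
  ultimately show ?thesis by linarith
qed

section \<open>A lower bound, uniform in \<open>n\<close>, for the Christoffel-Darboux sum\<close>

lemma riemann_sum_tendsto:
  fixes g :: "real \<Rightarrow> real"
  assumes "continuous_on {0..1} g"
  shows "(\<lambda>n. \<Sum>i\<le>n. mesh n * g (real i * mesh n)) \<longlonglongrightarrow> integral {0..1} g"
proof (rule tendstoI)
  fix \<omega> :: real assume w: "\<omega> > 0"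
  define \<Gamma> where "\<Gamma> x = integral {0..x} g" for x
  have "\<forall>\<^sub>F n in sequentially. \<forall>i\<le>n. \<bar>\<Gamma> (real (Suc i) * mesh n) - \<Gamma> (real i * mesh n)
      - mesh n * g (real i * mesh n)\<bar> \<le> mesh n * (\<omega> / 2)"
    using w by (intro euler_step_error[OF _ assms])
      (auto simp: \<Gamma>_def has_real_derivative_iff_has_vector_derivative intro!: integral_has_vector_derivative assms)
  then show "\<forall>\<^sub>F n in sequentially. dist (\<Sum>i\<le>n. mesh n * g (real i * mesh n)) (integral {0..1} g) < \<omega>"
  proof eventually_elim
    case (elim n)
    have "\<Gamma> 1 = (\<Sum>i\<le>n. \<Gamma> (real (Suc i) * mesh n) - \<Gamma> (real i * mesh n))"
      using sum_lessThan_telescope[of "\<lambda>i. \<Gamma> (real i * mesh n)" "Suc n"] grid_end[of n]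
      by (simp add: lessThan_Suc_atMost \<Gamma>_def)
    then have "\<bar>\<Gamma> 1 - (\<Sum>i\<le>n. mesh n * g (real i * mesh n))\<bar>
        = \<bar>\<Sum>i\<le>n. \<Gamma> (real (Suc i) * mesh n) - \<Gamma> (real i * mesh n) - mesh n * g (real i * mesh n)\<bar>"
      by (simp add: sum_subtractf)
    also have "\<dots> \<le> (\<Sum>i\<le>n. mesh n * (\<omega> / 2))"
      using elim by (intro order_trans[OF sum_abs] sum_mono) auto
    also have "\<dots> = real (Suc n) * mesh n * (\<omega> / 2)" by simp
    also have "\<dots> < \<omega>" unfolding grid_end using w by simp
    finally show ?case by (simp add: \<Gamma>_def dist_real_def abs_minus_commute)
  qed
qed

lemma product_lower_bound:
  fixes u v p G \<eta> :: real
  assumes "\<bar>u - p\<bar> < \<eta>" "\<bar>v - p\<bar> < \<eta>" "\<bar>p\<bar> \<le> G" "\<eta> \<le> 1"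
  shows "u * v \<ge> p\<^sup>2 - (2 * G + 1) * \<eta>"
proof -
  have "\<eta> > 0" using assms(1) by linarith
  have "\<bar>u * v - p\<^sup>2\<bar> = \<bar>(u - p) * (v - p) + p * (u - p) + p * (v - p)\<bar>"
    by (simp add: algebra_simps power2_eq_square)
  also have "\<dots> \<le> \<bar>u - p\<bar> * \<bar>v - p\<bar> + \<bar>p\<bar> * \<bar>u - p\<bar> + \<bar>p\<bar> * \<bar>v - p\<bar>"
    unfolding abs_mult[symmetric] by linarith
  also have "\<dots> \<le> \<eta> * 1 + G * \<eta> + G * \<eta>"
    using assms by (intro add_mono mult_mono) auto
  finally show ?thesis by (simp add: algebra_simps)
qed

text \<open>For \<open>s\<close> and \<open>t\<close> near \<open>t0\<close> the sum is close to the
  integral \<open>I\<close> of \<open>(phi t0)\<^sup>2\<close>. The Riemann sum is eventually above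
  \<open>I / 2\<close>, and \<open>\<eta>\<close> is chosen so that replacing the scheme by
  \<open>phi t0\<close> costs at most \<open>I / 4\<close>.\<close>

lemma scheme_energy_lower_bound:
  "\<exists>\<delta>>0. \<exists>\<epsilon>>0. \<forall>\<^sub>F n in sequentially. \<forall>s t. \<bar>s - t0\<bar> < \<epsilon> \<longrightarrow> \<bar>t - t0\<bar> < \<epsilon> \<longrightarrow>
     \<delta> \<le> (\<Sum>j=1..Suc n. mesh n * (scheme_u n s j * scheme_u n t j))"
proof -
  define I where "I = integral {0..1} (\<lambda>x. (phi t0 x)\<^sup>2)"
  have I: "I > 0" unfolding I_def by (rule integral_phi_sq_pos)
  obtain G where G: "G > 0" "\<And>x. x \<in> {0..1} \<Longrightarrow> \<bar>phi t0 x\<bar> \<le> G"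
    using continuous_on_unit_bounded[OF cont_phi] by blast
  define \<eta> where "\<eta> = min 1 (I / (4 * (2 * G + 1)))"
  have eta: "\<eta> > 0" "\<eta> \<le> 1" "(2 * G + 1) * \<eta> \<le> I / 4"
  proof -
    show "\<eta> > 0" "\<eta> \<le> 1" using G I by (auto simp: \<eta>_def)
    have "(2 * G + 1) * \<eta> \<le> (2 * G + 1) * (I / (4 * (2 * G + 1)))"
      using G by (intro mult_left_mono) (auto simp: \<eta>_def)
    also have "\<dots> = I / 4"
    proof -
      have cancel: "c * (I / (4 * c)) = I / 4" if "c \<noteq> 0" for c using that by simp
      have "2 * G + 1 \<noteq> 0" using G(1) by linarith
      from cancel[OF this] show ?thesis .
    qed
    finally show "(2 * G + 1) * \<eta> \<le> I / 4" .
  qed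
  obtain \<epsilon> where e: "\<epsilon> > 0" and ev: "\<forall>\<^sub>F n in sequentially. \<forall>s. \<bar>s - t0\<bar> < \<epsilon> \<longrightarrow> (\<forall>i\<le>Suc n.
    \<bar>scheme_u n s i - phi t0 (real i * mesh n)\<bar> + \<bar>scheme_w n s i - psi t0 (real i * mesh n)\<bar> < \<eta>)"
    using scheme_tendsto[OF eta(1), of t0] by blast
  have "(\<lambda>n. \<Sum>i\<le>n. mesh n * (phi t0 (real i * mesh n))\<^sup>2) \<longlonglongrightarrow> I"
    unfolding I_def by (rule riemann_sum_tendsto) (intro continuous_intros cont_phi)
  then have "\<forall>\<^sub>F n in sequentially. (\<Sum>i\<le>n. mesh n * (phi t0 (real i * mesh n))\<^sup>2) > I / 2"
    using I by (intro order_tendstoD(1)) auto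
  with ev have "\<forall>\<^sub>F n in sequentially. \<forall>s t. \<bar>s - t0\<bar> < \<epsilon> \<longrightarrow> \<bar>t - t0\<bar> < \<epsilon> \<longrightarrow>
     I / 4 \<le> (\<Sum>j=1..Suc n. mesh n * (scheme_u n s j * scheme_u n t j))"
  proof eventually_elim
    case (elim n)
    show ?case
    proof (intro allI impI)
      fix s t assume st: "\<bar>s - t0\<bar> < \<epsilon>" "\<bar>t - t0\<bar> < \<epsilon>"
      have "mesh n * ((phi t0 (real j * mesh n))\<^sup>2 - I / 4) \<le> mesh n * (scheme_u n s j * scheme_u n t j)"
        if "j \<in> {1..Suc n}" for j
      proof (intro mult_left_mono)
        have "\<bar>scheme_u n s j - phi t0 (real j * mesh n)\<bar> < \<eta>" if "\<bar>s - t0\<bar> < \<epsilon>" for s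
        proof -
          have "\<bar>scheme_u n s j - phi t0 (real j * mesh n)\<bar> + \<bar>scheme_w n s j - psi t0 (real j * mesh n)\<bar> < \<eta>"
            using elim(1) that \<open>j \<in> {1..Suc n}\<close> by auto
          then show ?thesis by linarith
        qed
        then have "\<bar>scheme_u n s j - phi t0 (real j * mesh n)\<bar> < \<eta>" "\<bar>scheme_u n t j - phi t0 (real j * mesh n)\<bar> < \<eta>"
          using st by auto
        then show "(phi t0 (real j * mesh n))\<^sup>2 - I / 4 \<le> scheme_u n s j * scheme_u n t j"
          using product_lower_bound[of _ _ \<eta> _ G] G(2)[OF grid_in_unit[of j n]] that eta by fastforce
      qed simp
      then have "(\<Sum>j=1..Suc n. mesh n * ((phi t0 (real j * mesh n))\<^sup>2 - I / 4))
          \<le> (\<Sum>j=1..Suc n. mesh n * (scheme_u n s j * scheme_u n t j))" by (rule sum_mono)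
      moreover have "(\<Sum>j=1..Suc n. mesh n * ((phi t0 (real j * mesh n))\<^sup>2 - I / 4))
          = (\<Sum>j=1..Suc n. mesh n * (phi t0 (real j * mesh n))\<^sup>2) - real (Suc n) * mesh n * (I / 4)"
        by (simp only: right_diff_distrib sum_subtractf sum_constant card_atLeastAtMost) simp
      \<comment> \<open>The Riemann sum runs over left end points, the identity over right ones. The
        two differ by the term at \<open>0\<close>, which vanishes, and the term at
        \<open>1\<close>, which is nonnegative.\<close>
      moreover have "(\<Sum>i\<le>n. mesh n * (phi t0 (real i * mesh n))\<^sup>2)
          \<le> (\<Sum>i\<le>Suc n. mesh n * (phi t0 (real i * mesh n))\<^sup>2)" by simp
      moreover have "(\<Sum>i\<le>Suc n. mesh n * (phi t0 (real i * mesh n))\<^sup>2)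
          = (\<Sum>j=1..Suc n. mesh n * (phi t0 (real j * mesh n))\<^sup>2)"
      proof -
        have "{..Suc n} = insert 0 {1..Suc n}" by auto
        then show ?thesis by (simp only:) (subst sum.insert, auto)
      qed
      ultimately show "I / 4 \<le> (\<Sum>j=1..Suc n. mesh n * (scheme_u n s j * scheme_u n t j))"
        unfolding grid_end using elim(2) by linarith
    qed
  qed
  then show ?thesis using I e by (intro exI[of _ "I / 4"] exI[of _ \<epsilon>] conjI) auto
qed

text \<open>The Riccati quotient \<open>r = \<psi> / \<phi>\<close> satisfies \<open>r' = t - (r - b)\<^sup>2 / \<beta>\<close>, so for very negative
  \<open>t\<close> the function \<open>arctan (r / a)\<close> decreases by more than \<open>\<pi>\<close> on an interval without zeros.\<close>

lemma oscillation:
  fixes p q \<sigma> :: real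
  assumes pq: "0 \<le> p" "p < q" "q \<le> 1" and \<sigma>: "\<sigma> = 1 \<or> \<sigma> = -1"
    and K: "\<And>x. x \<in> {0..1} \<Longrightarrow> \<bar>b x\<bar> \<le> K"
    and t: "t \<le> - ((8 * pi * \<beta> / (q - p))\<^sup>2 / (2 * \<beta>) + K\<^sup>2 / \<beta>)"
  shows "\<exists>x. p < x \<and> x < q \<and> \<sigma> * phi t x > 0"
proof (rule ccontr)
  assume "\<not> ?thesis"
  then have le: "\<sigma> * phi t x \<le> 0" if "p < x" "x < q" for x using that by force
  define y z where "y x = - \<sigma> * phi t x" and "z x = - \<sigma> * psi t x" for x
  have int: "at x within {0..1} = at x" if "p < x" "x < q" for x :: real
    using that pq by (intro at_within_interior) (auto simp: interior_atLeastAtMost_real)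
  have y': "(y has_real_derivative (z x - b x * y x) / \<beta>) (at x)" if "p < x" "x < q" for x
  proof -
    have "(phi t has_real_derivative dphi t x) (at x)" using DERIV_phi[of x t] int that pq by auto
    then show ?thesis unfolding y_def
      by (rule DERIV_cong[OF DERIV_cmult]) (simp add: z_def y_def dphi_def algebra_simps diff_divide_distrib)
  qed
  have z': "(z has_real_derivative t * y x + b x * ((z x - b x * y x) / \<beta>)) (at x)" if "p < x" "x < q" for x
  proof -
    have "(psi t has_real_derivative t * phi t x + b x * dphi t x) (at x)" using DERIV_psi[of x t] int that pq by auto
    then show ?thesis unfolding z_def
      by (rule DERIV_cong[OF DERIV_cmult]) (simp add: z_def y_def dphi_def algebra_simps diff_divide_distrib)
  qed
  \<comment> \<open>By assumption \<open>y\<close> is nonnegative, so an interior zero is a local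
    minimum; there \<open>y\<close> and \<open>y'\<close>, hence also \<open>z\<close>, would vanish
    together.\<close>
  have ypos: "y x > 0" if x: "p < x" "x < q" for x
  proof (rule ccontr)
    assume "\<not> y x > 0"
    then have y0: "y x = 0" using le[OF x] by (simp add: y_def)
    have "(z x - b x * y x) / \<beta> = 0"
    proof (rule DERIV_local_min[OF y'[OF x], of "min (x - p) (q - x)"])
      show "\<forall>w. \<bar>x - w\<bar> < min (x - p) (q - x) \<longrightarrow> y x \<le> y w"
        using le unfolding y0 by (auto simp: y_def)
    qed (use x in auto)
    then have "z x = 0" using y0 beta_pos by simp
    then show False using y0 \<sigma> phi_psi_not_both_0[of x t] x pq by (auto simp: y_def z_def)
  qed
  \<comment> \<open>With this scale the slope of \<open>g\<close> is at most
    \<open>- a / (2 * \<beta>)\<close>, a drop of \<open>2 * pi\<close> over half of the interval,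
    while the range of \<open>arctan\<close> has length \<open>pi\<close>.\<close>
  define a where "a = 8 * pi * \<beta> / (q - p)"
  have a: "a > 0" using pq beta_pos by (simp add: a_def)
  define g where "g x = arctan (z x / y x / a)" for x
  define r where "r x = z x / y x" for x
  have g': "\<exists>d. (g has_real_derivative d) (at x) \<and> d \<le> - (a / (2 * \<beta>))" if x: "p < x" "x < q" for x
  proof -
    have yx: "y x > 0" using ypos[OF x] .
    define D where "D = t - (r x - b x)\<^sup>2 / \<beta>"
    have "((\<lambda>x. z x / y x) has_real_derivative D) (at x)"
    proof (rule DERIV_cong[OF DERIV_divide[OF z'[OF x] y'[OF x]]])
      show "((t * y x + b x * ((z x - b x * y x) / \<beta>)) * y x - z x * ((z x - b x * y x) / \<beta>)) / (y x * y x) = D"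
        unfolding D_def r_def using yx beta_pos by (simp add: field_simps power2_eq_square)
    qed (use yx in simp)
    then have 1: "(g has_real_derivative (D / a) * inverse (1 + (r x / a)\<^sup>2)) (at x)"
      unfolding g_def r_def by (rule DERIV_cong[OF DERIV_chain2[OF DERIV_arctan DERIV_cdivide]]) simp
    have bK: "(b x)\<^sup>2 \<le> K\<^sup>2" using K[of x] x pq by (intro power2_le_iff_abs_le[THEN iffD2]) (auto intro: order_trans[OF abs_ge_zero])
    \<comment> \<open>Removes \<open>b\<close> from the quotient, keeping half of
      \<open>(r x)\<^sup>2\<close> and paying \<open>K\<^sup>2\<close>; the summand
      \<open>K\<^sup>2 / \<beta>\<close> in the bound on \<open>t\<close> compensates this.\<close>
    have "(r x)\<^sup>2 \<le> 2 * (r x - b x)\<^sup>2 + 2 * (b x)\<^sup>2"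
      using zero_le_power2[of "r x - 2 * b x"] by (simp add: power2_eq_square algebra_simps)
    then have "(r x)\<^sup>2 / 2 - K\<^sup>2 \<le> (r x - b x)\<^sup>2" using bK by linarith
    then have "((r x)\<^sup>2 / 2 - K\<^sup>2) / \<beta> \<le> (r x - b x)\<^sup>2 / \<beta>" using beta_pos by (intro divide_right_mono) auto
    then have "D \<le> - (a\<^sup>2 / (2 * \<beta>) + K\<^sup>2 / \<beta>) - ((r x)\<^sup>2 / 2 - K\<^sup>2) / \<beta>"
      using t by (simp add: D_def a_def)
    also have "\<dots> = - (a\<^sup>2 + (r x)\<^sup>2) / (2 * \<beta>)" using beta_pos by (simp add: field_simps)
    finally have D: "D \<le> - (a\<^sup>2 + (r x)\<^sup>2) / (2 * \<beta>)" .
    have pos: "a\<^sup>2 + (r x)\<^sup>2 > 0" using a by (simp add: sum_power2_gt_zero_iff)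
    have cancel: "- X / (2 * \<beta>) * (a / X) = - (a / (2 * \<beta>))" if "X > 0" for X
      using that beta_pos by (simp add: field_simps)
    have "(D / a) * inverse (1 + (r x / a)\<^sup>2) = D * (a / (a\<^sup>2 + (r x)\<^sup>2))"
      using a pos by (simp add: field_simps power2_eq_square)
    also have "\<dots> \<le> - (a\<^sup>2 + (r x)\<^sup>2) / (2 * \<beta>) * (a / (a\<^sup>2 + (r x)\<^sup>2))"
      using D a pos by (intro mult_right_mono) auto
    also have "\<dots> = - (a / (2 * \<beta>))" by (rule cancel[OF pos])
    finally show ?thesis using 1 by blast
  qed
  \<comment> \<open>Only the middle half is used, since \<open>y\<close> may vanish at
    \<open>p\<close> and \<open>q\<close>.\<close>
  define p' q' where "p' = p + (q - p) / 4" and "q' = q - (q - p) / 4"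
  have pq': "p < p'" "p' < q'" "q' < q" "q' - p' = (q - p) / 2" using pq by (auto simp: p'_def q'_def field_simps)
  have "\<exists>d. d \<le> - (a / (2 * \<beta>)) \<and> g q' - g p' = (q' - p') * d"
  proof -
    obtain G where G: "\<And>x. p < x \<Longrightarrow> x < q \<Longrightarrow> (g has_real_derivative G x) (at x) \<and> G x \<le> - (a / (2 * \<beta>))"
      using g' by metis
    have "\<exists>w>p'. w < q' \<and> g q' - g p' = (q' - p') * G w"
      by (rule MVT2[OF pq'(2)]) (use G pq' in auto)
    then obtain w where "p' < w" "w < q'" "g q' - g p' = (q' - p') * G w" by blast
    moreover have "G w \<le> - (a / (2 * \<beta>))" using G[of w] pq' calculation(1,2) by linarith
    ultimately show ?thesis by blast
  qed
  then obtain d where d: "d \<le> - (a / (2 * \<beta>))" "g q' - g p' = (q' - p') * d" by blast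
  have "g q' - g p' \<le> (q - p) / 2 * (- (a / (2 * \<beta>)))"
    unfolding d(2) pq'(4) using d(1) pq by (intro mult_left_mono) auto
  also have "\<dots> = - (2 * pi)" unfolding a_def using pq beta_pos by (simp add: field_simps)
  finally have "g q' - g p' \<le> - (2 * pi)" .
  moreover have "g q' > - (pi / 2)" "g p' < pi / 2" unfolding g_def by (rule arctan_lbound, rule arctan_ubound)
  ultimately show False using pi_gt_zero by linarith
qed

end

section \<open>Convergence of the eigenvalues along a path\<close>

context continuous_path
begin

definition grid_sample :: "nat \<Rightarrow> nat \<Rightarrow> real" where
  "grid_sample n i = sqrt (real n + 1) * (b (real i * mesh n) - b (real (i - 1) * mesh n))"

definition grid_eig :: "nat \<Rightarrow> nat \<Rightarrow> real" where
  "grid_eig n k = eigenvalues_decreasing (tridiagonal_matrix \<beta> n (grid_sample n)) ! k"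

abbreviation "grid_poly n \<equiv> jacobi_poly (tridiagonal_diag \<beta> n (grid_sample n)) (\<beta> * (real n + 1)\<^sup>2)"

lemma poly_grid_poly:
  "poly (grid_poly n i) t = \<beta> / mesh n * (\<beta> * (real n + 1)\<^sup>2) ^ i * scheme_u n t (Suc i)"
proof -
  have "grid_sample n = (\<lambda>i. sqrt (real n + 1) * (b (real i * mesh n) - b (real (i - 1) * mesh n)))"
    by (rule ext) (simp add: grid_sample_def)
  then have "(\<beta> * (real n + 1)\<^sup>2) ^ i * scheme_u n t (Suc i) = mesh n / \<beta> * poly (grid_poly n i) t"
    using scheme_u_jacobi_poly[of n i t] by simp
  moreover have "mesh n \<noteq> 0" "\<beta> \<noteq> 0" using mesh_pos(1)[of n] beta_pos by linarith+
  ultimately show ?thesis by (simp add: field_simps)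
qed

lemma scheme_u_poly_factor_pos: "\<beta> / mesh n * (\<beta> * (real n + 1)\<^sup>2) ^ i > 0"
proof -
  have "real n + 1 > 0" by simp
  then show ?thesis using beta_pos by (intro mult_pos_pos divide_pos_pos zero_less_power) auto
qed

lemma grid_eig_roots:
  shows scheme_u_end_eq_0_iff: "scheme_u n t (Suc n) = 0 \<longleftrightarrow> (\<exists>i<n. t = grid_eig n i)"
    and grid_eig_less: "i < k \<Longrightarrow> k < n \<Longrightarrow> grid_eig n k < grid_eig n i"
proof -
  have "\<beta> \<noteq> 0" using beta_pos by simp
  then obtain y where y: "eigenvalues_decreasing (tridiagonal_matrix \<beta> n (grid_sample n)) = map y [0..<n]"
    "grid_poly n n = root_poly y n" "\<And>i k. i < k \<Longrightarrow> k < n \<Longrightarrow> y k < y i"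
    using eigenvalues_decreasing_tridiagonal_matrix by blast
  have e: "grid_eig n i = y i" if "i < n" for i using that by (simp add: grid_eig_def y(1))
  have "scheme_u n t (Suc n) = 0 \<longleftrightarrow> poly (root_poly y n) t = 0"
    using poly_grid_poly[of n n t] scheme_u_poly_factor_pos[of n n] unfolding y(2) by auto
  also have "\<dots> \<longleftrightarrow> (\<exists>i<n. t = grid_eig n i)"
    unfolding poly_root_poly_eq_0_iff using e by metis
  finally show "scheme_u n t (Suc n) = 0 \<longleftrightarrow> (\<exists>i<n. t = grid_eig n i)" .
  show "grid_eig n k < grid_eig n i" if "i < k" "k < n" using that y(3) e by simp
qed

text \<open>Rounding up makes the index positive for \<open>x > 0\<close>, so that it is the
  successor of the index of a polynomial.\<close>

lemma scheme_point_tendsto: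
  assumes x: "0 < x" "x \<le> 1"
  shows "(\<lambda>n. scheme_u n t (nat \<lceil>x * (real n + 1)\<rceil>)) \<longlonglongrightarrow> phi t x"
proof -
  define I where "I n = nat \<lceil>x * (real n + 1)\<rceil>" for n
  have rI: "x * (real n + 1) \<le> real (I n)" "real (I n) \<le> x * (real n + 1) + 1" for n
    using x by (auto simp: I_def le_nat_iff of_nat_nat ceiling_correct intro: less_imp_le)
  have In: "I n \<le> Suc n" for n
  proof -
    have "x * (real n + 1) \<le> 1 * (real n + 1)" using x by (intro mult_right_mono) auto
    also have "\<dots> = real (Suc n)" by simp
    finally have "\<lceil>x * (real n + 1)\<rceil> \<le> int (Suc n)" by (simp add: ceiling_le_iff)
    then show ?thesis by (simp only: I_def nat_le_iff)
  qed
  have m: "mesh n * (real n + 1) = 1" for n by (simp add: mesh_def)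
  have bd: "x \<le> real (I n) * mesh n \<and> real (I n) * mesh n \<le> x + mesh n" for n
  proof -
    have "x * (real n + 1) * mesh n \<le> real (I n) * mesh n" "real (I n) * mesh n \<le> (x * (real n + 1) + 1) * mesh n"
      using rI by (intro mult_right_mono; simp)+
    moreover have "x * (real n + 1) * mesh n = x * (mesh n * (real n + 1))"
      by (simp only: mult.assoc mult.commute[of "mesh n"])
    moreover have "(x * (real n + 1) + 1) * mesh n = x * (real n + 1) * mesh n + mesh n"
      by (simp only: distrib_right mult_1_left)
    ultimately show ?thesis unfolding m by simp
  qed
  have up: "(\<lambda>n. x + mesh n) \<longlonglongrightarrow> x" using tendsto_add[OF tendsto_const mesh_tendsto, of x] by simp
  have lim: "(\<lambda>n. real (I n) * mesh n) \<longlonglongrightarrow> x"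
    by (rule tendsto_sandwich[OF always_eventually always_eventually tendsto_const up]) (use bd in auto)
  have "(\<lambda>n. phi t (real (I n) * mesh n)) \<longlonglongrightarrow> phi t x"
    by (rule continuous_on_tendsto_compose[OF cont_phi lim]) (use x grid_in_unit[OF In] in auto)
  moreover have "(\<lambda>n. scheme_u n t (I n) - phi t (real (I n) * mesh n)) \<longlonglongrightarrow> 0"
  proof (rule tendstoI)
    fix \<eta> :: real assume "\<eta> > 0"
    then obtain \<epsilon> where e: "\<epsilon> > 0" and ev: "\<forall>\<^sub>F n in sequentially. \<forall>s. \<bar>s - t\<bar> < \<epsilon> \<longrightarrow> (\<forall>i\<le>Suc n.
      \<bar>scheme_u n s i - phi t (real i * mesh n)\<bar> + \<bar>scheme_w n s i - psi t (real i * mesh n)\<bar> < \<eta>)"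
      using scheme_tendsto by blast
    from ev show "\<forall>\<^sub>F n in sequentially. dist (scheme_u n t (I n) - phi t (real (I n) * mesh n)) 0 < \<eta>"
    proof eventually_elim
      case (elim n)
      then have "\<bar>scheme_u n t (I n) - phi t (real (I n) * mesh n)\<bar>
          + \<bar>scheme_w n t (I n) - psi t (real (I n) * mesh n)\<bar> < \<eta>"
        using e In[of n] by simp
      then show ?case by (simp add: dist_real_def)
    qed
  qed
  ultimately have "(\<lambda>n. (scheme_u n t (I n) - phi t (real (I n) * mesh n)) + phi t (real (I n) * mesh n))
      \<longlonglongrightarrow> 0 + phi t x" by (intro tendsto_add)
  then show ?thesis by (simp add: I_def)
qed

text \<open>Split \<open>[0, 1]\<close> into \<open>k + 1\<close> equal pieces. For one very
  negative \<open>T\<close> the function \<open>phi T\<close> takes a prescribed sign in each piece;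
  choosing the signs alternately and passing them to the scheme forces \<open>k\<close> sign
  changes, hence \<open>k\<close> roots above \<open>T\<close>.\<close>

lemma eventually_many_roots:
  "\<exists>T. \<forall>\<^sub>F n in sequentially. k \<le> nroots_above (tridiagonal_diag \<beta> n (grid_sample n)) (\<beta> * (real n + 1)\<^sup>2) n T"
proof -
  obtain K where K: "K > 0" "\<And>x. x \<in> {0..1} \<Longrightarrow> \<bar>b x\<bar> \<le> K"
    using continuous_on_unit_bounded[OF cont_b] by blast
  define \<delta> where "\<delta> = 1 / real (Suc k)"
  define T where "T = - ((8 * pi * \<beta> / \<delta>)\<^sup>2 / (2 * \<beta>) + K\<^sup>2 / \<beta>)"
  have "\<exists>x. real m * \<delta> < x \<and> x < real (Suc m) * \<delta> \<and> (-1) ^ m * phi T x > 0" if "m \<le> k" for m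
  proof (rule oscillation)
    show "real (Suc m) * \<delta> \<le> 1" using that by (simp add: \<delta>_def)
    have "real (Suc m) * \<delta> - real m * \<delta> = \<delta>" by (simp add: algebra_simps)
    then show "T \<le> - ((8 * pi * \<beta> / (real (Suc m) * \<delta> - real m * \<delta>))\<^sup>2 / (2 * \<beta>) + K\<^sup>2 / \<beta>)"
      by (simp add: T_def)
    show "(-1) ^ m = (1::real) \<or> (-1) ^ m = (-1::real)" by (cases "even m") auto
  qed (use K in \<open>auto simp: \<delta>_def divide_strict_right_mono\<close>)
  then obtain x where x: "\<And>m. m \<le> k \<Longrightarrow> real m * \<delta> < x m \<and> x m < real (Suc m) * \<delta> \<and> (-1) ^ m * phi T (x m) > 0"
    by metis
  have d: "\<delta> > 0" by (simp add: \<delta>_def)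
  have x01: "0 < x m" "x m \<le> 1" if "m \<le> k" for m
  proof -
    have "0 \<le> real m * \<delta>" "real (Suc m) * \<delta> \<le> 1" using that d by (auto simp: \<delta>_def)
    then show "0 < x m" "x m \<le> 1" using x[OF that] by linarith+
  qed
  define I where "I m n = nat \<lceil>x m * (real n + 1)\<rceil>" for m n
  have "\<forall>\<^sub>F n in sequentially. (-1) ^ m * scheme_u n T (I m n) > 0" if "m \<le> k" for m
  proof (rule order_tendstoD(1))
    show "(\<lambda>n. (-1) ^ m * scheme_u n T (I m n)) \<longlonglongrightarrow> (-1) ^ m * phi T (x m)"
      unfolding I_def using x01[OF that] by (intro tendsto_mult tendsto_const scheme_point_tendsto)
  qed (use x[OF that] in blast)
  then have "\<forall>\<^sub>F n in sequentially. \<forall>m\<in>{..k}. (-1) ^ m * scheme_u n T (I m n) > 0"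
    by (intro eventually_ball_finite) auto
  then have "\<forall>\<^sub>F n in sequentially. k \<le> nroots_above (tridiagonal_diag \<beta> n (grid_sample n)) (\<beta> * (real n + 1)\<^sup>2) n T"
  proof eventually_elim
    case (elim n)
    define c where "c = \<beta> * (real n + 1)\<^sup>2"
    have c: "c \<noteq> 0" using beta_pos by (simp add: c_def)
    have I1: "I m n > 0" if "m \<le> k" for m
      using x01(1)[OF that] by (simp add: I_def)
    have In: "I k n - 1 \<le> n"
    proof -
      have "x k * (real n + 1) \<le> 1 * (real n + 1)" using x01[of k] by (intro mult_right_mono) auto
      also have "\<dots> = real (Suc n)" by simp
      finally have "\<lceil>x k * (real n + 1)\<rceil> \<le> int (Suc n)" by (simp add: ceiling_le_iff)
      then show ?thesis by (simp add: I_def)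
    qed
    have "k \<le> nroots_above (tridiagonal_diag \<beta> n (grid_sample n)) c (I k n - 1) T"
    proof (rule nroots_above_alternation[OF c])
      fix m assume "m < k"
      then have "x m \<le> x (Suc m)" using x[of m] x[of "Suc m"] by auto
      then have "I m n \<le> I (Suc m) n" unfolding I_def by (intro nat_mono ceiling_mono mult_right_mono) auto
      then show "I m n - 1 \<le> I (Suc m) n - 1" by simp
    next
      fix m assume m: "m \<le> k"
      \<comment> \<open>Step \<open>i\<close> of the scheme carries the polynomial of index
        \<open>i - 1\<close>.\<close>
      have "(-1) ^ m * poly (grid_poly n (I m n - 1)) T
          = (\<beta> / mesh n * (\<beta> * (real n + 1)\<^sup>2) ^ (I m n - 1)) * ((-1) ^ m * scheme_u n T (I m n))"
        unfolding poly_grid_poly using I1[OF m] by simp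
      also have "\<dots> > 0" by (rule mult_pos_pos[OF scheme_u_poly_factor_pos]) (use elim m in auto)
      finally show "(-1) ^ m * poly (jacobi_poly (tridiagonal_diag \<beta> n (grid_sample n)) c (I m n - 1)) T > 0"
        by (simp add: c_def)
    qed
    also have "\<dots> \<le> nroots_above (tridiagonal_diag \<beta> n (grid_sample n)) c n T"
      by (rule nroots_above_mono[OF c In])
    finally show ?case by (simp add: c_def)
  qed
  then show ?thesis by blast
qed

lemma simple_zeros_shooting:
  "\<exists>C. simple_zeros (\<lambda>n t. scheme_u n t (Suc n)) (\<lambda>t. phi t 1) grid_eig C"
proof -
  obtain K where K: "K > 0" "\<And>x. x \<in> {0..1} \<Longrightarrow> \<bar>b x\<bar> \<le> K"
    using continuous_on_unit_bounded[OF cont_b] by blast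
  have "simple_zeros (\<lambda>n t. scheme_u n t (Suc n)) (\<lambda>t. phi t 1) grid_eig (4 * K\<^sup>2 / \<beta>)"
  proof
    fix n :: nat and t :: real
    show "scheme_u n t (Suc n) = 0 \<longleftrightarrow> (\<exists>i<n. t = grid_eig n i)" by (rule scheme_u_end_eq_0_iff)
  next
    fix n i k :: nat assume "i < k" "k < n"
    then show "grid_eig n k < grid_eig n i" by (rule grid_eig_less)
  next
    fix n
    define c where "c = \<beta> / mesh n * (\<beta> * (real n + 1)\<^sup>2) ^ n"
    have c: "c > 0" unfolding c_def by (rule scheme_u_poly_factor_pos)
    have "scheme_u n t (Suc n) = poly (grid_poly n n) t / c" for t
      using poly_grid_poly[of n n t] c unfolding c_def[symmetric] by simp
    then show "continuous_on UNIV (\<lambda>t. scheme_u n t (Suc n))"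
      using c by (simp only:) (intro continuous_intros, simp)
  next
    fix t \<eta> :: real assume "\<eta> > 0"
    then obtain \<epsilon> where e: "\<epsilon> > 0" and ev: "\<forall>\<^sub>F n in sequentially. \<forall>s. \<bar>s - t\<bar> < \<epsilon> \<longrightarrow> (\<forall>i\<le>Suc n.
      \<bar>scheme_u n s i - phi t (real i * mesh n)\<bar> + \<bar>scheme_w n s i - psi t (real i * mesh n)\<bar> < \<eta>)"
      using scheme_tendsto[of \<eta> t] by blast
    from ev have "\<forall>\<^sub>F n in sequentially. \<forall>s. \<bar>s - t\<bar> < \<epsilon> \<longrightarrow> \<bar>scheme_u n s (Suc n) - phi t 1\<bar> < \<eta>"
    proof eventually_elim
      case (elim n)
      show ?case
      proof (intro allI impI)
        fix s assume "\<bar>s - t\<bar> < \<epsilon>"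
        then have "\<bar>scheme_u n s (Suc n) - phi t (real (Suc n) * mesh n)\<bar>
            + \<bar>scheme_w n s (Suc n) - psi t (real (Suc n) * mesh n)\<bar> < \<eta>"
          using elim by blast
        then show "\<bar>scheme_u n s (Suc n) - phi t 1\<bar> < \<eta>" unfolding grid_end by linarith
      qed
    qed
    with e show "\<exists>\<epsilon>>0. \<forall>\<^sub>F n in sequentially. \<forall>s. \<bar>s - t\<bar> < \<epsilon> \<longrightarrow> \<bar>scheme_u n s (Suc n) - phi t 1\<bar> < \<eta>"
      by blast
  next
    have "\<forall>\<^sub>F n in sequentially. mesh n < \<beta> / (2 * K)"
      using mesh_tendsto by (rule order_tendstoD) (use K beta_pos in simp)
    then show "\<forall>\<^sub>F n in sequentially. \<forall>i<n. grid_eig n i \<le> 4 * K\<^sup>2 / \<beta>"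
    proof eventually_elim
      case (elim n)
      show ?case
      proof (intro allI impI, rule ccontr)
        fix i assume i: "i < n" "\<not> grid_eig n i \<le> 4 * K\<^sup>2 / \<beta>"
        have "2 * K * mesh n \<le> \<beta>" using elim K(1) by (simp add: field_simps)
        then have "scheme_u n (grid_eig n i) (Suc n) > 0"
          using i by (intro scheme_u_end_pos[OF K]) auto
        moreover have "scheme_u n (grid_eig n i) (Suc n) = 0" using i scheme_u_end_eq_0_iff by blast
        ultimately show False by simp
      qed
    qed
  next
    fix k
    obtain T where "\<forall>\<^sub>F n in sequentially.
        Suc k \<le> nroots_above (tridiagonal_diag \<beta> n (grid_sample n)) (\<beta> * (real n + 1)\<^sup>2) n T"
      using eventually_many_roots by blast
    with eventually_gt_at_top[of k] have "\<forall>\<^sub>F n in sequentially. T \<le> grid_eig n k"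
    proof eventually_elim
      case (elim n)
      have "T < grid_eig n k" unfolding grid_eig_def
        using elim beta_pos by (subst less_eigenvalue_iff) auto
      then show ?case by simp
    qed
    then show "\<exists>T. \<forall>\<^sub>F n in sequentially. T \<le> grid_eig n k" by blast
  next
    fix t0 :: real
    obtain \<delta> \<epsilon> where de: "\<delta> > 0" "\<epsilon> > 0" and ev: "\<forall>\<^sub>F n in sequentially. \<forall>s t. \<bar>s - t0\<bar> < \<epsilon> \<longrightarrow> \<bar>t - t0\<bar> < \<epsilon> \<longrightarrow>
     \<delta> \<le> (\<Sum>j=1..Suc n. mesh n * (scheme_u n s j * scheme_u n t j))"
      using scheme_energy_lower_bound by blast
    from ev have "\<forall>\<^sub>F n in sequentially. \<forall>s t. \<bar>s - t0\<bar> < \<epsilon> \<longrightarrow> \<bar>t - t0\<bar> < \<epsilon> \<longrightarrow>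
        scheme_u n s (Suc n) = 0 \<longrightarrow> scheme_u n t (Suc n) = 0 \<longrightarrow> s = t"
    proof eventually_elim
      case (elim n)
      show ?case
      proof (intro allI impI)
        fix s t assume st: "\<bar>s - t0\<bar> < \<epsilon>" "\<bar>t - t0\<bar> < \<epsilon>"
          "scheme_u n s (Suc n) = 0" "scheme_u n t (Suc n) = 0"
        then have "(t - s) * (\<Sum>j=1..Suc n. mesh n * (scheme_u n s j * scheme_u n t j)) = 0"
          using scheme_christoffel_darboux[of n s "Suc n" t] by simp
        moreover have "(\<Sum>j=1..Suc n. mesh n * (scheme_u n s j * scheme_u n t j)) > 0"
          using elim st de by (meson less_le_trans)
        ultimately show "s = t" by simp
      qed
    qed
    then show "\<exists>\<epsilon>>0. \<forall>\<^sub>F n in sequentially. \<forall>s t. \<bar>s - t0\<bar> < \<epsilon> \<longrightarrow> \<bar>t - t0\<bar> < \<epsilon> \<longrightarrow>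
        scheme_u n s (Suc n) = 0 \<longrightarrow> scheme_u n t (Suc n) = 0 \<longrightarrow> s = t"
      using de by blast
    fix \<epsilon>' :: real assume f0: "phi t0 1 = 0" and e': "\<epsilon>' > 0"
    define r where "r = min \<epsilon> \<epsilon>' / 2"
    have r: "r > 0" "r < \<epsilon>" "r < \<epsilon>'" using de e' by (auto simp: r_def)
    have u: "(\<lambda>n. scheme_u n t (Suc n)) \<longlonglongrightarrow> phi t 1"
      and w: "(\<lambda>n. scheme_w n t (Suc n)) \<longlonglongrightarrow> psi t 1" for t
    proof -
      have "(\<lambda>n. \<bar>scheme_u n t (Suc n) - phi t 1\<bar> + \<bar>scheme_w n t (Suc n) - psi t 1\<bar>) \<longlonglongrightarrow> 0"
      proof (rule tendstoI)
        fix \<eta> :: real assume "\<eta> > 0"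
        then obtain e where e: "e > 0" and ev: "\<forall>\<^sub>F n in sequentially. \<forall>s. \<bar>s - t\<bar> < e \<longrightarrow> (\<forall>i\<le>Suc n.
          \<bar>scheme_u n s i - phi t (real i * mesh n)\<bar> + \<bar>scheme_w n s i - psi t (real i * mesh n)\<bar> < \<eta>)"
          using scheme_tendsto by blast
        from ev show "\<forall>\<^sub>F n in sequentially.
            dist (\<bar>scheme_u n t (Suc n) - phi t 1\<bar> + \<bar>scheme_w n t (Suc n) - psi t 1\<bar>) 0 < \<eta>"
        proof eventually_elim
          case (elim n)
          then have "\<bar>scheme_u n t (Suc n) - phi t (real (Suc n) * mesh n)\<bar>
            + \<bar>scheme_w n t (Suc n) - psi t (real (Suc n) * mesh n)\<bar> < \<eta>"
            using e by (metis abs_zero diff_self order_refl)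
          then show ?case unfolding grid_end by (simp add: dist_real_def)
        qed
      qed
      then have "(\<lambda>n. scheme_u n t (Suc n) - phi t 1) \<longlonglongrightarrow> 0" "(\<lambda>n. scheme_w n t (Suc n) - psi t 1) \<longlonglongrightarrow> 0"
        by (auto intro: Lim_null_comparison[rotated])
      then show "(\<lambda>n. scheme_u n t (Suc n)) \<longlonglongrightarrow> phi t 1" "(\<lambda>n. scheme_w n t (Suc n)) \<longlonglongrightarrow> psi t 1"
        by (auto intro: LIM_zero_cancel)
    qed
    \<comment> \<open>In the Christoffel-Darboux identity with one parameter equal to
      \<open>t0\<close>, the term with \<open>phi t0 1\<close> disappears in the limit. The factor
      \<open>t - s\<close> has opposite signs for \<open>s = t0 - r\<close> and
      \<open>s = t0 + r\<close>, and the sum stays above \<open>\<delta>\<close>; so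
      \<open>phi\<close> at \<open>1\<close> changes sign at \<open>t0\<close>.\<close>
    have lim: "(\<lambda>n. scheme_u n t (Suc n) * scheme_w n t0 (Suc n) - scheme_u n t0 (Suc n) * scheme_w n t (Suc n))
        \<longlonglongrightarrow> phi t 1 * psi t0 1" for t
      using tendsto_diff[OF tendsto_mult[OF u[of t] w[of t0]] tendsto_mult[OF u[of t0] w[of t]]] f0 by simp
    have "phi (t0 - r) 1 * psi t0 1 \<ge> r * \<delta>"
    proof (rule tendsto_lowerbound[OF lim])
      from ev show "\<forall>\<^sub>F n in sequentially. r * \<delta> \<le> scheme_u n (t0 - r) (Suc n) * scheme_w n t0 (Suc n)
          - scheme_u n t0 (Suc n) * scheme_w n (t0 - r) (Suc n)"
      proof eventually_elim
        case (elim n)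
        then have "\<delta> \<le> (\<Sum>j=1..Suc n. mesh n * (scheme_u n (t0 - r) j * scheme_u n t0 j))" using r by simp
        then show ?case unfolding scheme_christoffel_darboux using r by simp
      qed
    qed simp
    moreover have "phi (t0 + r) 1 * psi t0 1 \<le> - (r * \<delta>)"
    proof (rule tendsto_upperbound[OF lim])
      from ev show "\<forall>\<^sub>F n in sequentially. scheme_u n (t0 + r) (Suc n) * scheme_w n t0 (Suc n)
          - scheme_u n t0 (Suc n) * scheme_w n (t0 + r) (Suc n) \<le> - (r * \<delta>)"
      proof eventually_elim
        case (elim n)
        then have "\<delta> \<le> (\<Sum>j=1..Suc n. mesh n * (scheme_u n (t0 + r) j * scheme_u n t0 j))" using r by simp
        then show ?case unfolding scheme_christoffel_darboux using r by simp
      qed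
    qed simp
    moreover have "r * \<delta> > 0" using r de by simp
    ultimately have "phi (t0 - r) 1 * psi t0 1 > 0" "phi (t0 + r) 1 * psi t0 1 < 0" by linarith+
    then have "phi (t0 - r) 1 * phi (t0 + r) 1 < 0" by (auto simp: mult_less_0_iff zero_less_mult_iff)
    then show "\<exists>a b. t0 - \<epsilon>' < a \<and> a < t0 \<and> t0 < b \<and> b < t0 + \<epsilon>' \<and> phi a 1 * phi b 1 < 0"
      using r by (intro exI[of _ "t0 - r"] exI[of _ "t0 + r"]) auto
  qed
  then show ?thesis by blast
qed

lemma grid_eig_limit:
  obtains l where "\<And>i k. i < k \<Longrightarrow> l k < l i" "range l = {t. phi t 1 = 0}"
    "\<And>k. (\<lambda>n. grid_eig n k) \<longlonglongrightarrow> l k"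
proof -
  obtain C where "simple_zeros (\<lambda>n t. scheme_u n t (Suc n)) (\<lambda>t. phi t 1) grid_eig C"
    using simple_zeros_shooting by blast
  then show ?thesis using simple_zeros.zeros_limit that by blast
qed

end

section \<open>Absolutely continuous functions\<close>

text \<open>In the Henstock-Kurzweil integral the exceptional set is handled by the gauge: tagged
  intervals with tag in \<open>N\<close> lie in an open set of measure below
  \<open>\<delta>\<close>, so absolute continuity bounds their total increment. Elsewhere the
  derivative controls the increment.\<close>

lemma absolutely_continuous_fun_on_FTC:
  fixes F f :: "real \<Rightarrow> real"
  assumes ab: "a \<le> b" and ac: "absolutely_continuous_fun_on a b F" and N: "negligible N"
    and F': "\<And>x. x \<in> {a..b} - N \<Longrightarrow> (F has_real_derivative f x) (at x within {a..b})"
  shows "(f has_integral (F b - F a)) {a..b}"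
proof -
  define g where "g x = (if x \<in> N then 0 else f x)" for x
  have "(g has_integral (F b - F a)) (cbox a b)"
    unfolding has_integral
  proof (intro allI impI)
    fix e :: real assume e: "e > 0"
    \<comment> \<open>The tags outside \<open>N\<close> contribute at most
      \<open>e1 * (b - a) \<le> e / 2\<close>; the added 1 keeps the denominator positive when
      \<open>a = b\<close>.\<close>
    define e1 where "e1 = e / (2 * (b - a + 1))"
    have e1: "e1 > 0" using e ab by (simp add: e1_def)
    obtain \<delta> where d: "\<delta> > 0" and ac': "\<And>(m::nat) s t.
        (\<forall>i<m. a \<le> s i \<and> s i \<le> t i \<and> t i \<le> b) \<Longrightarrow>
        (\<forall>i<m. \<forall>j<m. i \<noteq> j \<longrightarrow> {s i<..<t i} \<inter> {s j<..<t j} = {}) \<Longrightarrow>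
        (\<Sum>i<m. t i - s i) < \<delta> \<Longrightarrow> (\<Sum>i<m. \<bar>F (t i) - F (s i)\<bar>) < e / 2"
      using ac[unfolded absolutely_continuous_fun_on_def, rule_format, OF half_gt_zero[OF e]] by blast
    obtain U where U: "open U" "N \<subseteq> U" "U \<in> lmeasurable" "measure lebesgue U < \<delta>"
    proof -
      have NL: "N \<in> lmeasurable" "measure lebesgue N = 0"
        using negligible_imp_measurable[OF N] negligible_imp_measure0[OF N] by auto
      then obtain U where U: "open U" "N \<subseteq> U" "U - N \<in> lmeasurable" "emeasure lebesgue (U - N) < ennreal \<delta>"
        using sets_lebesgue_outer_open[of N \<delta>] d by (auto dest: fmeasurableD)
      have "measure lebesgue (U - N) < \<delta>"
        using U(4) d by (simp add: emeasure_eq_measure2[OF U(3)] ennreal_less_iff)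
      moreover have UN: "U = (U - N) \<union> N" using U(2) by auto
      moreover have "measure lebesgue ((U - N) \<union> N) \<le> measure lebesgue (U - N) + measure lebesgue N"
        using U(3) NL(1) by (intro measure_Un_le) (auto dest: fmeasurableD)
      moreover have "U \<in> lmeasurable" using fmeasurable.Un[OF U(3) NL(1)] UN by simp
      ultimately show ?thesis using that[of U] U(1,2) NL(2) by simp
    qed
    have "\<exists>r>0. \<forall>y\<in>{a..b}. \<bar>y - x\<bar> < r \<longrightarrow> \<bar>F y - F x - f x * (y - x)\<bar> \<le> e1 * \<bar>y - x\<bar>"
      if "x \<in> {a..b} - N" for x
      using F'[OF that] e1 unfolding has_field_derivative_def has_derivative_within_alt real_norm_def
      by blast
    then obtain r where r: "\<And>x. x \<in> {a..b} - N \<Longrightarrow> r x > 0"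
      "\<And>x y. x \<in> {a..b} - N \<Longrightarrow> y \<in> {a..b} \<Longrightarrow> \<bar>y - x\<bar> < r x \<Longrightarrow>
        \<bar>F y - F x - f x * (y - x)\<bar> \<le> e1 * \<bar>y - x\<bar>"
      by metis
    \<comment> \<open>Outside \<open>[a, b]\<close> the radius 1 merely completes the gauge on the
      line.\<close>
    define \<gamma> where "\<gamma> x = (if x \<in> N then U else if x \<in> {a..b} then ball x (r x) else ball x 1)" for x
    have "gauge \<gamma>" using U r(1) by (auto simp: gauge_def \<gamma>_def)
    moreover have "norm ((\<Sum>(x, k)\<in>D. measure lborel k *\<^sub>R g x) - (F b - F a)) < e"
      if D: "D tagged_division_of cbox a b" and fine: "\<gamma> fine D" for D
    proof -
      have finD: "finite D" using D by blast
      have k: "Inf k \<le> x \<and> x \<le> Sup k \<and> a \<le> Inf k \<and> Sup k \<le> b \<and> k = {Inf k..Sup k}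
          \<and> measure lborel k = Sup k - Inf k" if xk: "(x, k) \<in> D" for x k
      proof -
        obtain u v where uv: "k = cbox u v" using tagged_division_ofD(4)[OF D xk] by blast
        have xin: "x \<in> k" using tagged_division_ofD(2)[OF D xk] .
        then have le: "u \<le> v" using uv by auto
        have "k \<subseteq> {a..b}" using tagged_division_ofD(3)[OF D xk] by simp
        moreover have "u \<in> k" "v \<in> k" using uv le by auto
        ultimately have "a \<le> u" "v \<le> b" by auto
        then show ?thesis using uv xin le by simp
      qed
      define T where "T = (\<lambda>(x, k). measure lborel k *\<^sub>R g x - (F (Sup k) - F (Inf k)))"
      have "(\<Sum>(x, k)\<in>D. measure lborel k *\<^sub>R g x) - (F b - F a) = sum T D"
        using additive_tagged_division_1[OF ab, of D F] D
        by (simp add: T_def case_prod_beta sum_subtractf)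
      also have "\<dots> = sum T {p \<in> D. fst p \<notin> N} + sum T {p \<in> D. fst p \<in> N}"
      proof -
        have "D = {p \<in> D. fst p \<notin> N} \<union> {p \<in> D. fst p \<in> N}" by auto
        then show ?thesis using finD by (subst sum.union_disjoint[symmetric]) auto
      qed
      also have "\<bar>\<dots>\<bar> \<le> \<bar>sum T {p \<in> D. fst p \<notin> N}\<bar> + \<bar>sum T {p \<in> D. fst p \<in> N}\<bar>" by (rule abs_triangle_ineq)
      also have "\<bar>sum T {p \<in> D. fst p \<notin> N}\<bar> \<le> e / 2"
      proof -
        have "\<bar>T p\<bar> \<le> e1 * measure lborel (snd p)" if "p \<in> D" "fst p \<notin> N" for p
        proof -
          obtain x K where p: "p = (x, K)" by (cases p)
          have xK: "(x, K) \<in> D" "x \<notin> N" using that p by auto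
          note kk = k[OF xK(1)]
          have x: "x \<in> {a..b} - N" using kk xK(2) by auto
          have "K \<subseteq> ball x (r x)" using fine xK x unfolding fine_def \<gamma>_def by fastforce
          then have "Inf K \<in> ball x (r x)" "Sup K \<in> ball x (r x)"
            using kk by (metis atLeastAtMost_iff order_refl order_trans subsetD)+
          then have b: "\<bar>Inf K - x\<bar> < r x" "\<bar>Sup K - x\<bar> < r x" by (auto simp: dist_real_def)
          have "\<bar>F (Inf K) - F x - f x * (Inf K - x)\<bar> \<le> e1 * \<bar>Inf K - x\<bar>"
            "\<bar>F (Sup K) - F x - f x * (Sup K - x)\<bar> \<le> e1 * \<bar>Sup K - x\<bar>"
            using r(2)[OF x _ b(1)] r(2)[OF x _ b(2)] kk by auto
          moreover have "\<bar>Inf K - x\<bar> = x - Inf K" "\<bar>Sup K - x\<bar> = Sup K - x" using kk by auto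
          ultimately have *: "\<bar>F (Inf K) - F x - f x * (Inf K - x)\<bar> \<le> e1 * (x - Inf K)"
            "\<bar>F (Sup K) - F x - f x * (Sup K - x)\<bar> \<le> e1 * (Sup K - x)" by simp_all
          have c: "measure lborel K = Sup K - Inf K" using kk by blast
          have Tp: "T p = (F (Inf K) - F x - f x * (Inf K - x)) - (F (Sup K) - F x - f x * (Sup K - x))"
            by (simp add: T_def p g_def c xK(2) algebra_simps)
          have "\<bar>T p\<bar> \<le> \<bar>F (Inf K) - F x - f x * (Inf K - x)\<bar> + \<bar>F (Sup K) - F x - f x * (Sup K - x)\<bar>"
            unfolding Tp by (rule abs_triangle_ineq4)
          also have "\<dots> \<le> e1 * (x - Inf K) + e1 * (Sup K - x)" using * by (intro add_mono) simp_all
          also have "\<dots> = e1 * measure lborel K" by (simp add: c algebra_simps)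
          finally show ?thesis by (simp add: p)
        qed
        then have "\<bar>sum T {p \<in> D. fst p \<notin> N}\<bar> \<le> (\<Sum>p\<in>{p \<in> D. fst p \<notin> N}. e1 * measure lborel (snd p))"
          by (intro order_trans[OF sum_abs] sum_mono) auto
        also have "\<dots> \<le> (\<Sum>p\<in>D. e1 * measure lborel (snd p))"
          using finD e1 by (intro sum_mono2) auto
        also have "\<dots> = e1 * measure lborel (cbox a b)"
          using additive_content_tagged_division[OF D] by (simp add: sum_distrib_left[symmetric] case_prod_beta)
        also have "\<dots> = e / 2 * ((b - a) / (b - a + 1))" using ab by (simp add: e1_def)
        also have "\<dots> \<le> e / 2 * 1" using e ab by (intro mult_left_mono) auto
        finally show ?thesis by simp
      qed
      also have "\<bar>sum T {p \<in> D. fst p \<in> N}\<bar> < e / 2"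
      proof -
        define D2 where "D2 = {p \<in> D. fst p \<in> N}"
        have "finite D2" using finD by (simp add: D2_def)
        then obtain h where h: "bij_betw h {..<card D2} D2"
          using ex_bij_betw_nat_finite[of D2] by (auto simp: atLeast0LessThan)
        define s t where "s i = Inf (snd (h i))" and "t i = Sup (snd (h i))" for i
        have hD: "h i \<in> D \<and> fst (h i) \<in> N" if "i < card D2" for i
          using h that by (auto simp: bij_betw_def D2_def)
        have hk: "a \<le> s i \<and> s i \<le> t i \<and> t i \<le> b \<and> snd (h i) = {s i..t i}" if "i < card D2" for i
          using k[of "fst (h i)" "snd (h i)"] hD[OF that] by (auto simp: s_def t_def)
        have disj: "{s i<..<t i} \<inter> {s j<..<t j} = {}" if "i < card D2" "j < card D2" "i \<noteq> j" for i j
        proof -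
          have "h i \<noteq> h j" using h that by (auto simp: bij_betw_def inj_on_def)
          then have "interior (snd (h i)) \<inter> interior (snd (h j)) = {}"
            using tagged_division_ofD(5)[OF D, of "fst (h i)" "snd (h i)" "fst (h j)" "snd (h j)"] hD that by simp
          then show ?thesis using hk[OF that(1)] hk[OF that(2)] by (simp add: interior_atLeastAtMost_real)
        qed
        have "(\<Sum>i<card D2. t i - s i) = (\<Sum>i<card D2. measure lebesgue {s i<..<t i})"
          using hk by (intro sum.cong) auto
        also have "\<dots> = measure lebesgue (\<Union>i<card D2. {s i<..<t i})"
          by (rule measure_UNION'[symmetric]) (use disj in \<open>auto simp: pairwise_def disjnt_def\<close>)
        also have "\<dots> \<le> measure lebesgue U"
        proof (rule measure_mono_fmeasurable[OF _ _ U(3)])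
          show "(\<Union>i<card D2. {s i<..<t i}) \<subseteq> U"
          proof
            fix w assume "w \<in> (\<Union>i<card D2. {s i<..<t i})"
            then obtain i where i: "i < card D2" "w \<in> {s i<..<t i}" by auto
            then have "w \<in> snd (h i)" using hk[OF i(1)] by auto
            moreover have "snd (h i) \<subseteq> U"
              using fineD[OF fine, of "fst (h i)" "snd (h i)"] hD[OF i(1)] by (simp add: \<gamma>_def)
            ultimately show "w \<in> U" by blast
          qed
        qed auto
        finally have "(\<Sum>i<card D2. t i - s i) < \<delta>" using U(4) by simp
        then have lt: "(\<Sum>i<card D2. \<bar>F (t i) - F (s i)\<bar>) < e / 2"
          using hk disj by (intro ac') blast+
        have "\<bar>sum T D2\<bar> \<le> (\<Sum>p\<in>D2. \<bar>T p\<bar>)" by (rule sum_abs)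
        also have "\<dots> = (\<Sum>i<card D2. \<bar>T (h i)\<bar>)" by (rule sum.reindex_bij_betw[OF h, symmetric])
        also have "\<dots> = (\<Sum>i<card D2. \<bar>F (t i) - F (s i)\<bar>)"
        proof (rule sum.cong[OF refl])
          fix i assume "i \<in> {..<card D2}"
          then have "fst (h i) \<in> N" using hD by blast
          then show "\<bar>T (h i)\<bar> = \<bar>F (t i) - F (s i)\<bar>"
            by (simp add: T_def g_def case_prod_beta s_def t_def abs_minus_commute)
        qed
        finally show ?thesis using lt by (simp add: D2_def)
      qed
      finally show ?thesis by simp
    qed
    ultimately have "gauge \<gamma> \<and> (\<forall>D. D tagged_division_of cbox a b \<and> \<gamma> fine D \<longrightarrow>
        norm ((\<Sum>(x, k)\<in>D. measure lborel k *\<^sub>R g x) - (F b - F a)) < e)" by simp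
    then show "\<exists>\<gamma>. gauge \<gamma> \<and> (\<forall>D. D tagged_division_of cbox a b \<and> \<gamma> fine D \<longrightarrow>
        norm ((\<Sum>(x, k)\<in>D. measure lborel k *\<^sub>R g x) - (F b - F a)) < e)" by (rule exI[where x = \<gamma>])
  qed
  then have "(g has_integral (F b - F a)) {a..b}" by simp
  then show ?thesis by (rule has_integral_spike[OF N, rotated]) (simp add: g_def)
qed

lemma absolutely_continuous_fun_on_imp_continuous:
  assumes "absolutely_continuous_fun_on a b f"
  shows "continuous_on {a..b} f"
  unfolding continuous_on_iff
proof (intro ballI allI impI)
  fix x e :: real assume x: "x \<in> {a..b}" and "e > 0"
  then obtain \<delta> where d: "\<delta> > 0" and ac: "\<And>(m::nat) s t.
        (\<forall>i<m. a \<le> s i \<and> s i \<le> t i \<and> t i \<le> b) \<Longrightarrow>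
        (\<forall>i<m. \<forall>j<m. i \<noteq> j \<longrightarrow> {s i<..<t i} \<inter> {s j<..<t j} = {}) \<Longrightarrow>
        (\<Sum>i<m. t i - s i) < \<delta> \<Longrightarrow> (\<Sum>i<m. \<bar>f (t i) - f (s i)\<bar>) < e"
    using assms[unfolded absolutely_continuous_fun_on_def, rule_format, OF \<open>e > 0\<close>] by blast
  have "dist (f y) (f x) < e" if "y \<in> {a..b}" "dist y x < \<delta>" for y
    using ac[of 1 "\<lambda>_. min x y" "\<lambda>_. max x y"] x that
    by (cases "x \<le> y") (auto simp: dist_real_def abs_minus_commute)
  then show "\<exists>d>0. \<forall>x'\<in>{a..b}. dist x' x < d \<longrightarrow> dist (f x') (f x) < e" using d by blast
qed

text \<open>Serves twice: with a continuously differentiable factor for integration by parts, and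
  with \<open>u = 1\<close> to see that Lipschitz functions are absolutely continuous.\<close>

lemma absolutely_continuous_fun_on_lipschitz_mult:
  fixes g u :: "real \<Rightarrow> real"
  assumes u: "absolutely_continuous_fun_on a b u" and L: "\<And>x y. x \<in> {a..b} \<Longrightarrow> y \<in> {a..b} \<Longrightarrow> \<bar>g x - g y\<bar> \<le> L * \<bar>x - y\<bar>"
    and B: "\<And>x. x \<in> {a..b} \<Longrightarrow> \<bar>g x\<bar> \<le> B" "\<And>x. x \<in> {a..b} \<Longrightarrow> \<bar>u x\<bar> \<le> B" and pos: "L > 0" "B > 0"
  shows "absolutely_continuous_fun_on a b (\<lambda>x. g x * u x)"
  unfolding absolutely_continuous_fun_on_def
proof (intro allI impI)
  fix e :: real assume e: "e > 0"
  have eB: "e / (2 * B) > 0" using pos e by simp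
  obtain \<delta> where d: "\<delta> > 0" and ac: "\<And>(m::nat) s t.
        (\<forall>i<m. a \<le> s i \<and> s i \<le> t i \<and> t i \<le> b) \<Longrightarrow>
        (\<forall>i<m. \<forall>j<m. i \<noteq> j \<longrightarrow> {s i<..<t i} \<inter> {s j<..<t j} = {}) \<Longrightarrow>
        (\<Sum>i<m. t i - s i) < \<delta> \<Longrightarrow> (\<Sum>i<m. \<bar>u (t i) - u (s i)\<bar>) < e / (2 * B)"
    using u[unfolded absolutely_continuous_fun_on_def, rule_format, OF eB] by blast
  define \<delta>' where "\<delta>' = min \<delta> (e / (2 * B * L))"
  have "(\<Sum>i<m. \<bar>g (t i) * u (t i) - g (s i) * u (s i)\<bar>) < e"
    if st: "\<forall>i<m. a \<le> s i \<and> s i \<le> t i \<and> t i \<le> b"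
      "\<forall>i<m. \<forall>j<m. i \<noteq> j \<longrightarrow> {s i<..<t i} \<inter> {s j<..<t j} = {}" "(\<Sum>i<m. t i - s i) < \<delta>'" for m :: nat and s t
  proof -
    have "(\<Sum>i<m. \<bar>g (t i) * u (t i) - g (s i) * u (s i)\<bar>)
        \<le> (\<Sum>i<m. B * \<bar>u (t i) - u (s i)\<bar> + B * L * (t i - s i))"
    proof (rule sum_mono)
      fix i assume "i \<in> {..<m}"
      then have i: "s i \<in> {a..b}" "t i \<in> {a..b}" "s i \<le> t i" using st(1) by force+
      have "\<bar>g (t i) * u (t i) - g (s i) * u (s i)\<bar> = \<bar>g (t i) * (u (t i) - u (s i)) + u (s i) * (g (t i) - g (s i))\<bar>"
        by (simp add: algebra_simps)
      also have "\<dots> \<le> \<bar>g (t i)\<bar> * \<bar>u (t i) - u (s i)\<bar> + \<bar>u (s i)\<bar> * \<bar>g (t i) - g (s i)\<bar>"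
        unfolding abs_mult[symmetric] by (rule abs_triangle_ineq)
      also have "\<dots> \<le> B * \<bar>u (t i) - u (s i)\<bar> + B * (L * \<bar>t i - s i\<bar>)"
        using B i L[OF i(2,1)] pos by (intro add_mono mult_mono) auto
      finally show "\<bar>g (t i) * u (t i) - g (s i) * u (s i)\<bar> \<le> B * \<bar>u (t i) - u (s i)\<bar> + B * L * (t i - s i)"
        using i by simp
    qed
    also have "\<dots> = B * (\<Sum>i<m. \<bar>u (t i) - u (s i)\<bar>) + B * L * (\<Sum>i<m. t i - s i)"
      by (simp only: sum.distrib sum_distrib_left)
    also have "\<dots> < B * (e / (2 * B)) + B * L * (e / (2 * B * L))"
    proof (intro add_strict_mono mult_strict_left_mono)
      show "(\<Sum>i<m. \<bar>u (t i) - u (s i)\<bar>) < e / (2 * B)" using st by (intro ac) (auto simp: \<delta>'_def)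
      show "(\<Sum>i<m. t i - s i) < e / (2 * B * L)" using st(3) by (simp add: \<delta>'_def)
    qed (use pos in auto)
    also have "\<dots> = e" using pos by simp
    finally show ?thesis .
  qed
  moreover have "\<delta>' > 0" using d e pos by (simp add: \<delta>'_def)
  ultimately show "\<exists>\<delta>>0. \<forall>(m::nat) s t. (\<forall>i<m. a \<le> s i \<and> s i \<le> t i \<and> t i \<le> b) \<longrightarrow>
      (\<forall>i<m. \<forall>j<m. i \<noteq> j \<longrightarrow> {s i<..<t i} \<inter> {s j<..<t j} = {}) \<longrightarrow> (\<Sum>i<m. t i - s i) < \<delta> \<longrightarrow>
      (\<Sum>i<m. \<bar>g (t i) * u (t i) - g (s i) * u (s i)\<bar>) < e"
    by (intro exI[of _ \<delta>']) simp
qed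

section \<open>The eigenspaces of the weak problem\<close>

lemma absolutely_integrable_continuous_mult:
  fixes g f :: "real \<Rightarrow> real"
  assumes "continuous_on {a..b} g" "f absolutely_integrable_on {a..b}"
  shows "(\<lambda>x. g x * f x) absolutely_integrable_on {a..b}"
proof (rule absolutely_integrable_bounded_measurable_product_real[OF _ _ _ assms(2)])
  show "g \<in> borel_measurable (lebesgue_on {a..b})"
    using assms(1) by (rule continuous_imp_measurable_on_sets_lebesgue) simp
  show "bounded (g ` {a..b})"
    using assms(1) by (intro compact_imp_bounded compact_continuous_image) auto
qed simp

lemma H1_continuous: "u \<in> H1 \<Longrightarrow> continuous_on {0..1} u"
  unfolding H1_def using absolutely_continuous_fun_on_imp_continuous by blast

lemma H1_deriv_integrable:
  assumes "u \<in> H1"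
  shows "deriv u absolutely_integrable_on {0..1}"
proof (rule set_integrable_bound)
  have sq: "(\<lambda>x. (deriv u x)\<^sup>2) absolutely_integrable_on {0..1}"
    using assms by (simp add: H1_def square_integrable_01_def)
  show "(\<lambda>x. 1 + (deriv u x)\<^sup>2) absolutely_integrable_on {0..1}"
    by (rule set_integral_add(1)[OF absolutely_integrable_continuous_real[OF continuous_on_const] sq])
  show "set_borel_measurable lebesgue {0..1} (deriv u)"
    using assms by (simp add: H1_def square_integrable_01_def)
  have "\<bar>x\<bar> \<le> 1 + x\<^sup>2" for x :: real
    using zero_le_power2[of "\<bar>x\<bar> - 1"] by (simp add: power2_eq_square algebra_simps)
  then show "AE x in lebesgue. x \<in> {0..1} \<longrightarrow> norm (deriv u x) \<le> norm (1 + (deriv u x)\<^sup>2)"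
    by (intro always_eventually allI impI) (simp add: abs_of_nonneg)
qed

lemma C1_lipschitz:
  fixes y :: "real \<Rightarrow> real"
  assumes "\<And>x. x \<in> {0..1} \<Longrightarrow> (y has_real_derivative y' x) (at x within {0..1})" "continuous_on {0..1} y'"
  obtains L where "L > 0" "\<And>s t. s \<in> {0..1} \<Longrightarrow> t \<in> {0..1} \<Longrightarrow> \<bar>y s - y t\<bar> \<le> L * \<bar>s - t\<bar>"
proof -
  obtain L where L: "L > 0" "\<And>x. x \<in> {0..1} \<Longrightarrow> \<bar>y' x\<bar> \<le> L"
    using continuous_on_unit_bounded[OF assms(2)] by blast
  have "\<bar>y s - y t\<bar> \<le> L * \<bar>s - t\<bar>" if "s \<in> {0..1}" "t \<in> {0..1}" for s t
    using field_differentiable_bound[of "{0..1}" y y' L s t] assms(1) L(2) that by simp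
  with L(1) that show ?thesis by blast
qed

text \<open>\<open>g * u\<close> is absolutely continuous and vanishes at both ends, so the integral
  of its derivative is zero; the points where \<open>u\<close> is not differentiable form a null
  set.\<close>

lemma H1_by_parts:
  assumes u: "u \<in> H1" and g: "\<And>x. x \<in> {0..1} \<Longrightarrow> (g has_real_derivative g' x) (at x within {0..1})"
    and g': "continuous_on {0..1} g'"
  shows "integral {0..1} (\<lambda>x. g' x * u x + g x * deriv u x) = 0"
proof -
  have AE: "AE x in lebesgue. x \<in> {0..1} \<longrightarrow> u field_differentiable at x"
    and ac: "absolutely_continuous_fun_on 0 1 u" and u01: "u 0 = 0" "u 1 = 0"
    using u by (auto simp: H1_def)
  from AE obtain N where N: "N \<in> null_sets lebesgue" "{x. \<not> (x \<in> {0..1} \<longrightarrow> u field_differentiable at x)} \<subseteq> N"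
    unfolding eventually_ae_filter by auto
  have cg: "continuous_on {0..1} g" by (rule DERIV_continuous_on[OF g])
  obtain L where L: "L > 0" "\<And>s t. s \<in> {0..1} \<Longrightarrow> t \<in> {0..1} \<Longrightarrow> \<bar>g s - g t\<bar> \<le> L * \<bar>s - t\<bar>"
    using C1_lipschitz[OF g g'] by blast
  obtain B1 where B1: "B1 > 0" "\<And>x. x \<in> {0..1} \<Longrightarrow> \<bar>g x\<bar> \<le> B1"
    using continuous_on_unit_bounded[OF cg] by blast
  obtain B2 where B2: "B2 > 0" "\<And>x. x \<in> {0..1} \<Longrightarrow> \<bar>u x\<bar> \<le> B2"
    using continuous_on_unit_bounded[OF H1_continuous[OF u]] by blast
  have "absolutely_continuous_fun_on 0 1 (\<lambda>x. g x * u x)"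
  proof (rule absolutely_continuous_fun_on_lipschitz_mult[OF ac L(2)])
    fix x :: real assume "x \<in> {0..1}"
    then show "\<bar>g x\<bar> \<le> B1 + B2" "\<bar>u x\<bar> \<le> B1 + B2" using B1(1) B1(2)[of x] B2(1) B2(2)[of x] by linarith+
  qed (use L B1 B2 in auto)
  then have "((\<lambda>x. g' x * u x + g x * deriv u x) has_integral (g 1 * u 1 - g 0 * u 0)) {0..1}"
  proof (rule absolutely_continuous_fun_on_FTC[rotated])
    show "negligible N" using N(1) by (simp add: negligible_iff_null_sets)
    fix x assume x: "x \<in> {0..1} - N"
    then have "u field_differentiable at x" using N(2) by blast
    then have "(u has_real_derivative deriv u x) (at x)" by (simp add: DERIV_deriv_iff_field_differentiable)
    then have "(u has_real_derivative deriv u x) (at x within {0..1})" by (rule has_field_derivative_at_within)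
    then show "((\<lambda>x. g x * u x) has_real_derivative g' x * u x + g x * deriv u x) (at x within {0..1})"
      using x by (intro DERIV_cong[OF DERIV_mult[OF g]]) auto
  qed simp
  then show ?thesis using u01 by (simp add: integral_unique)
qed

text \<open>The representative that \<open>H1\<close> asks for. It may fail to be differentiable at
  \<open>0\<close> and \<open>1\<close>, so its \<open>deriv\<close> is computed only in the
  interior.\<close>

definition extend_zero :: "(real \<Rightarrow> real) \<Rightarrow> real \<Rightarrow> real" where
  "extend_zero y x = (if x \<in> {0..1} then y x else 0)"

lemma deriv_extend_zero:
  assumes "\<And>x. x \<in> {0..1} \<Longrightarrow> (y has_real_derivative y' x) (at x within {0..1})" and x: "0 < x" "x < 1"
  shows "(extend_zero y has_real_derivative y' x) (at x)" and "deriv (extend_zero y) x = y' x"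
proof -
  have "at x within {0..1} = at x"
    using x by (intro at_within_interior) (auto simp: interior_atLeastAtMost_real)
  then have "(y has_real_derivative y' x) (at x)" using assms(1)[of x] x by simp
  then show "(extend_zero y has_real_derivative y' x) (at x)"
    by (rule has_field_derivative_transform_within_open[of _ _ _ "{0<..<1}"])
      (use x in \<open>auto simp: extend_zero_def\<close>)
  then show "deriv (extend_zero y) x = y' x" by (rule DERIV_imp_deriv)
qed

lemma extend_zero_in_H1:
  assumes y': "\<And>x. x \<in> {0..1} \<Longrightarrow> (y has_real_derivative y' x) (at x within {0..1})"
    and cont: "continuous_on {0..1} y'" and y01: "y 0 = 0" "y 1 = 0"
  shows "extend_zero y \<in> H1"
proof -
  have neg: "negligible {0, 1 :: real}" by simp
  have cy: "continuous_on {0..1} y" by (rule DERIV_continuous_on[OF y'])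
  have sq: "square_integrable_01 f" if "continuous_on {0..1} g" "\<And>x. x \<in> {0..1} - {0, 1} \<Longrightarrow> f x = g x" for f g
  proof -
    have "f absolutely_integrable_on {0..1}"
      by (rule absolutely_integrable_spike[OF absolutely_integrable_continuous_real[OF that(1)] neg that(2)])
    moreover have "(\<lambda>x. (f x)\<^sup>2) absolutely_integrable_on {0..1}"
      by (rule absolutely_integrable_spike[OF absolutely_integrable_continuous_real neg, of _ _ "\<lambda>x. (g x)\<^sup>2"])
        (use that in \<open>auto intro!: continuous_intros\<close>)
    ultimately show ?thesis
      by (auto simp: square_integrable_01_def set_borel_measurable_def set_integrable_def
          intro: borel_measurable_integrable)
  qed
  obtain L where L: "L > 0" "\<And>s t. s \<in> {0..1} \<Longrightarrow> t \<in> {0..1} \<Longrightarrow> \<bar>y s - y t\<bar> \<le> L * \<bar>s - t\<bar>"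
    using C1_lipschitz[OF y' cont] by blast
  obtain C where C: "C > 0" "\<And>x. x \<in> {0..1} \<Longrightarrow> \<bar>y x\<bar> \<le> C"
    using continuous_on_unit_bounded[OF cy] by blast
  have "absolutely_continuous_fun_on 0 1 (\<lambda>_. 1)"
    unfolding absolutely_continuous_fun_on_def by (auto intro!: exI[of _ 1])
  then have "absolutely_continuous_fun_on 0 1 (\<lambda>x. extend_zero y x * 1)"
    by (rule absolutely_continuous_fun_on_lipschitz_mult[where L = L and B = "C + 1"])
      (use L C in \<open>auto simp: extend_zero_def intro: add_increasing2\<close>)
  then have "absolutely_continuous_fun_on 0 1 (extend_zero y)" by simp
  moreover have "AE x in lebesgue. x \<in> {0..1} \<longrightarrow> extend_zero y field_differentiable at x"
  proof (rule AE_I')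
    show "{0, 1} \<in> null_sets lebesgue" using neg by (simp add: negligible_iff_null_sets)
    show "{x \<in> space lebesgue. \<not> (x \<in> {0..1} \<longrightarrow> extend_zero y field_differentiable at x)} \<subseteq> {0, 1}"
    proof
      fix x assume x: "x \<in> {x \<in> space lebesgue. \<not> (x \<in> {0..1} \<longrightarrow> extend_zero y field_differentiable at x)}"
      show "x \<in> {0, 1}"
      proof (rule ccontr)
        assume "x \<notin> {0, 1}"
        then have "0 < x" "x < 1" using x by auto
        from deriv_extend_zero(1)[OF y' this] x show False
          by (auto simp: field_differentiable_def)
      qed
    qed
  qed
  moreover have "square_integrable_01 (extend_zero y)"
    by (rule sq[OF cy]) (simp add: extend_zero_def)
  moreover have "square_integrable_01 (deriv (extend_zero y))"
    by (rule sq[OF cont]) (use deriv_extend_zero(2)[OF y'] in auto)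
  moreover have "extend_zero y 0 = 0" "extend_zero y 1 = 0" "\<And>x. x \<notin> {0..1} \<Longrightarrow> extend_zero y x = 0"
    using y01 by (auto simp: extend_zero_def)
  ultimately show ?thesis unfolding H1_def by blast
qed

lemma schroedinger_form_commute: "schroedinger_form \<beta> b u v = schroedinger_form \<beta> b v u"
  by (simp add: schroedinger_form_def inner_01_def noise_form_def mult.commute add.commute)

context continuous_path
begin

text \<open>Integration by parts with \<open>g = z\<close>, whose derivative is continuous because
  the path is hidden inside \<open>z\<close>. Inserting \<open>z = \<beta> * y' + b * y\<close> and
  the equation for \<open>z'\<close> reproduces the two parts of the form, and \<open>b\<close> is
  never differentiated.\<close>

lemma schroedinger_form_classical:
  assumes u: "u \<in> H1"
    and y: "\<And>x. x \<in> {0..1} \<Longrightarrow> (y has_real_derivative (z x - b x * y x) / \<beta>) (at x within {0..1})"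
    and z: "\<And>x. x \<in> {0..1} \<Longrightarrow>
      (z has_real_derivative t * y x + b x * ((z x - b x * y x) / \<beta>) + f x) (at x within {0..1})"
    and f: "continuous_on {0..1} f"
  shows "schroedinger_form \<beta> b u (extend_zero y)
    = t * inner_01 u (extend_zero y) + integral {0..1} (\<lambda>x. f x * u x)"
proof -
  define y' where "y' x = (z x - b x * y x) / \<beta>" for x
  have nz: "\<beta> \<noteq> 0" using beta_pos by simp
  have cy: "continuous_on {0..1} y" and cz: "continuous_on {0..1} z"
    by (rule DERIV_continuous_on[OF y], assumption, rule DERIV_continuous_on[OF z])
  have cy': "continuous_on {0..1} y'" unfolding y'_def using nz by (intro continuous_intros cy cz cont_b) auto
  have cu: "continuous_on {0..1} u" by (rule H1_continuous[OF u])
  have du: "deriv u absolutely_integrable_on {0..1}" by (rule H1_deriv_integrable[OF u])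
  have neg: "negligible {0, 1 :: real}" by simp
  have dv: "deriv (extend_zero y) x = y' x" "extend_zero y x = y x" if "x \<in> {0..1} - {0, 1}" for x
    using deriv_extend_zero(2)[of y y' x] y that by (auto simp: y'_def extend_zero_def)
  \<comment> \<open>Passes from the Lebesgue to the Henstock-Kurzweil integral and discards the end
    points, where \<open>deriv (extend_zero y)\<close> may be an unspecified value.\<close>
  have LINT: "(LINT x:{0..1}|lebesgue. F x) = integral {0..1} G"
    if "G absolutely_integrable_on {0..1}" "\<And>x. x \<in> {0..1} - {0, 1} \<Longrightarrow> F x = G x" for F G :: "real \<Rightarrow> real"
    using set_lebesgue_integral_eq_integral(2)[OF absolutely_integrable_spike[OF that(1) neg that(2)]]
      integral_spike[OF neg, of "{0..1}" F G] that(2) by simp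
  have i1: "(\<lambda>x. y' x * deriv u x) absolutely_integrable_on {0..1}"
    by (rule absolutely_integrable_continuous_mult[OF cy' du])
  have i2: "(\<lambda>x. (b x * y x) * deriv u x + b x * u x * y' x) absolutely_integrable_on {0..1}"
    by (intro set_integral_add absolutely_integrable_continuous_mult[OF _ du] absolutely_integrable_continuous_real
        continuous_intros cont_b cy cu cy')
  have i3: "(\<lambda>x. u x * y x) absolutely_integrable_on {0..1}"
    by (intro absolutely_integrable_continuous_real continuous_intros cu cy)
  have i4: "(\<lambda>x. f x * u x) absolutely_integrable_on {0..1}"
    by (intro absolutely_integrable_continuous_real continuous_intros cu f)
  have I1: "inner_01 (deriv u) (deriv (extend_zero y)) = integral {0..1} (\<lambda>x. y' x * deriv u x)"
    unfolding inner_01_def by (rule LINT[OF i1]) (simp add: dv)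
  have I2: "noise_form b u (extend_zero y)
      = - integral {0..1} (\<lambda>x. (b x * y x) * deriv u x + b x * u x * y' x)"
    unfolding noise_form_def by (subst LINT[OF i2]) (simp_all add: dv algebra_simps)
  have I3: "inner_01 u (extend_zero y) = integral {0..1} (\<lambda>x. u x * y x)"
    unfolding inner_01_def by (rule LINT[OF i3]) (simp add: dv)
  have "0 = integral {0..1} (\<lambda>x. (t * y x + b x * y' x + f x) * u x + z x * deriv u x)"
    by (rule H1_by_parts[OF u, symmetric])
      (use z in \<open>auto simp: y'_def[symmetric] intro!: continuous_intros cy cy' cont_b f\<close>)
  also have "\<dots> = integral {0..1} (\<lambda>x. \<beta> * (y' x * deriv u x)
      + (((b x * y x) * deriv u x + b x * u x * y' x) + (t * (u x * y x) + f x * u x)))"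
  proof (rule Henstock_Kurzweil_Integration.integral_cong)
    fix x
    have "z x = \<beta> * y' x + b x * y x" using nz by (simp add: y'_def)
    then show "(t * y x + b x * y' x + f x) * u x + z x * deriv u x = \<beta> * (y' x * deriv u x)
      + (((b x * y x) * deriv u x + b x * u x * y' x) + (t * (u x * y x) + f x * u x))"
      by (simp add: algebra_simps)
  qed
  also have "\<dots> = \<beta> * integral {0..1} (\<lambda>x. y' x * deriv u x)
      + (integral {0..1} (\<lambda>x. (b x * y x) * deriv u x + b x * u x * y' x)
      + (t * integral {0..1} (\<lambda>x. u x * y x) + integral {0..1} (\<lambda>x. f x * u x)))"
  proof -
    have h: "(F has_integral integral {0..1} F) {0..1}" if "F absolutely_integrable_on {0..1}" for F :: "real \<Rightarrow> real"
      using that set_lebesgue_integral_eq_integral(1) by (intro integrable_integral)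
    show ?thesis
      by (rule integral_unique[OF has_integral_add[OF has_integral_mult_right[OF h[OF i1]]
            has_integral_add[OF h[OF i2] has_integral_add[OF has_integral_mult_right[OF h[OF i3]] h[OF i4]]]]])
  qed
  finally show ?thesis unfolding schroedinger_form_def I1 I2 I3 by simp
qed

text \<open>The product in the hypothesis covers the multiples of an eigenfunction and, through
  \<open>c = 0\<close>, the zero function.\<close>

lemma scaled_phi_in_eigenspace:
  assumes "c * phi t 1 = 0"
  shows "(\<lambda>x. c * extend_zero (phi t) x) \<in> schroedinger_eigenspace \<beta> b t"
proof -
  have eq: "(\<lambda>x. c * extend_zero (phi t) x) = extend_zero (\<lambda>x. c * phi t x)"
    by (auto simp: extend_zero_def)
  have d1: "((\<lambda>x. c * phi t x) has_real_derivative (c * psi t x - b x * (c * phi t x)) / \<beta>) (at x within {0..1})"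
    if "x \<in> {0..1}" for x
    by (rule DERIV_cong[OF DERIV_cmult[OF DERIV_phi[OF that]]]) (simp add: dphi_def algebra_simps)
  have d2: "((\<lambda>x. c * psi t x) has_real_derivative t * (c * phi t x)
      + b x * ((c * psi t x - b x * (c * phi t x)) / \<beta>) + 0) (at x within {0..1})" if "x \<in> {0..1}" for x
    by (rule DERIV_cong[OF DERIV_cmult[OF DERIV_psi[OF that]]])
      (simp add: dphi_def algebra_simps diff_divide_distrib)
  have "extend_zero (\<lambda>x. c * phi t x) \<in> H1"
  proof (rule extend_zero_in_H1[OF d1])
    show "continuous_on {0..1} (\<lambda>x. (c * psi t x - b x * (c * phi t x)) / \<beta>)"
      using beta_pos by (intro continuous_intros cont_phi cont_psi cont_b) auto
  qed (use assms in auto)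
  moreover have "schroedinger_form \<beta> b (extend_zero (\<lambda>x. c * phi t x)) v
      = t * inner_01 (extend_zero (\<lambda>x. c * phi t x)) v" if "v \<in> H1" for v
    using schroedinger_form_classical[OF that d1 d2 continuous_on_const]
    by (simp add: schroedinger_form_commute[of \<beta> b _ v] inner_01_def mult.commute)
  ultimately show ?thesis unfolding eq by (simp add: schroedinger_eigenspace_def)
qed

text \<open>Testing the weak equation against classical solutions of \<open>(L - t) v = f\<close> avoids any
  regularity theory: for \<open>f\<close> continuous and orthogonal to \<open>\<phi>\<close> such a \<open>v\<close> exists.\<close>

lemma eigenspace_orthogonal:
  assumes u: "u \<in> schroedinger_eigenspace \<beta> b t" and f: "continuous_on {0..1} f"
    and fphi: "phi t 1 = 0 \<Longrightarrow> integral {0..1} (\<lambda>x. phi t x * f x) = 0"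
  shows "integral {0..1} (\<lambda>x. f x * u x) = 0"
proof -
  obtain y0 z0 where yz: "y0 0 = 0" "z0 0 = 0"
    "\<And>x. x \<in> {0..1} \<Longrightarrow> (y0 has_real_derivative (z0 x - b x * y0 x) / \<beta>) (at x within {0..1})"
    "\<And>x. x \<in> {0..1} \<Longrightarrow>
       (z0 has_real_derivative t * y0 x + b x * ((z0 x - b x * y0 x) / \<beta>) + f x) (at x within {0..1})"
    using inhomogeneous_solution[OF f, of 0 0 t] by blast
  \<comment> \<open>Adding a multiple of \<open>phi\<close> to a solution with zero initial data
    corrects the value at \<open>1\<close>. If \<open>phi t 1 = 0\<close> no correction is possible,
    but then the orthogonality of \<open>f\<close> makes \<open>y0 1\<close> vanish by the
    Wronskian, as in Fredholm's alternative.\<close>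
  define c where "c = y0 1 / phi t 1"
  define y z where "y x = y0 x - c * phi t x" and "z x = z0 x - c * psi t x" for x
  have y1: "y 1 = 0"
  proof (cases "phi t 1 = 0")
    case True
    have "((\<lambda>s. phi t s * f s) has_integral
      (phi t 1 * z0 1 - y0 1 * psi t 1) - (phi t 0 * z0 0 - y0 0 * psi t 0)) {0..1}"
    proof (rule wronskian_integral[of "phi t" "psi t" t y0 z0 f 1])
      fix s :: real assume s: "s \<in> {0..1}"
      show "(phi t has_real_derivative (psi t s - b s * phi t s) / \<beta>) (at s within {0..1})"
        using DERIV_phi[OF s, of t] unfolding dphi_def .
      show "(psi t has_real_derivative t * phi t s + b s * ((psi t s - b s * phi t s) / \<beta>)) (at s within {0..1})"
        using DERIV_psi[OF s, of t] unfolding dphi_def .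
    qed (fact yz(3), fact yz(4), simp)
    then have "y0 1 * psi t 1 = 0" using fphi[OF True] True yz(1,2) by (simp add: has_integral_iff)
    then show ?thesis using phi_psi_not_both_0[of 1 t] True by (simp add: y_def)
  next
    case False
    then show ?thesis by (simp add: y_def c_def)
  qed
  have d1: "(y has_real_derivative (z x - b x * y x) / \<beta>) (at x within {0..1})" if "x \<in> {0..1}" for x
    unfolding y_def
    by (rule DERIV_cong[OF DERIV_diff[OF yz(3)[OF that] DERIV_cmult[OF DERIV_phi[OF that]]]])
      (simp add: y_def z_def dphi_def algebra_simps diff_divide_distrib add_divide_distrib)
  have d2: "(z has_real_derivative t * y x + b x * ((z x - b x * y x) / \<beta>) + f x) (at x within {0..1})"
    if "x \<in> {0..1}" for x
    unfolding z_def
    by (rule DERIV_cong[OF DERIV_diff[OF yz(4)[OF that] DERIV_cmult[OF DERIV_psi[OF that]]]])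
      (simp add: y_def z_def dphi_def algebra_simps diff_divide_distrib add_divide_distrib)
  have "extend_zero y \<in> H1"
  proof (rule extend_zero_in_H1[OF d1])
    show "continuous_on {0..1} (\<lambda>x. (z x - b x * y x) / \<beta>)"
      using beta_pos DERIV_continuous_on[OF d1] DERIV_continuous_on[OF d2]
      by (intro continuous_intros cont_b) auto
  qed (use y1 yz(1) in \<open>auto simp: y_def\<close>)
  then have "schroedinger_form \<beta> b u (extend_zero y) = t * inner_01 u (extend_zero y)" and "u \<in> H1"
    using u by (auto simp: schroedinger_eigenspace_def)
  then show ?thesis using schroedinger_form_classical[OF _ d1 d2 f, of u] by simp
qed

text \<open>Subtracting from \<open>u\<close> its projection to \<open>phi\<close> leaves a
  continuous \<open>f\<close> that is admissible in \<open>eigenspace_orthogonal\<close>. So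
  \<open>f\<close> is orthogonal to \<open>u\<close> and to the part subtracted, hence to itself.
  When \<open>phi t 1 \<noteq> 0\<close> nothing is subtracted and \<open>u\<close> itself
  vanishes.\<close>

lemma schroedinger_eigenspace_eq:
  "schroedinger_eigenspace \<beta> b t = (if phi t 1 = 0 then fun_vs.span {extend_zero (phi t)} else {0})"
proof -
  have sub: "\<exists>c. c * phi t 1 = 0 \<and> u = (\<lambda>x. c * extend_zero (phi t) x)" if u: "u \<in> schroedinger_eigenspace \<beta> b t" for u
  proof -
    have uH: "u \<in> H1" using u by (simp add: schroedinger_eigenspace_def)
    then have cu: "continuous_on {0..1} u" by (rule H1_continuous)
    define I where "I = integral {0..1} (\<lambda>x. (phi t x)\<^sup>2)"
    have I: "I > 0" unfolding I_def by (rule integral_phi_sq_pos)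
    define c where "c = (if phi t 1 = 0 then integral {0..1} (\<lambda>x. phi t x * u x) / I else 0)"
    define f where "f x = u x - c * phi t x" for x
    have cf: "continuous_on {0..1} f" unfolding f_def by (intro continuous_intros cu cont_phi)
    have fphi: "integral {0..1} (\<lambda>x. phi t x * f x) = 0" if "phi t 1 = 0"
    proof -
      have "integral {0..1} (\<lambda>x. phi t x * f x) = integral {0..1} (\<lambda>x. phi t x * u x - c * (phi t x)\<^sup>2)"
        by (simp add: f_def algebra_simps power2_eq_square)
      also have "\<dots> = integral {0..1} (\<lambda>x. phi t x * u x) - c * I"
        unfolding I_def
        by (subst Henstock_Kurzweil_Integration.integral_diff)
          (auto intro!: integrable_continuous_real continuous_intros cont_phi cu)
      also have "\<dots> = 0" using that I by (simp add: c_def)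
      finally show ?thesis .
    qed
    have cphi: "c * integral {0..1} (\<lambda>x. phi t x * f x) = 0" using fphi by (auto simp: c_def)
    have "integral {0..1} (\<lambda>x. (f x)\<^sup>2) = integral {0..1} (\<lambda>x. f x * u x - c * (phi t x * f x))"
      by (intro Henstock_Kurzweil_Integration.integral_cong) (simp add: f_def algebra_simps power2_eq_square)
    also have "\<dots> = integral {0..1} (\<lambda>x. f x * u x) - c * integral {0..1} (\<lambda>x. phi t x * f x)"
      by (subst Henstock_Kurzweil_Integration.integral_diff)
        (auto intro!: integrable_continuous_real continuous_intros cont_phi cu cf)
    also have "\<dots> = 0" using eigenspace_orthogonal[OF u cf fphi] cphi by simp
    finally have ff: "integral {0..1} (\<lambda>x. (f x)\<^sup>2) = 0" .
    have cf2: "continuous_on {0..1} (\<lambda>x. (f x)\<^sup>2)" by (intro continuous_intros cf)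
    have "\<forall>x\<in>{0..1}. (f x)\<^sup>2 = 0" using integral_eq_0_iff[OF cf2] ff by simp
    then have f0: "f x = 0" if "x \<in> {0..1}" for x using that by simp
    have u0: "u x = 0" if "x \<notin> {0..1}" for x using uH that unfolding H1_def by blast
    have "u x = c * extend_zero (phi t) x" for x
      using f0[of x] u0[of x] by (cases "x \<in> {0..1}") (auto simp: extend_zero_def f_def)
    then have "u = (\<lambda>x. c * extend_zero (phi t) x)" by (rule ext)
    moreover have "c * phi t 1 = 0" by (simp add: c_def)
    ultimately show ?thesis by blast
  qed
  show ?thesis
  proof (cases "phi t 1 = 0")
    case True
    have "schroedinger_eigenspace \<beta> b t = range (\<lambda>c x. c * extend_zero (phi t) x)"
    proof (intro equalityI subsetI)
      fix u assume "u \<in> schroedinger_eigenspace \<beta> b t"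
      from sub[OF this] obtain c where "u = (\<lambda>x. c * extend_zero (phi t) x)" by blast
      then show "u \<in> range (\<lambda>c x. c * extend_zero (phi t) x)" by (rule range_eqI)
    next
      fix u assume "u \<in> range (\<lambda>c x. c * extend_zero (phi t) x)"
      then obtain c where "u = (\<lambda>x. c * extend_zero (phi t) x)" by blast
      then show "u \<in> schroedinger_eigenspace \<beta> b t" using scaled_phi_in_eigenspace[of c t] True by simp
    qed
    then show ?thesis using True by (simp add: fun_vs.span_singleton)
  next
    case False
    have "schroedinger_eigenspace \<beta> b t = {0}"
    proof (intro equalityI subsetI)
      fix u assume "u \<in> schroedinger_eigenspace \<beta> b t"
      from sub[OF this] obtain c where "c * phi t 1 = 0" "u = (\<lambda>x. c * extend_zero (phi t) x)" by blast
      then show "u \<in> {0}" using False by (simp add: zero_fun_def)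
    next
      fix u :: "real \<Rightarrow> real" assume "u \<in> {0}"
      then show "u \<in> schroedinger_eigenspace \<beta> b t"
        using scaled_phi_in_eigenspace[of 0 t] by (simp add: zero_fun_def)
    qed
    then show ?thesis using False by simp
  qed
qed

lemma independent_extend_zero_phi: "fun_vs.independent {extend_zero (phi t)}"
proof -
  have "extend_zero (phi t) \<noteq> 0"
  proof
    assume "extend_zero (phi t) = 0"
    then have z: "phi t x = 0" if "x \<in> {0..1}" for x
      using that by (auto simp: extend_zero_def fun_eq_iff split: if_splits dest!: spec[of _ x])
    have "integral {0..1} (\<lambda>x. (phi t x)\<^sup>2) = integral {0..1} (\<lambda>x :: real. 0 :: real)"
      by (rule Henstock_Kurzweil_Integration.integral_cong) (simp add: z)
    then show False using integral_phi_sq_pos[of t] by simp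
  qed
  then show ?thesis by simp
qed

text \<open>Bases of the same span are equinumerous, so the existential over \<open>S\<close> can be
  evaluated on the explicit basis with one element or none.\<close>

lemma lists_schroedinger_eigenvalues_iff:
  "lists_schroedinger_eigenvalues \<beta> b l \<longleftrightarrow>
     antimono l \<and> (\<forall>t. finite {i. l i = t} \<and> card {i. l i = t} = (if phi t 1 = 0 then 1 else 0))"
proof -
  define B where "B t = (if phi t 1 = 0 then {extend_zero (phi t)} else {})" for t
  have B: "finite (B t)" "fun_vs.independent (B t)" "fun_vs.span (B t) = schroedinger_eigenspace \<beta> b t"
    "card (B t) = (if phi t 1 = 0 then 1 else 0)" for t
    using independent_extend_zero_phi by (auto simp: B_def schroedinger_eigenspace_eq fun_vs.span_empty fun_vs.independent_empty)
  have "(\<exists>S. finite S \<and> fun_vs.independent S \<and> fun_vs.span S = schroedinger_eigenspace \<beta> b t \<and> card S = m)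
      \<longleftrightarrow> m = (if phi t 1 = 0 then 1 else 0)" for t m
  proof
    assume "\<exists>S. finite S \<and> fun_vs.independent S \<and> fun_vs.span S = schroedinger_eigenspace \<beta> b t \<and> card S = m"
    then obtain S where S: "fun_vs.independent S" "fun_vs.span S = fun_vs.span (B t)" "card S = m"
      using B(3) by auto
    then obtain h where "bij_betw h S (B t)" using fun_vs.bij_if_span_eq_span_bases B(2) by blast
    then show "m = (if phi t 1 = 0 then 1 else 0)" using S(3) B(4) bij_betw_same_card by metis
  next
    assume "m = (if phi t 1 = 0 then 1 else 0)"
    then show "\<exists>S. finite S \<and> fun_vs.independent S \<and> fun_vs.span S = schroedinger_eigenspace \<beta> b t \<and> card S = m"
      using B[of t] by (intro exI[of _ "B t"]) simp
  qed
  then show ?thesis by (simp only: lists_schroedinger_eigenvalues_def)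
qed

lemma decreasing_enumeration_unique:
  fixes l l' :: "nat \<Rightarrow> real"
  assumes l: "\<And>i k. i < k \<Longrightarrow> l k < l i" and l': "\<And>i k. i < k \<Longrightarrow> l' k < l' i" and eq: "range l = range l'"
  shows "l = l'"
proof
  \<comment> \<open>If the lists agree before \<open>i\<close>, strict decrease excludes the value
    \<open>g i\<close> from the earlier entries of \<open>h\<close>, so it occurs at
    \<open>i\<close> or later and is at most \<open>h i\<close>.\<close>
  have le: "g i \<le> h i" if "\<And>j. j < i \<Longrightarrow> g j = h j" and g: "\<And>i k. i < k \<Longrightarrow> g k < g i"
    and h: "\<And>i k. i < k \<Longrightarrow> h k < h i" and "range g = range h" for g h :: "nat \<Rightarrow> real" and i
  proof -
    obtain m where m: "g i = h m" using \<open>range g = range h\<close> by (metis rangeE rangeI)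
    have "\<not> m < i" using that(1)[of m] g[of m i] m by fastforce
    then show ?thesis using h[of i m] m by (cases "m = i") auto
  qed
  fix i show "l i = l' i"
  proof (induction i rule: less_induct)
    case (less i)
    show ?case using le[of i l l', OF less l l' eq] le[of i l' l, OF less[symmetric] l' l eq[symmetric]] by simp
  qed
qed

text \<open>Simplicity turns every weakly decreasing list of the spectrum into a strictly decreasing
  one with the zeros of \<open>phi t 1\<close> as its range. Such a list is unique, so the
  \<open>THE\<close> in \<open>schroedinger_eigenvalue\<close> denotes the sequence of
  limits.\<close>

lemma grid_eig_tendsto_schroedinger_eigenvalue:
  "(\<lambda>n. grid_eig n (k - 1)) \<longlonglongrightarrow> schroedinger_eigenvalue \<beta> b k"
proof -
  obtain l where l: "\<And>i k. i < k \<Longrightarrow> l k < l i" "range l = {t. phi t 1 = 0}"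
    "\<And>k. (\<lambda>n. grid_eig n k) \<longlonglongrightarrow> l k"
    using grid_eig_limit by blast
  have "lists_schroedinger_eigenvalues \<beta> b l"
    unfolding lists_schroedinger_eigenvalues_iff
  proof (intro conjI allI)
    show "antimono l" unfolding antimono_def using l(1) by (metis le_less)
    fix t
    have "{i. l i = t} = (if phi t 1 = 0 then {inv_into UNIV l t} else {})"
    proof (cases "phi t 1 = 0")
      case True
      then have "t \<in> range l" using l(2) by simp
      then obtain i where i: "l i = t" by auto
      have inj: "inj l" by (rule linorder_injI) (use l(1) in force)
      then have "inv_into UNIV l t = i" using i by (simp add: inv_f_eq)
      then show ?thesis using True i inj by (auto dest: injD)
    next
      case False
      then show ?thesis using l(2) by auto
    qed
    then show "finite {i. l i = t}" "card {i. l i = t} = (if phi t 1 = 0 then 1 else 0)" by auto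
  qed
  moreover have "l' = l" if "lists_schroedinger_eigenvalues \<beta> b l'" for l'
  proof (rule decreasing_enumeration_unique[OF _ l(1)])
    have am: "antimono l'" and c: "\<And>t. finite {i. l' i = t}"
      "\<And>t. card {i. l' i = t} = (if phi t 1 = 0 then 1 else 0)"
      using that unfolding lists_schroedinger_eigenvalues_iff by auto
    show "l' k < l' i" if "i < k" for i k
    proof -
      have "l' k \<noteq> l' i"
      proof
        assume "l' k = l' i"
        then have "{i, k} \<subseteq> {j. l' j = l' i}" by auto
        then have "card {i, k} \<le> card {j. l' j = l' i}" using c(1) card_mono by blast
        then show False using c(2)[of "l' i"] \<open>i < k\<close> by (auto split: if_splits)
      qed
      then show ?thesis using antimonoD[OF am, of i k] that by simp
    qed
    show "range l' = range l"
    proof (rule Set.set_eqI)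
      fix t
      have "t \<in> range l' \<longleftrightarrow> card {i. l' i = t} \<noteq> 0" using c(1)[of t] by auto
      then show "t \<in> range l' \<longleftrightarrow> t \<in> range l" unfolding l(2) c(2) by simp
    qed
  qed
  ultimately have "(THE l. lists_schroedinger_eigenvalues \<beta> b l) = l" by (rule the_equality)
  then show ?thesis using l(3)[of "k - 1"] by (simp add: schroedinger_eigenvalue_def)
qed

end

section \<open>Equality in law and convergence\<close>

lemma (in prob_space) indep_vars_shift:
  fixes D :: "nat \<Rightarrow> 'a \<Rightarrow> 'b"
  assumes "indep_vars (\<lambda>_. N) D {..<n}"
  shows "indep_vars (\<lambda>_. N) (\<lambda>i. D (i - 1)) {1..n}"
  unfolding indep_vars_def2
proof (intro conjI ballI)
  fix i assume "i \<in> {1..n}"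
  then have "i - 1 \<in> {..<n}" by auto
  then show "random_variable N (D (i - 1))" using assms by (simp add: indep_vars_def2)
next
  define F where "F i = {D i -` A \<inter> space M |A. A \<in> sets N}" for i
  have F: "indep_sets F {..<n}" using assms unfolding indep_vars_def2 F_def by blast
  show "indep_sets (\<lambda>i. {D (i - 1) -` A \<inter> space M |A. A \<in> sets N}) {1..n}"
    unfolding F_def[symmetric]
  proof (rule indep_setsI)
    fix i assume "i \<in> {1..n}"
    then have "i - 1 \<in> {..<n}" by auto
    then show "F (i - 1) \<subseteq> events" using F by (auto simp: indep_sets_def)
  next
    fix A J assume J: "J \<noteq> {}" "J \<subseteq> {1..n}" "finite J" and A: "\<forall>j\<in>J. A j \<in> F (j - 1)"
    define J' where "J' = (\<lambda>j. j - 1) ` J"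
    have inj: "inj_on (\<lambda>j. j - 1) J"
    proof (rule inj_onI)
      fix i j assume "i \<in> J" "j \<in> J" "i - 1 = j - 1"
      moreover from this have "1 \<le> i" "1 \<le> j" using J(2) by auto
      ultimately show "i = j" by simp
    qed
    have Suc: "Suc (j - 1) = j" if "j \<in> J" for j using that J(2) by auto
    have "prob (\<Inter>j\<in>J'. A (Suc j)) = (\<Prod>j\<in>J'. prob (A (Suc j)))"
    proof (rule indep_setsD[OF F])
      show "J' \<subseteq> {..<n}"
      proof
        fix i assume "i \<in> J'"
        then obtain j where "j \<in> J" "i = j - 1" by (auto simp: J'_def)
        moreover from this have "1 \<le> j" "j \<le> n" using J(2) by auto
        ultimately show "i \<in> {..<n}" by simp
      qed
      show "J' \<noteq> {}" "finite J'" using J by (auto simp: J'_def)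
      show "\<forall>j\<in>J'. A (Suc j) \<in> F j" using A Suc by (auto simp: J'_def)
    qed
    moreover have "(\<Inter>j\<in>J'. A (Suc j)) = (\<Inter>j\<in>J. A j)" using Suc by (auto simp: J'_def)
    moreover have "(\<Prod>j\<in>J'. prob (A (Suc j))) = (\<Prod>j\<in>J. prob (A j))"
      unfolding J'_def prod.reindex[OF inj] using Suc by (intro prod.cong) auto
    ultimately show "prob (\<Inter>j\<in>J. A j) = (\<Prod>j\<in>J. prob (A j))" by simp
  qed
qed

text \<open>The right-hand side mentions only the density, which is how a statistic of the Gaussian
  sample on \<open>M n\<close> and the same statistic of Brownian increments on \<open>N\<close> get
  the same law. \<open>GI\<close> is required because the product measure lives on functions
  restricted to \<open>I\<close>.\<close>

lemma (in prob_space) distr_of_iid: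
  fixes X :: "'i \<Rightarrow> 'a \<Rightarrow> real"
  assumes I: "I \<noteq> {}" and ind: "indep_vars (\<lambda>_. borel) X I"
    and d: "\<And>i. i \<in> I \<Longrightarrow> distributed M lborel (X i) f"
    and G: "G \<in> borel_measurable (PiM I (\<lambda>_. borel))" and GI: "\<And>x. G (restrict x I) = G x"
  shows "distr M borel (\<lambda>\<omega>. G (\<lambda>i. X i \<omega>)) = distr (PiM I (\<lambda>_. density lborel f)) borel G"
proof -
  have rv: "random_variable borel (X i)" if "i \<in> I" for i
    using distributed_measurable[OF d[OF that]] by simp
  have di: "distr M borel (X i) = density lborel f" if "i \<in> I" for i
    using distributed_distr_eq_density[OF d[OF that]] by (metis distr_cong sets_lborel)
  have m: "(\<lambda>\<omega>. \<lambda>i\<in>I. X i \<omega>) \<in> measurable M (PiM I (\<lambda>_. borel))"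
    using rv by (intro measurable_restrict) auto
  have "distr M borel (\<lambda>\<omega>. G (\<lambda>i. X i \<omega>)) = distr M borel (G \<circ> (\<lambda>\<omega>. \<lambda>i\<in>I. X i \<omega>))"
    using GI[of "\<lambda>i. X i _"] by (intro arg_cong[where f = "distr M borel"] ext) simp
  also have "\<dots> = distr (distr M (PiM I (\<lambda>_. borel)) (\<lambda>\<omega>. \<lambda>i\<in>I. X i \<omega>)) borel G"
    by (rule distr_distr[OF G m, symmetric])
  also have "distr M (PiM I (\<lambda>_. borel)) (\<lambda>\<omega>. \<lambda>i\<in>I. X i \<omega>) = PiM I (\<lambda>i. distr M borel (X i))"
    using indep_vars_iff_distr_eq_PiM'[OF I rv] ind by simp
  also have "\<dots> = PiM I (\<lambda>_. density lborel f)" by (rule PiM_cong[OF refl di])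
  finally show ?thesis .
qed

lemma tridiagonal_matrix_restrict: "tridiagonal_matrix \<beta> n (restrict x {1..n}) = tridiagonal_matrix \<beta> n x"
  unfolding tridiagonal_matrix_def by (rule eq_matI) auto

text \<open>The assumptions of the theorem concern \<open>n \<ge> k\<close> only, so the first
  measures have to be skipped.\<close>

lemma weak_conv_m_offset:
  assumes "weak_conv_m (\<lambda>n. \<mu> (n + k)) \<nu>"
  shows "weak_conv_m \<mu> \<nu>"
  using assms LIMSEQ_offset[of "\<lambda>n. cdf (\<mu> n) _" k] unfolding weak_conv_m_def weak_conv_def by blast

lemma (in prob_space) pointwise_convergence_imp_weak_conv:
  fixes Z :: "nat \<Rightarrow> 'a \<Rightarrow> real"
  assumes Z: "\<And>n. random_variable borel (Z n)" and L: "random_variable borel L"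
    and lim: "\<And>\<omega>. \<omega> \<in> space M \<Longrightarrow> (\<lambda>n. Z n \<omega>) \<longlonglongrightarrow> L \<omega>"
  shows "weak_conv_m (\<lambda>n. distr M borel (Z n)) (distr M borel L)"
proof (rule integral_bdd_continuous_conv_imp_weak_conv)
  fix f :: "real \<Rightarrow> real" assume f: "\<And>x. isCont f x" "\<And>x. \<bar>f x\<bar> \<le> 1"
  have fm: "f \<in> borel_measurable borel"
    using f(1) by (intro borel_measurable_continuous_onI) (simp add: continuous_on_eq_continuous_at)
  have fZ: "(\<lambda>\<omega>. f (Z n \<omega>)) \<in> borel_measurable M" for n by (rule measurable_compose[OF Z fm])
  have fL: "(\<lambda>\<omega>. f (L \<omega>)) \<in> borel_measurable M" by (rule measurable_compose[OF L fm])
  have "(\<lambda>n. expectation (\<lambda>\<omega>. f (Z n \<omega>))) \<longlonglongrightarrow> expectation (\<lambda>\<omega>. f (L \<omega>))"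
  proof (rule integral_dominated_convergence[where w = "\<lambda>_. 1"])
    show "AE \<omega> in M. (\<lambda>n. f (Z n \<omega>)) \<longlonglongrightarrow> f (L \<omega>)"
      by (rule AE_I2) (rule isCont_tendsto_compose[OF f(1) lim])
    show "AE \<omega> in M. norm (f (Z n \<omega>)) \<le> 1" for n using f(2) by (intro AE_I2) simp
  qed (rule fL fZ integrable_const)+
  then show "(\<lambda>n. integral\<^sup>L (distr M borel (Z n)) f) \<longlonglongrightarrow> integral\<^sup>L (distr M borel L) f"
    by (simp only: integral_distr[OF Z fm] integral_distr[OF L fm])
qed (rule real_distribution_distr Z L)+

section \<open>Coupling of the matrices to one Brownian path\<close>

definition scaled_increment :: "nat \<Rightarrow> (real \<Rightarrow> real) \<Rightarrow> nat \<Rightarrow> real" where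
  "scaled_increment n b i = sqrt (real n + 1) * (b (real i * (1 / (real n + 1))) - b (real (i - 1) * (1 / (real n + 1))))"

text \<open>An increment over a step of length \<open>1 / (n + 1)\<close> has exactly this variance,
  which the factor \<open>sqrt (n + 1)\<close> scales to 1. Independence is the one in the
  definition of Brownian motion, taken at the grid points and reindexed from 1.\<close>

lemma increments_iid:
  assumes B: "standard_brownian_motion N B"
  shows "prob_space.indep_vars N (\<lambda>_. borel) (\<lambda>i \<omega>. scaled_increment n (\<lambda>t. B t \<omega>) i) {1..n}"
    and "i \<in> {1..n} \<Longrightarrow>
      distributed N lborel (\<lambda>\<omega>. scaled_increment n (\<lambda>t. B t \<omega>) i) std_normal_density"
proof -
  interpret prob_space N using B by (simp add: standard_brownian_motion_def)
  define h where "h = 1 / (real n + 1)"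
  have h: "h > 0" "(real n + 1) * h = 1" by (auto simp: h_def)
  have sample: "scaled_increment n (\<lambda>t. B t \<omega>) i
      = sqrt (real n + 1) * (B (real i * h) \<omega> - B (real (i - 1) * h) \<omega>)" for i \<omega>
    by (simp only: scaled_increment_def h_def)
  have unit: "real i * h \<in> {0..1}" if "i \<le> n" for i
    using that by (auto simp: h_def)
  have "indep_vars (\<lambda>_. borel) (\<lambda>i \<omega>. B (real (Suc i) * h) \<omega> - B (real i * h) \<omega>) {..<n}"
  proof -
    have "strict_mono_on {0..n} (\<lambda>i. real i * h)"
      using h(1) by (auto simp: strict_mono_on_def)
    moreover have "(\<lambda>i. real i * h) ` {0..n} \<subseteq> {0..1}" using unit by auto
    ultimately show ?thesis
      using B unfolding standard_brownian_motion_def by blast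
  qed
  from indep_vars_compose2[OF indep_vars_shift[OF this], of "\<lambda>_ y. sqrt (real n + 1) * y" "\<lambda>_. borel"]
  have "indep_vars (\<lambda>_. borel)
      (\<lambda>i \<omega>. sqrt (real n + 1) * (B (real (Suc (i - 1)) * h) \<omega> - B (real (i - 1) * h) \<omega>)) {1..n}"
    by simp
  then show "indep_vars (\<lambda>_. borel) (\<lambda>i \<omega>. scaled_increment n (\<lambda>t. B t \<omega>) i) {1..n}"
    by (rule indep_vars_cong[THEN iffD1, rotated 3]) (auto simp: sample)
  assume i: "i \<in> {1..n}"
  define s t where "s = real (i - 1) * h" and "t = real i * h"
  have st: "0 \<le> s" "s < t" "t \<le> 1" "t - s = h"
    using i h(1) unit[of i] by (auto simp: s_def t_def of_nat_diff algebra_simps)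
  then have "distributed N lborel (\<lambda>\<omega>. B t \<omega> - B s \<omega>) (normal_density 0 (sqrt h))"
    using B unfolding standard_brownian_motion_def by metis
  from normal_density_affine[OF this, of "sqrt (real n + 1)" 0]
  have "distributed N lborel (\<lambda>\<omega>. sqrt (real n + 1) * (B t \<omega> - B s \<omega>))
      (normal_density 0 (\<bar>sqrt (real n + 1)\<bar> * sqrt h))"
    using h(1) by simp
  moreover have "\<bar>sqrt (real n + 1)\<bar> * sqrt h = 1" using h(2) by (simp add: real_sqrt_mult[symmetric])
  ultimately show "distributed N lborel (\<lambda>\<omega>. scaled_increment n (\<lambda>t. B t \<omega>) i) std_normal_density"
    by (simp add: sample s_def t_def)
qed

theorem theorem5:
  fixes \<beta> :: real and k :: nat
    and M :: "nat \<Rightarrow> 'a measure" and \<xi> :: "nat \<Rightarrow> nat \<Rightarrow> 'a \<Rightarrow> real"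
    and N :: "'b measure" and B :: "real \<Rightarrow> 'b \<Rightarrow> real"
    and eig_matrix :: "nat \<Rightarrow> 'a \<Rightarrow> real" and eig_operator :: "'b \<Rightarrow> real"
  defines "eig_matrix \<equiv> \<lambda>n \<omega>.
      eigenvalues_decreasing (tridiagonal_matrix \<beta> n (\<lambda>i. \<xi> n i \<omega>)) ! (k - 1)"
    and "eig_operator \<equiv> \<lambda>\<omega>. schroedinger_eigenvalue \<beta> (\<lambda>t. B t \<omega>) k"
  assumes "\<beta> > 0" and "k \<ge> 1"
    and "\<And>n. n \<ge> k \<Longrightarrow> prob_space (M n)"
    and "\<And>n. n \<ge> k \<Longrightarrow> prob_space.indep_vars (M n) (\<lambda>_. borel) (\<xi> n) {1..n}"
    and "\<And>n i. n \<ge> k \<Longrightarrow> i \<in> {1..n} \<Longrightarrow> distributed (M n) lborel (\<xi> n i) std_normal_density"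
    and "standard_brownian_motion N B"
  shows "(\<forall>n\<ge>k. eig_matrix n \<in> borel_measurable (M n)) \<and>
         eig_operator \<in> borel_measurable N \<and>
         weak_conv_m (\<lambda>n. distr (M n) borel (eig_matrix n)) (distr N borel eig_operator)"
proof -
  have \<beta>: "\<beta> \<noteq> 0" using \<open>\<beta> > 0\<close> by simp
  note B = \<open>standard_brownian_motion N B\<close>
  note P = \<open>\<And>n. n \<ge> k \<Longrightarrow> prob_space (M n)\<close>
    and \<xi> = \<open>\<And>n. n \<ge> k \<Longrightarrow> prob_space.indep_vars (M n) (\<lambda>_. borel) (\<xi> n) {1..n}\<close>
    and d\<xi> = \<open>\<And>n i. n \<ge> k \<Longrightarrow> i \<in> {1..n} \<Longrightarrow> distributed (M n) lborel (\<xi> n i) std_normal_density\<close>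
  interpret N: prob_space N using B by (simp add: standard_brownian_motion_def)
  define S where "S n \<omega> i = scaled_increment n (\<lambda>t. B t \<omega>) i" for n \<omega> i
  define G where "G n x = eigenvalues_decreasing (tridiagonal_matrix \<beta> n x) ! (k - 1)" for n and x :: "nat \<Rightarrow> real"
  have S_iid: "N.indep_vars (\<lambda>_. borel) (\<lambda>i \<omega>. S n \<omega> i) {1..n}"
    "i \<in> {1..n} \<Longrightarrow> distributed N lborel (\<lambda>\<omega>. S n \<omega> i) std_normal_density" for n i
    unfolding S_def using increments_iid[OF B] by auto
  have mat: "eig_matrix n \<in> borel_measurable (M n)" if "n \<ge> k" for n
    unfolding eig_matrix_def
  proof (rule borel_measurable_eigenvalue[OF \<beta>])
    show "k - 1 < n" using that \<open>k \<ge> 1\<close> by simp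
    show "(\<lambda>\<omega>. \<xi> n i \<omega>) \<in> borel_measurable (M n)" if "i \<in> {1..n}" for i
      using distributed_measurable[OF d\<xi>[OF \<open>n \<ge> k\<close> that]] by simp
  qed
  have GS: "(\<lambda>\<omega>. G n (S n \<omega>)) \<in> borel_measurable N" if "n \<ge> k" for n
    unfolding G_def
  proof (rule borel_measurable_eigenvalue[OF \<beta>])
    show "k - 1 < n" using that \<open>k \<ge> 1\<close> by simp
    show "(\<lambda>\<omega>. S n \<omega> i) \<in> borel_measurable N" if "i \<in> {1..n}" for i
      using distributed_measurable[OF S_iid(2)[OF that]] by simp
  qed
  \<comment> \<open>Holds at every point of the space, not just almost surely, because every path is
    required to be continuous.\<close>
  have lim: "(\<lambda>n. G n (S n \<omega>)) \<longlonglongrightarrow> eig_operator \<omega>" if \<omega>: "\<omega> \<in> space N" for \<omega>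
  proof -
    interpret continuous_path \<beta> "\<lambda>t. B t \<omega>"
      using \<open>\<beta> > 0\<close> B \<omega> by unfold_locales (auto simp: standard_brownian_motion_def)
    have "S n \<omega> = grid_sample n" for n
      by (rule ext) (simp only: S_def scaled_increment_def grid_sample_def mesh_def)
    then show ?thesis
      using grid_eig_tendsto_schroedinger_eigenvalue[of k]
      by (simp add: grid_eig_def G_def eig_operator_def)
  qed
  have lim': "(\<lambda>n. G (n + k) (S (n + k) \<omega>)) \<longlonglongrightarrow> eig_operator \<omega>" if "\<omega> \<in> space N" for \<omega>
    using lim[OF that] by (rule LIMSEQ_ignore_initial_segment)
  \<comment> \<open>The eigenvalue of the operator comes from a \<open>THE\<close>, so its
    measurability is obtained from the matrices, as a pointwise limit.\<close>
  have op: "eig_operator \<in> borel_measurable N"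
    by (rule borel_measurable_LIMSEQ_real[OF lim' GS]) simp_all
  have law: "distr (M n) borel (eig_matrix n) = distr N borel (\<lambda>\<omega>. G n (S n \<omega>))" if n: "n \<ge> k" for n
  proof -
    have I: "{1..n} \<noteq> {}" using n \<open>k \<ge> 1\<close> by simp
    have Gm: "G n \<in> borel_measurable (PiM {1..n} (\<lambda>_. borel))"
      unfolding G_def
    proof (rule borel_measurable_eigenvalue[OF \<beta>])
      show "k - 1 < n" using n \<open>k \<ge> 1\<close> by simp
    qed simp
    have Gr: "G n (restrict x {1..n}) = G n x" for x
      unfolding G_def tridiagonal_matrix_restrict ..
    have "distr (M n) borel (\<lambda>\<omega>. G n (\<lambda>i. \<xi> n i \<omega>)) = distr N borel (\<lambda>\<omega>. G n (\<lambda>i. S n \<omega> i))"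
      by (rule trans[OF prob_space.distr_of_iid[OF P[OF n] I \<xi>[OF n] d\<xi>[OF n] Gm Gr]
            N.distr_of_iid[OF I S_iid Gm Gr, symmetric]])
    then show ?thesis by (simp add: G_def eig_matrix_def)
  qed
  have "weak_conv_m (\<lambda>n. distr N borel (\<lambda>\<omega>. G (n + k) (S (n + k) \<omega>))) (distr N borel eig_operator)"
    by (rule N.pointwise_convergence_imp_weak_conv[OF GS op lim']) simp_all
  then have "weak_conv_m (\<lambda>n. distr (M (n + k)) borel (eig_matrix (n + k))) (distr N borel eig_operator)"
    by (simp add: law)
  then have "weak_conv_m (\<lambda>n. distr (M n) borel (eig_matrix n)) (distr N borel eig_operator)"
    by (rule weak_conv_m_offset)
  with mat op show ?thesis by blast
qed

end
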